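(* Let $u$ be a solution of the thin eigenvalue problem in $\Omega$ and assume also that $u_y\le 0$ in $\Omega\times\mathbb{R}^+$. Then $$\partial\{u(\cdot,0)<0\}\subset\partial\{u(\cdot,0)>0\}.$$ In particular, if $w$ is a solution of $(-\Delta)^s w=\lambda(w-\gamma)_+$ in $\Omega$ with $w=0$ on $\partial\Omega$, where $\lambda,\gamma>0$, then $\partial\{w<\gamma\}\subset\partial\{w>\gamma\}$.
   Context: $\Omega\subset\mathbb{R}^n$ is a smooth bounded domain, $0<s<1$, $a=1-2s$, $\lambda>0$, $\mathbb{R}^+=(0,\infty)$, points of $\mathbb{R}^{n+1}$ are $(x,y)$ with $x\in\mathbb{R}^n$, $y\in\mathbb{R}$. For $U\subset\{y>0\}$ open, $L^2(a,U)=\{f: f\,y^{a/2}\in L^2(U)\}$ and $H^1(a,U)=\{f: f,\nabla f\in L^2(a,U)\}$. A solution of the thin eigenvalue problem in $\Omega$ is a function $u$ with $u\in H^1(a,\Omega\times(0,T))$ for every $T>0$ satisfying $\operatorname{div}(y^a\nabla u)=0$ in $\Omega\times\mathbb{R}^+$ and $\lim_{y\to0^+}y^a u_y(x,y)=-\lambda u_+(x,0)$ for $x\in\Omega$, in the weak sense: $\int_{\Omega\times\mathbb{R}^+}y^a\nabla u\cdot\nabla\psi\,dx\,dy=\lambda\int_\Omega u_+(x,0)\psi(x,0)\,dx$ for all $\psi\in C_c^\infty(\Omega\times\mathbb{R})$. $u(\cdot,0)$ is the trace on $\Omega\times\{0\}$, identified with its continuous representative; $t_+=\max(t,0)$. $(-\Delta)^s$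 is the spectral fractional Laplacian on $\Omega$: if $\{\lambda_k\},\{\phi_k\}$ are the Dirichlet eigenvalues and orthonormal eigenfunctions of $-\Delta$ on $\Omega$ and $f=\sum_k a_k\phi_k$, then $(-\Delta)^sf=\sum_k\lambda_k^sa_k\phi_k$; solutions $w$ are taken in the energy space $\{\sum_k a_k\phi_k:\sum_k\lambda_k^sa_k^2<\infty\}$ and identified with their continuous representative. All sets are subsets of $\Omega$ and boundaries are taken relative to $\Omega$. *)

theory Defs
  imports "HOL-Analysis.Analysis"
begin

section \<open>Smooth functions, test functions and smooth domains\<close>

(* Meaningful for open S. *)
primrec Ck_on :: "nat \<Rightarrow> 'a::euclidean_space set \<Rightarrow> ('a \<Rightarrow> real) \<Rightarrow> bool" where
  "Ck_on 0 S f \<longleftrightarrow> continuous_on S f"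
| "Ck_on (Suc k) S f \<longleftrightarrow>
     (\<forall>x\<in>S. f differentiable (at x)) \<and> (\<forall>v. Ck_on k S (\<lambda>x. frechet_derivative f (at x) v))"

definition smooth_on :: "'a::euclidean_space set \<Rightarrow> ('a \<Rightarrow> real) \<Rightarrow> bool" where
  "smooth_on S f \<longleftrightarrow> (\<forall>k. Ck_on k S f)"

definition grad :: "('a::euclidean_space \<Rightarrow> real) \<Rightarrow> 'a \<Rightarrow> 'a" where
  "grad f x = (\<Sum>b\<in>Basis. frechet_derivative f (at x) b *\<^sub>R b)"

definition test_function :: "'a::euclidean_space set \<Rightarrow> ('a \<Rightarrow> real) \<Rightarrow> bool" where
  "test_function U \<psi> \<longleftrightarrow>
     smooth_on UNIV \<psi> \<and> compact (closure {x. \<psi> x \<noteq> 0}) \<and> closure {x. \<psi> x \<noteq> 0} \<subseteq> U"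

(* The boundary is smooth in the sense of local defining functions with nonvanishing gradient;
   in dimension one these domains are exactly the bounded open intervals. *)
definition smooth_bounded_domain :: "'a::euclidean_space set \<Rightarrow> bool" where
  "smooth_bounded_domain \<Omega> \<longleftrightarrow>
     open \<Omega> \<and> connected \<Omega> \<and> bounded \<Omega> \<and> \<Omega> \<noteq> {} \<and>
     (\<forall>p\<in>frontier \<Omega>. \<exists>V \<rho>. open V \<and> p \<in> V \<and> smooth_on V \<rho> \<and>
        (\<forall>x\<in>V. grad \<rho> x \<noteq> 0) \<and> \<Omega> \<inter> V = {x\<in>V. \<rho> x < 0})"


section \<open>Weighted Lebesgue and Sobolev spaces\<close>

definition L2 :: "'a::euclidean_space set \<Rightarrow> ('a \<Rightarrow> 'b::euclidean_space) set" where
  "L2 U = {f. f \<in> borel_measurable (lebesgue_on U) \<and>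
              integrable (lebesgue_on U) (\<lambda>x. (norm (f x))\<^sup>2)}"

definition L2_lim ::
  "'a::euclidean_space set \<Rightarrow> (nat \<Rightarrow> 'a \<Rightarrow> 'b::euclidean_space) \<Rightarrow> ('a \<Rightarrow> 'b) \<Rightarrow> bool" where
  "L2_lim U F f \<longleftrightarrow> f \<in> L2 U \<and> (\<forall>k. F k \<in> L2 U) \<and>
     (\<lambda>k. LINT x|lebesgue_on U. (norm (F k x - f x))\<^sup>2) \<longlonglongrightarrow> 0"

(* Points of the half space are pairs (x, y). *)
definition weighted ::
  "real \<Rightarrow> ('a \<times> real \<Rightarrow> 'b::euclidean_space) \<Rightarrow> 'a \<times> real \<Rightarrow> 'b" where
  "weighted a f z = (snd z) powr (a / 2) *\<^sub>R f z"

definition has_weak_gradient ::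
  "'a::euclidean_space set \<Rightarrow> ('a \<Rightarrow> real) \<Rightarrow> ('a \<Rightarrow> 'a) \<Rightarrow> bool" where
  "has_weak_gradient U u G \<longleftrightarrow>
     (\<forall>K. compact K \<and> K \<subseteq> U \<longrightarrow> integrable (lebesgue_on K) u \<and> integrable (lebesgue_on K) G) \<and>
     (\<forall>\<psi>. test_function U \<psi> \<longrightarrow>
        (LINT x|lebesgue_on U. u x *\<^sub>R grad \<psi> x) = - (LINT x|lebesgue_on U. \<psi> x *\<^sub>R G x))"

(* u belongs to H^1(a, U), with weak gradient Du *)
definition in_H1 ::
  "real \<Rightarrow> ('a::euclidean_space \<times> real) set \<Rightarrow> ('a \<times> real \<Rightarrow> real) \<Rightarrow>
     ('a \<times> real \<Rightarrow> 'a \<times> real) \<Rightarrow> bool" where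
  "in_H1 a U u Du \<longleftrightarrow> has_weak_gradient U u Du \<and> weighted a u \<in> L2 U \<and> weighted a Du \<in> L2 U"

(* u0 is the trace on \<Omega> \<times> {0} of u, an element of H^1(a, \<Omega> \<times> (0,T)): the value at u of the
   continuous extension of the restriction map v \<mapsto> v(.,0) on functions v smooth up to
   the boundary. *)
definition has_trace ::
  "real \<Rightarrow> 'a::euclidean_space set \<Rightarrow> real \<Rightarrow> ('a \<times> real \<Rightarrow> real) \<Rightarrow>
     ('a \<times> real \<Rightarrow> 'a \<times> real) \<Rightarrow> ('a \<Rightarrow> real) \<Rightarrow> bool" where
  "has_trace a \<Omega> T u Du u0 \<longleftrightarrow>
     (\<exists>v. (\<forall>k. smooth_on UNIV (v k)) \<and>
          L2_lim (\<Omega> \<times> {0<..<T}) (\<lambda>k. weighted a (v k)) (weighted a u) \<and>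
          L2_lim (\<Omega> \<times> {0<..<T}) (\<lambda>k. weighted a (grad (v k))) (weighted a Du) \<and>
          L2_lim \<Omega> (\<lambda>k x. v k (x, 0)) u0)"


section \<open>The thin eigenvalue problem\<close>

(* u is a solution with weak gradient Du, and u0 is the continuous representative of the
   trace u(.,0). *)
definition thin_eigen_solution ::
  "'a::euclidean_space set \<Rightarrow> real \<Rightarrow> real \<Rightarrow> ('a \<times> real \<Rightarrow> real) \<Rightarrow>
     ('a \<times> real \<Rightarrow> 'a \<times> real) \<Rightarrow> ('a \<Rightarrow> real) \<Rightarrow> bool" where
  "thin_eigen_solution \<Omega> a lam u Du u0 \<longleftrightarrow>
     (\<forall>T>0. in_H1 a (\<Omega> \<times> {0<..<T}) u Du \<and> has_trace a \<Omega> T u Du u0) \<and>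
     continuous_on \<Omega> u0 \<and>
     (\<forall>\<psi>. test_function (\<Omega> \<times> UNIV) \<psi> \<longrightarrow>
        (LINT z|lebesgue_on (\<Omega> \<times> {0<..}). (snd z) powr a * (Du z \<bullet> grad \<psi> z)) =
        lam * (LINT x|lebesgue_on \<Omega>. max (u0 x) 0 * \<psi> (x, 0)))"


section \<open>The spectral fractional Laplacian\<close>

(* f belongs to H^1_0(\<Omega>), with weak gradient G *)
definition in_H10 :: "'a::euclidean_space set \<Rightarrow> ('a \<Rightarrow> real) \<Rightarrow> ('a \<Rightarrow> 'a) \<Rightarrow> bool" where
  "in_H10 \<Omega> f G \<longleftrightarrow>
     (\<exists>\<psi>. (\<forall>k. test_function \<Omega> (\<psi> k)) \<and> L2_lim \<Omega> \<psi> f \<and> L2_lim \<Omega> (\<lambda>k. grad (\<psi> k)) G)"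

definition dirichlet_eigenfunction ::
  "'a::euclidean_space set \<Rightarrow> real \<Rightarrow> ('a \<Rightarrow> real) \<Rightarrow> bool" where
  "dirichlet_eigenfunction \<Omega> \<mu> f \<longleftrightarrow>
     (\<exists>G. in_H10 \<Omega> f G \<and>
       (\<forall>\<psi>. test_function \<Omega> \<psi> \<longrightarrow>
          (LINT x|lebesgue_on \<Omega>. G x \<bullet> grad \<psi> x) = \<mu> * (LINT x|lebesgue_on \<Omega>. f x * \<psi> x)))"

definition L2_sums ::
  "'a::euclidean_space set \<Rightarrow> (nat \<Rightarrow> 'a \<Rightarrow> real) \<Rightarrow> (nat \<Rightarrow> real) \<Rightarrow> ('a \<Rightarrow> real) \<Rightarrow> bool" where
  "L2_sums \<Omega> \<phi> c f \<longleftrightarrow> L2_lim \<Omega> (\<lambda>N x. \<Sum>k<N. c k * \<phi> k x) f"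

(* All Dirichlet eigenvalues, repeated with multiplicity and in any order, with eigenfunctions
   forming an orthonormal basis of L^2(\<Omega>) *)
definition dirichlet_eigensystem ::
  "'a::euclidean_space set \<Rightarrow> (nat \<Rightarrow> real) \<Rightarrow> (nat \<Rightarrow> 'a \<Rightarrow> real) \<Rightarrow> bool" where
  "dirichlet_eigensystem \<Omega> \<mu> \<phi> \<longleftrightarrow>
     (\<forall>k. dirichlet_eigenfunction \<Omega> (\<mu> k) (\<phi> k)) \<and>
     (\<forall>j k. (LINT x|lebesgue_on \<Omega>. \<phi> j x * \<phi> k x) = (if j = k then 1 else 0)) \<and>
     (\<forall>f\<in>L2 \<Omega>. L2_sums \<Omega> \<phi> (\<lambda>k. LINT x|lebesgue_on \<Omega>. f x * \<phi> k x) f)"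

(* w lies in the energy space and (-\<Delta>)^s w = g, where g is in L^2(\<Omega>). For w in the energy
   space the series of (-\<Delta>)^s w converges in the dual of that space; if its sum is an
   L^2 function g, then its coefficients are those of g and it converges in L^2.
   The condition w = 0 on the boundary is the one carried by the energy space. *)
definition spectral_frac_laplacian ::
  "'a::euclidean_space set \<Rightarrow> (nat \<Rightarrow> real) \<Rightarrow> (nat \<Rightarrow> 'a \<Rightarrow> real) \<Rightarrow> real \<Rightarrow>
     ('a \<Rightarrow> real) \<Rightarrow> ('a \<Rightarrow> real) \<Rightarrow> bool" where
  "spectral_frac_laplacian \<Omega> \<mu> \<phi> s w g \<longleftrightarrow>
     (\<exists>c. L2_sums \<Omega> \<phi> c w \<and> summable (\<lambda>k. \<mu> k powr s * (c k)\<^sup>2) \<and>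
          L2_sums \<Omega> \<phi> (\<lambda>k. \<mu> k powr s * c k) g)"

end

(* Both inclusions follow from one observation: near a point c where f(c) = 0 and f <= 0, the
   function f (the trace u(.,0), resp. w - gamma) is weakly subharmonic, so the strong maximum
   principle forces f = 0 near c, and c is not a boundary point of {f < 0}.

   For the thin problem, test the equation with phi(x) chi(y/h), where chi decreases on (0,oo) and
   phi >= 0 is supported in {u(.,0) <= 0}. Since u_y <= 0, the term with chi' has a sign, and as
   h -> 0 what remains is  int u(x,0) Laplace phi(x) dx >= 0.

   For the spectral problem no extension is needed. With g = lambda (w - gamma)_+ and eta >= 0
   supported in {g = 0},  int w Laplace eta = - <(-Laplace)^(1-s) eta, g>, and
   m^sigma = C int_0^oo t^(sigma-1) m/(t+m) dt  reduces the sign of the right-hand side to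
   positivity of the resolvents:  <(t - Laplace)^(-1) eta, g> >= 0. *)

theory Submission
  imports Defs "HOL-Computational_Algebra.Polynomial"
begin

section \<open>Smooth functions\<close>

text \<open>For the thin problem two vector fields on a slab of height h share the x-component y^a
  chi grad \<phi>. One, \<open>Y\<close>, comes from the equation. The other, \<open>Z\<close>, is
  divergence free in the slab, so for v smooth up to y = 0 its pairing with grad v is exactly -
  \<open>W 0\<close> times the integral of v(x,0) Laplace \<phi>. This identity survives the L2
  limits that define the trace, so no further regularity of u enters. Subtracting the two leaves
  only u_y: besides the signed chi' term there is a term bounded by \<open>W 0\<close> times C times
  the integral of |u_y| over the slab. Dividing by \<open>W 0\<close> makes the constant independent
  of h, and u_y is integrable near y = 0 because a < 1, so this remainder vanishes with h. For the
  spectral problem the disjoint supports of g and \<eta> enter twice: they give |g - \<eta>| = g +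
  \<eta>, to which positivity of the resolvents is reduced, and <\<eta>, g> = 0, so that only the
  resolvent part of m/(t+m) = 1 - t/(t+m) contributes.\<close>

definition dir_deriv :: "'a::euclidean_space \<Rightarrow> ('a \<Rightarrow> real) \<Rightarrow> 'a \<Rightarrow> real" where
  "dir_deriv v f = (\<lambda>x. frechet_derivative f (at x) v)"

definition laplacian :: "('a::euclidean_space \<Rightarrow> real) \<Rightarrow> 'a \<Rightarrow> real" where
  "laplacian f x = (\<Sum>b\<in>Basis. dir_deriv b (dir_deriv b f) x)"

lemma dir_deriv_eq:
  assumes "\<And>x. (f has_derivative f' x) (at x)"
  shows "dir_deriv v f = (\<lambda>x. f' x v)"
  using frechet_derivative_at[OF assms] by (auto simp: dir_deriv_def fun_eq_iff)

text \<open>Coinduction for smoothness: \<open>Ck_on\<close> recurses into directional derivatives,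
  so an induction on k over all members of \<open>F\<close> at once stays inside
  \<open>F\<close>.\<close>

lemma smooth_onI_closed_family:
  assumes "f \<in> F"
    and "\<And>f x. f \<in> F \<Longrightarrow> f differentiable (at x)"
    and "\<And>f v. f \<in> F \<Longrightarrow> dir_deriv v f \<in> F"
  shows "smooth_on UNIV f"
proof -
  have "Ck_on k UNIV f" if "f \<in> F" for k f
    using that
  proof (induction k arbitrary: f)
    case 0
    then show ?case
      using assms(2) by (simp add: continuous_on_eq_continuous_at differentiable_imp_continuous_within)
  next
    case (Suc k)
    then show ?case
      using assms(2,3) by (auto simp: dir_deriv_def)
  qed
  then show ?thesis
    using assms(1) by (simp add: smooth_on_def)
qed

lemma smooth_on_differentiable: "smooth_on UNIV f \<Longrightarrow> f differentiable (at x)"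
  unfolding smooth_on_def by (metis Ck_on.simps(2) UNIV_I)

lemma smooth_on_has_derivative:
  "smooth_on UNIV f \<Longrightarrow> (f has_derivative (\<lambda>v. dir_deriv v f x)) (at x)"
  using smooth_on_differentiable frechet_derivative_works by (fastforce simp: dir_deriv_def)

lemma smooth_on_continuous: "smooth_on UNIV f \<Longrightarrow> continuous_on UNIV f"
  unfolding smooth_on_def by (metis Ck_on.simps(1))

lemma smooth_on_dir_deriv: "smooth_on UNIV f \<Longrightarrow> smooth_on UNIV (dir_deriv v f)"
  unfolding smooth_on_def dir_deriv_def by (metis Ck_on.simps(2))

section \<open>Algebras generated by smooth functions\<close>

inductive_set alg :: "('a::euclidean_space \<Rightarrow> real) set \<Rightarrow> ('a \<Rightarrow> real) set" for F where
  base: "f \<in> F \<Longrightarrow> f \<in> alg F"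
| const: "(\<lambda>x. c) \<in> alg F"
| add: "f \<in> alg F \<Longrightarrow> g \<in> alg F \<Longrightarrow> (\<lambda>x. f x + g x) \<in> alg F"
| mult: "f \<in> alg F \<Longrightarrow> g \<in> alg F \<Longrightarrow> (\<lambda>x. f x * g x) \<in> alg F"

lemma alg_sum:
  "(\<And>i. i \<in> I \<Longrightarrow> f i \<in> alg F) \<Longrightarrow> (\<lambda>x. \<Sum>i\<in>I. f i x) \<in> alg F"
  by (induction I rule: infinite_finite_induct) (auto intro: alg.intros)

lemma has_derivative_dir_deriv:
  "f differentiable (at x) \<Longrightarrow> (f has_derivative (\<lambda>v. dir_deriv v f x)) (at x)"
  using frechet_derivative_works by (fastforce simp: dir_deriv_def)

lemma dir_deriv_const [simp]: "dir_deriv v (\<lambda>x. c) = (\<lambda>x. 0)"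
  by (simp add: dir_deriv_def)

lemma dir_deriv_add:
  assumes "\<And>x. f differentiable (at x)" "\<And>x. g differentiable (at x)"
  shows "dir_deriv v (\<lambda>x. f x + g x) = (\<lambda>x. dir_deriv v f x + dir_deriv v g x)"
  using dir_deriv_eq[OF has_derivative_add[OF has_derivative_dir_deriv has_derivative_dir_deriv]]
    assms by blast

lemma dir_deriv_mult:
  assumes "\<And>x. f differentiable (at x)" "\<And>x. g differentiable (at x)"
  shows "dir_deriv v (\<lambda>x. f x * g x) = (\<lambda>x. f x * dir_deriv v g x + dir_deriv v f x * g x)"
  using dir_deriv_eq[OF has_derivative_mult[OF has_derivative_dir_deriv has_derivative_dir_deriv]]
    assms by blast

text \<open>By the product rule the generated algebra is closed under differentiation as soon as the
  derivatives of the generators are polynomial in the generators. Smoothness of a concrete function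
  then takes one first derivative and no formula for the higher ones.\<close>

lemma smooth_on_alg:
  assumes "f \<in> alg F"
    and diff: "\<And>f x. f \<in> F \<Longrightarrow> f differentiable (at x)"
    and closed: "\<And>f v. f \<in> F \<Longrightarrow> dir_deriv v f \<in> alg F"
  shows "smooth_on UNIV f"
proof (rule smooth_onI_closed_family[OF assms(1)])
  show d: "f differentiable (at x)" if "f \<in> alg F" for f x
    using that by induction (use diff in auto)
  show "dir_deriv v f \<in> alg F" if "f \<in> alg F" for f v
    using that
  proof induction
    case (add f g)
    then show ?case by (simp add: dir_deriv_add d alg.add)
  next
    case (mult f g)
    then show ?case by (simp add: dir_deriv_mult d alg.add alg.mult)
  qed (auto intro: closed alg.const)
qed

lemma smooth_on_in_alg:
  assumes "f \<in> alg {f. smooth_on UNIV f}"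
  shows "smooth_on UNIV f"
  by (rule smooth_on_alg[OF assms]) (auto intro: smooth_on_differentiable alg.base smooth_on_dir_deriv)

lemma smooth_on_const: "smooth_on UNIV (\<lambda>x. c)"
  by (intro smooth_on_in_alg alg.const)

lemma smooth_on_mult:
  "smooth_on UNIV f \<Longrightarrow> smooth_on UNIV g \<Longrightarrow> smooth_on UNIV (\<lambda>x. f x * g x)"
  by (intro smooth_on_in_alg alg.mult alg.base) auto

lemma smooth_on_sum:
  "(\<And>i. i \<in> I \<Longrightarrow> smooth_on UNIV (f i)) \<Longrightarrow> smooth_on UNIV (\<lambda>x. \<Sum>i\<in>I. f i x)"
  by (intro smooth_on_in_alg alg_sum alg.base) auto

lemma smooth_on_laplacian: "smooth_on UNIV f \<Longrightarrow> smooth_on UNIV (laplacian f)"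
  unfolding laplacian_def[abs_def] by (intro smooth_on_sum smooth_on_dir_deriv)

lemma dir_deriv_sum:
  assumes "\<And>i x. i \<in> I \<Longrightarrow> f i differentiable (at x)"
  shows "dir_deriv v (\<lambda>x. \<Sum>i\<in>I. f i x) = (\<lambda>x. \<Sum>i\<in>I. dir_deriv v (f i) x)"
  using dir_deriv_eq[OF has_derivative_sum[OF has_derivative_dir_deriv]]
    assms by blast

lemma grad_inner_Basis: "b \<in> Basis \<Longrightarrow> grad f x \<bullet> b = dir_deriv b f x"
  by (simp add: grad_def dir_deriv_def inner_sum_left inner_Basis if_distrib cong: if_cong)

lemma grad_eq: "grad f x = (\<Sum>b\<in>Basis. dir_deriv b f x *\<^sub>R b)"
  by (simp add: grad_def dir_deriv_def)

lemma dir_deriv_eq_grad: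
  assumes "f differentiable (at x)"
  shows "dir_deriv v f x = grad f x \<bullet> v"
proof -
  have "linear (\<lambda>v. dir_deriv v f x)"
    using has_derivative_dir_deriv[OF assms] has_derivative_linear by blast
  then have "dir_deriv (\<Sum>b\<in>Basis. (v \<bullet> b) *\<^sub>R b) f x = (\<Sum>b\<in>Basis. (v \<bullet> b) * dir_deriv b f x)"
    by (simp only: linear_sum[of "\<lambda>v. dir_deriv v f x"] linear_cmul[of "\<lambda>v. dir_deriv v f x"]
        real_scaleR_def)
  then show ?thesis
    unfolding euclidean_representation grad_eq inner_sum_left
    by (simp add: mult.commute inner_commute)
qed

lemma continuous_on_grad:
  "smooth_on UNIV f \<Longrightarrow> continuous_on UNIV (grad f)"
  unfolding grad_eq[abs_def]
  by (intro continuous_intros smooth_on_continuous smooth_on_dir_deriv)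

lemma grad_sum_scale:
  assumes "\<And>i. i \<in> I \<Longrightarrow> smooth_on UNIV (f i)"
  shows "grad (\<lambda>x. \<Sum>i\<in>I. c i * f i x) x = (\<Sum>i\<in>I. c i *\<^sub>R grad (f i) x)"
proof -
  have "dir_deriv b (\<lambda>x. \<Sum>i\<in>I. c i * f i x) x = (\<Sum>i\<in>I. c i * dir_deriv b (f i) x)" for b
    using assms
    by (subst dir_deriv_sum) (auto simp: dir_deriv_mult smooth_on_differentiable)
  then show ?thesis
    by (simp add: grad_eq scaleR_sum_left scaleR_sum_right sum.swap[of _ I])
qed

subsection \<open>Test functions\<close>

lemma test_function_smooth: "test_function U \<psi> \<Longrightarrow> smooth_on UNIV \<psi>"
  by (simp add: test_function_def)

lemma test_functionI:
  assumes "smooth_on UNIV \<psi>" "compact K" "K \<subseteq> U" "\<And>x. x \<notin> K \<Longrightarrow> \<psi> x = 0"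
  shows "test_function U \<psi>"
proof -
  have "closure {x. \<psi> x \<noteq> 0} \<subseteq> K"
    using assms by (intro closure_minimal) (auto intro: compact_imp_closed)
  moreover from this have "compact (closure {x. \<psi> x \<noteq> 0})"
    using assms(2) by (metis closed_Int_compact closed_closure inf.absorb1)
  ultimately show ?thesis
    using assms by (auto simp: test_function_def)
qed

lemma test_functionE:
  assumes "test_function U \<psi>"
  obtains K where "compact K" "K \<subseteq> U" "\<And>x. x \<notin> K \<Longrightarrow> \<psi> x = 0"
proof (rule that)
  show "\<psi> x = 0" if "x \<notin> closure {x. \<psi> x \<noteq> 0}" for x
    using that closure_subset[of "{x. \<psi> x \<noteq> 0}"] by blast
qed (use assms in \<open>auto simp: test_function_def\<close>)

lemma test_function_mono: "test_function U \<psi> \<Longrightarrow> U \<subseteq> V \<Longrightarrow> test_function V \<psi>"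
  by (auto simp: test_function_def)

lemma dir_deriv_zero_outside:
  assumes "closed K" "\<And>x. x \<notin> K \<Longrightarrow> f x = 0" "x \<notin> K"
  shows "dir_deriv v f x = 0"
proof -
  have "(f has_derivative (\<lambda>v. 0)) (at x)"
    by (rule has_derivative_transform_within_open[of "\<lambda>x. 0" _ _ _ "- K"]) (use assms in auto)
  from frechet_derivative_at[OF this, symmetric] show ?thesis
    by (simp add: dir_deriv_def)
qed

lemma grad_zero_outside:
  assumes "closed K" "\<And>x. x \<notin> K \<Longrightarrow> f x = 0" "x \<notin> K"
  shows "grad f x = 0"
  unfolding grad_eq by (simp add: dir_deriv_zero_outside[OF assms])

lemma test_function_dir_deriv:
  assumes "test_function U \<psi>"
  shows "test_function U (dir_deriv v \<psi>)"
proof -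
  obtain K where K: "compact K" "K \<subseteq> U" "\<And>x. x \<notin> K \<Longrightarrow> \<psi> x = 0"
    using test_functionE[OF assms] by blast
  show ?thesis
    by (rule test_functionI[OF _ K(1,2)])
      (use K assms in \<open>auto intro!: smooth_on_dir_deriv test_function_smooth[OF assms] dir_deriv_zero_outside[OF compact_imp_closed]\<close>)
qed

lemma test_function_sum:
  assumes "\<And>i. i \<in> I \<Longrightarrow> test_function U (f i)"
  shows "test_function U (\<lambda>x. \<Sum>i\<in>I. f i x)"
proof (cases "finite I")
  case True
  have "\<forall>i\<in>I. \<exists>K. compact K \<and> K \<subseteq> U \<and> (\<forall>x. x \<notin> K \<longrightarrow> f i x = 0)"
    using test_functionE[OF assms] by metis
  then obtain K where K: "\<And>i. i \<in> I \<Longrightarrow> compact (K i)" "\<And>i. i \<in> I \<Longrightarrow> K i \<subseteq> U"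
    "\<And>i x. i \<in> I \<Longrightarrow> x \<notin> K i \<Longrightarrow> f i x = 0"
    by metis
  show ?thesis
    by (rule test_functionI[of _ "\<Union>i\<in>I. K i"])
      (use K True assms in \<open>auto intro!: smooth_on_sum test_function_smooth[OF assms] compact_UN\<close>)
next
  case False
  then show ?thesis
    by (auto intro!: test_functionI[of _ "{}"] smooth_on_const)
qed

lemma test_function_scale:
  assumes "test_function U f"
  shows "test_function U (\<lambda>x. c * f x)"
proof -
  obtain K where K: "compact K" "K \<subseteq> U" "\<And>x. x \<notin> K \<Longrightarrow> f x = 0"
    using test_functionE[OF assms] by blast
  show ?thesis
    by (rule test_functionI[OF _ K(1,2)])
      (use K assms in \<open>auto intro!: smooth_on_mult smooth_on_const test_function_smooth[OF assms]\<close>)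
qed

lemma test_function_laplacian: "test_function U f \<Longrightarrow> test_function U (laplacian f)"
  unfolding laplacian_def[abs_def] by (intro test_function_sum test_function_dir_deriv)

lemma test_function_bounded:
  assumes "test_function U f"
  obtains C where "C > 0" "\<And>x. \<bar>f x\<bar> \<le> C"
proof -
  obtain K where K: "compact K" "K \<subseteq> U" "\<And>x. x \<notin> K \<Longrightarrow> f x = 0"
    using test_functionE[OF assms] by blast
  have "continuous_on K f"
    using smooth_on_continuous[OF test_function_smooth[OF assms]] continuous_on_subset by blast
  then have "bounded (f ` K)"
    by (intro compact_imp_bounded compact_continuous_image K)
  then obtain C where C: "C > 0" "\<forall>x\<in>K. \<bar>f x\<bar> \<le> C"
    by (auto simp: bounded_pos)
  show ?thesis
  proof (rule that[OF C(1)])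
    show "\<bar>f x\<bar> \<le> C" for x
      using C K(3)[of x] by (cases "x \<in> K") auto
  qed
qed

subsection \<open>Bump functions\<close>

text \<open>The polynomial in 1/t makes this family closed under differentiation;
  \<open>flat 1\<close> is the classical function exp(-1/t), extended by 0.\<close>

definition flat :: "real poly \<Rightarrow> real \<Rightarrow> real" where
  "flat p t = (if t > 0 then poly p (1 / t) * exp (- (1 / t)) else 0)"

text \<open>With w = 1/t one has dw/dt = - w^2, so the derivative of p(w) exp(-w) in t is w^2 (p -
  p')(w) exp(-w).\<close>

definition flat_deriv :: "real poly \<Rightarrow> real poly" where
  "flat_deriv p = monom 1 2 * (p - pderiv p)"

lemma tendsto_poly_exp_0: "((\<lambda>w::real. poly p w * exp (- w)) \<longlongrightarrow> 0) at_top"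
proof -
  have "((\<lambda>w::real. \<Sum>i\<le>degree p. coeff p i * (w ^ i / exp w)) \<longlongrightarrow> (\<Sum>i\<le>degree p. coeff p i * 0)) at_top"
    by (intro tendsto_intros tendsto_power_div_exp_0)
  then show ?thesis
    by (simp add: poly_altdef sum_distrib_right exp_minus divide_inverse mult.assoc)
qed

lemma flat_has_derivative: "(flat p has_real_derivative flat (flat_deriv p) t) (at t)"
proof -
  consider "t > 0" | "t < 0" | "t = 0" by linarith
  then show ?thesis
  proof cases
    case 1
    have "((\<lambda>t. poly p (1 / t) * exp (- (1 / t))) has_real_derivative
        (poly (pderiv p) (1 / t) * (- 1 / t\<^sup>2)) * exp (- (1/t)) + poly p (1 / t) * (exp (- (1 / t)) * (1 / t\<^sup>2))) (at t)"
      using 1 by (auto intro!: derivative_eq_intros DERIV_chain2[OF poly_DERIV] simp: power2_eq_square)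
    also have "(poly (pderiv p) (1 / t) * (- 1 / t\<^sup>2)) * exp (- (1/t)) + poly p (1 / t) * (exp (- (1 / t)) * (1 / t\<^sup>2))
        = flat (flat_deriv p) t"
      using 1 by (simp add: flat_def flat_deriv_def poly_monom field_simps power2_eq_square)
    finally show ?thesis
      by (rule has_field_derivative_transform_within_open[of _ _ _ "{0<..}"]) (use 1 in \<open>auto simp: flat_def\<close>)
  next
    case 2
    have "((\<lambda>t. 0) has_real_derivative flat (flat_deriv p) t) (at t)"
      using 2 by (simp add: flat_def)
    then show ?thesis
      by (rule has_field_derivative_transform_within_open[of _ _ _ "{..<0}"]) (use 2 in \<open>auto simp: flat_def\<close>)
  next
    case 3
    have R: "((\<lambda>y. flat p y / y) \<longlongrightarrow> 0) (at_right 0)"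
    proof -
      \<comment> \<open>The right difference quotient at 0 is w p(w) exp(-w) at w = 1/y; the extra
        factor w is absorbed into the polynomial.\<close>
      have "((\<lambda>t::real. poly (monom 1 1 * p) (inverse t) * exp (- (inverse t))) \<longlongrightarrow> 0) (at_right 0)"
        by (rule filterlim_compose[OF tendsto_poly_exp_0 filterlim_inverse_at_top_right])
      then show ?thesis
        by (rule Lim_transform_eventually)
          (auto simp: flat_def eventually_at_filter poly_monom field_simps)
    qed
    have "((\<lambda>y. flat p y / y) \<longlongrightarrow> 0) (at_left 0)"
      by (rule tendsto_eventually) (auto simp: flat_def eventually_at_filter)
    with R have "((\<lambda>y. flat p y / y) \<longlongrightarrow> 0) (at 0)"
      by (simp add: filterlim_at_split)
    then show ?thesis
      using 3 by (simp add: has_field_derivative_iff flat_def)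
  qed
qed

text \<open>The squared distance keeps the function smooth at the centre. The radius stays a
  parameter because the mean value argument differentiates in it.\<close>

definition bump :: "real poly \<Rightarrow> 'a::euclidean_space \<Rightarrow> real \<Rightarrow> 'a \<Rightarrow> real" where
  "bump p c r x = flat p (1 - (x - c) \<bullet> (x - c) / r\<^sup>2)"

lemma bump_has_derivative:
  "(bump p c r has_derivative (\<lambda>v. - (2 / r\<^sup>2) * ((x - c) \<bullet> v) * bump (flat_deriv p) c r x)) (at x)"
proof -
  have "((\<lambda>x. 1 - k * ((x - c) \<bullet> (x - c))) has_derivative (\<lambda>v. - (2 * k) * ((x - c) \<bullet> v))) (at x)" for k
    by (auto intro!: derivative_eq_intros simp: inner_commute)
  from this[of "1 / r\<^sup>2"]
  have "((\<lambda>x. 1 - (x - c) \<bullet> (x - c) / r\<^sup>2) has_derivative (\<lambda>v. - (2 / r\<^sup>2) * ((x - c) \<bullet> v))) (at x)"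
    by simp
  from has_derivative_compose[OF this flat_has_derivative[unfolded has_field_derivative_def]]
  show ?thesis
    by (simp add: bump_def[abs_def] mult.commute)
qed

lemma dir_deriv_bump:
  "dir_deriv v (bump p c r) = (\<lambda>x. (- (2 / r\<^sup>2) * ((x - c) \<bullet> v)) * bump (flat_deriv p) c r x)"
  using dir_deriv_eq[OF bump_has_derivative] by blast

lemma has_derivative_scaled_inner:
  "((\<lambda>x. k * ((x - c) \<bullet> w)) has_derivative (\<lambda>v. k * (v \<bullet> w))) (at x)"
  by (auto intro!: derivative_eq_intros)

lemma dir_deriv_scaled_inner: "dir_deriv v (\<lambda>x. k * ((x - c) \<bullet> w)) = (\<lambda>x. k * (v \<bullet> w))"
  by (rule dir_deriv_eq[OF has_derivative_scaled_inner])

lemma smooth_on_bump: "smooth_on UNIV (bump p c r)"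
proof -
  \<comment> \<open>Differentiating a bump produces a linear factor (x - c) . v, so these factors
    join the generators; their own derivatives are constants.\<close>
  define F where "F = range (\<lambda>p. bump p c r) \<union> range (\<lambda>(k, w) x. k * ((x - c) \<bullet> w))"
  have bump_F: "bump p c r \<in> F" for p
    by (simp add: F_def)
  have lin_F: "(\<lambda>x. k * ((x - c) \<bullet> w)) \<in> F" for k w
    unfolding F_def by (rule UnI2, rule range_eqI[of _ _ "(k, w)"]) simp
  have cases: "(\<exists>p. f = bump p c r) \<or> (\<exists>k w. f = (\<lambda>x. k * ((x - c) \<bullet> w)))" if "f \<in> F" for f
    using that unfolding F_def by (elim UnE rangeE) (auto split: prod.splits)
  show ?thesis
  proof (rule smooth_on_alg[OF alg.base[OF bump_F]])
    show "f differentiable (at x)" if "f \<in> F" for f x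
      using cases[OF that]
      by (elim disjE exE)
        (simp_all only: differentiableI[OF bump_has_derivative] differentiableI[OF has_derivative_scaled_inner])
    show "dir_deriv v f \<in> alg F" if "f \<in> F" for f v
      using cases[OF that]
    proof (elim disjE exE)
      fix p assume "f = bump p c r"
      then show ?thesis
        using alg.mult[OF alg.base[OF lin_F[of "- (2 / r\<^sup>2)" v]] alg.base[OF bump_F[of "flat_deriv p"]]]
        by (simp only: dir_deriv_bump)
    next
      fix k w assume "f = (\<lambda>x. k * ((x - c) \<bullet> w))"
      then show ?thesis
        using alg.const[of "k * (v \<bullet> w)" F] by (simp only: dir_deriv_scaled_inner)
    qed
  qed
qed

lemma bump_eq_0: "r > 0 \<Longrightarrow> x \<notin> cball c r \<Longrightarrow> bump p c r x = 0"
proof -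
  assume "r > 0" "x \<notin> cball c r"
  then have "norm (x - c) > r"
    by (simp add: dist_norm norm_minus_commute)
  then have "(norm (x - c))\<^sup>2 > r\<^sup>2"
    using \<open>r > 0\<close> by (simp add: power_strict_mono)
  then show ?thesis
    using \<open>r > 0\<close> by (simp add: bump_def flat_def power2_norm_eq_inner field_simps)
qed

lemma test_function_bump: "r > 0 \<Longrightarrow> cball c r \<subseteq> U \<Longrightarrow> test_function U (bump p c r)"
  by (rule test_functionI[OF smooth_on_bump compact_cball]) (auto simp: bump_eq_0)

text \<open>The profiles on the right are those that \<open>bump_radius_has_derivative\<close>
  yields when started from \<open>flat_deriv p\<close>; the maximum principle matches the two
  formulas.\<close>

lemma laplacian_bump:
  fixes c :: "'a::euclidean_space"
  shows "laplacian (bump p c r) x =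
    - (2 * DIM('a) / r\<^sup>2) * bump (flat_deriv p) c r x
    + (4 / r ^ 4) * ((x - c) \<bullet> (x - c)) * bump (flat_deriv (flat_deriv p)) c r x"
proof -
  have "dir_deriv b (dir_deriv b (bump p c r)) x =
      (4 / r ^ 4) * bump (flat_deriv (flat_deriv p)) c r x * (((x - c) \<bullet> b) * ((x - c) \<bullet> b))
      - (2 / r\<^sup>2) * bump (flat_deriv p) c r x" if "b \<in> Basis" for b
  proof -
    have "(\<lambda>x. - (2 / r\<^sup>2) * ((x - c) \<bullet> b)) differentiable (at x)" for x
      by (rule differentiableI[OF has_derivative_scaled_inner])
    then have eq: "dir_deriv b (dir_deriv b (bump p c r)) x =
        (- (2 / r\<^sup>2) * ((x - c) \<bullet> b)) * dir_deriv b (bump (flat_deriv p) c r) x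
        + (- (2 / r\<^sup>2) * (b \<bullet> b)) * bump (flat_deriv p) c r x"
      unfolding dir_deriv_bump[of b p]
      by (simp only: dir_deriv_mult smooth_on_differentiable[OF smooth_on_bump] dir_deriv_scaled_inner)
    show ?thesis
      unfolding eq using that by (simp add: dir_deriv_bump power4_eq_xxxx power2_eq_square mult.assoc)
  qed
  then have "laplacian (bump p c r) x =
     (\<Sum>b\<in>Basis. (4 / r ^ 4) * bump (flat_deriv (flat_deriv p)) c r x * (((x - c) \<bullet> b) * ((x - c) \<bullet> b))
      - (2 / r\<^sup>2) * bump (flat_deriv p) c r x)"
    by (simp add: laplacian_def)
  also have "\<dots> = (4 / r ^ 4) * bump (flat_deriv (flat_deriv p)) c r x * (\<Sum>b\<in>Basis. ((x - c) \<bullet> b) * ((x - c) \<bullet> b))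
      - (\<Sum>b\<in>(Basis::'a set). (2 / r\<^sup>2) * bump (flat_deriv p) c r x)"
    by (simp add: sum_subtractf sum_distrib_left)
  finally show ?thesis
    by (simp add: euclidean_inner[of "x - c" "x - c"] mult_ac)
qed

section \<open>Integration\<close>

lemma integral_lebesgue_on_borel:
  fixes f :: "'a::euclidean_space \<Rightarrow> 'b::euclidean_space"
  assumes "U \<in> sets borel" "f \<in> borel_measurable borel"
  shows "(LINT x|lebesgue_on U. f x) = (LINT x|lborel. indicator U x *\<^sub>R f x)"
  using assms by (subst integral_restrict_space) (auto intro!: integral_completion)

lemma integrable_lebesgue_on_borel:
  fixes f :: "'a::euclidean_space \<Rightarrow> 'b::euclidean_space"
  assumes "U \<in> sets borel" "f \<in> borel_measurable borel"
  shows "integrable (lebesgue_on U) f \<longleftrightarrow> integrable lborel (\<lambda>x. indicator U x *\<^sub>R f x)"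
  using assms by (subst integrable_restrict_space) (auto intro!: integrable_completion)

lemma integrable_lborel_compact_support:
  fixes f :: "'a::euclidean_space \<Rightarrow> 'b::euclidean_space"
  assumes "compact K" "continuous_on UNIV f" "\<And>x. x \<notin> K \<Longrightarrow> f x = 0"
  shows "integrable lborel f"
proof -
  have "integrable lborel (\<lambda>x. indicator K x *\<^sub>R f x)"
    using assms by (intro borel_integrable_compact) (auto intro: continuous_on_subset)
  also have "(\<lambda>x. indicator K x *\<^sub>R f x) = f"
    using assms by (auto simp: fun_eq_iff indicator_def)
  finally show ?thesis .
qed

lemma lborel_integrable_translation:
  fixes f :: "'a::euclidean_space \<Rightarrow> 'b::euclidean_space"
  assumes "integrable lborel f"
  shows "integrable lborel (\<lambda>x. f (c + x))"
proof -
  have "integrable (distr lborel borel ((+) c)) f"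
    using assms by (simp add: lborel_distr_plus)
  then show ?thesis
    by (rule integrable_distr[rotated]) simp
qed

lemma lborel_integral_translation:
  fixes f :: "'a::euclidean_space \<Rightarrow> 'b::euclidean_space"
  assumes [measurable]: "f \<in> borel_measurable borel"
  shows "(LINT x|lborel. f (c + x)) = (LINT x|lborel. f x)"
proof -
  have "(LINT x|lborel. f x) = (LINT x|distr lborel borel ((+) c). f x)"
    by (simp add: lborel_distr_plus)
  also have "\<dots> = (LINT x|lborel. f (c + x))"
    by (rule integral_distr) auto
  finally show ?thesis by simp
qed

text \<open>The difference quotients have integral zero by translation invariance.\<close>

lemma integral_derivative_eq_0:
  fixes h :: "'a::euclidean_space \<Rightarrow> real"
  assumes der: "\<And>x. (h has_derivative h' x) (at x)"
    and cont: "continuous_on UNIV (\<lambda>x. h' x e)"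
    and K: "compact K" "\<And>x. x \<notin> K \<Longrightarrow> h x = 0"
  shows "(LINT x|lborel. h' x e) = 0"
proof -
  have conth: "continuous_on UNIV h"
    using der has_derivative_continuous continuous_at_imp_continuous_on by blast
  note inth = integrable_lborel_compact_support[OF K(1) conth K(2)]
  obtain R where R: "\<And>x. x \<in> K \<Longrightarrow> norm x \<le> R"
    using compact_imp_bounded[OF K(1)] by (auto simp: bounded_iff)
  \<comment> \<open>\<open>S\<close> contains every x for which x or x + t e lies in
    \<open>K\<close> with 0 < t <= 1. The larger \<open>S'\<close> also contains the intermediate
    points of the mean value theorem, where the derivative must be bounded.\<close>
  define S where "S = cball (0::'a) (R + norm e)"
  define S' where "S' = cball (0::'a) (R + norm e + norm e)"
  have "bounded ((\<lambda>x. h' x e) ` S')"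
    unfolding S'_def
    by (intro compact_imp_bounded compact_continuous_image continuous_on_subset[OF cont] compact_cball) auto
  then obtain C where C: "\<And>x. x \<in> S' \<Longrightarrow> \<bar>h' x e\<bar> \<le> C"
    by (auto simp: bounded_iff)
  define t where "t k = 1 / real (Suc k)" for k
  have t: "0 < t k" "t k \<le> 1" for k by (auto simp: t_def)
  define q where "q k x = (h (t k *\<^sub>R e + x) - h x) / t k" for k x
  have dh: "((\<lambda>s. h (s *\<^sub>R e + x)) has_real_derivative h' (s *\<^sub>R e + x) e) (at s)" for s x
  proof -
    have "((\<lambda>s. s *\<^sub>R e + x) has_derivative (\<lambda>r. r *\<^sub>R e)) (at s)"
      by (auto intro!: derivative_eq_intros)
    from has_derivative_compose[OF this der]
    have "((\<lambda>s. h (s *\<^sub>R e + x)) has_derivative (\<lambda>r. h' (s *\<^sub>R e + x) (r *\<^sub>R e))) (at s)" .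
    moreover have "h' y (r *\<^sub>R e) = h' y e * r" for y r
      using linear_cmul[OF has_derivative_linear[OF der]] by simp
    ultimately show ?thesis
      by (simp add: has_field_derivative_def)
  qed
  have lim: "(\<lambda>k. LINT x|lborel. q k x) \<longlonglongrightarrow> (LINT x|lborel. h' x e)"
  proof (rule integral_dominated_convergence[where w="\<lambda>x. indicator S x *\<^sub>R C"])
    show "(\<lambda>x. h' x e) \<in> borel_measurable lborel"
      using borel_measurable_continuous_onI[OF cont] by simp
    have [measurable]: "h \<in> borel_measurable borel"
      using borel_measurable_continuous_onI[OF conth] .
    show "q k \<in> borel_measurable lborel" for k
      unfolding q_def[abs_def] by measurable
    show "integrable lborel (\<lambda>x. indicator S x *\<^sub>R C)"
      unfolding S_def by (intro borel_integrable_compact) auto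
    show "AE x in lborel. (\<lambda>k. q k x) \<longlonglongrightarrow> h' x e"
    proof (rule AE_I2)
      fix x
      have t0: "filterlim t (at 0) sequentially"
        unfolding filterlim_at
      proof
        have "t = (\<lambda>k. inverse (real (Suc k)))"
          by (simp add: t_def fun_eq_iff inverse_eq_divide)
        then show "t \<longlonglongrightarrow> 0"
          using LIMSEQ_inverse_real_of_nat by simp
        show "\<forall>\<^sub>F k in sequentially. t k \<in> UNIV \<and> t k \<noteq> 0"
          using t(1) by (intro always_eventually) (auto simp: less_imp_neq[symmetric])
      qed
      have "((\<lambda>s. (h (s *\<^sub>R e + x) - h x) / s) \<longlongrightarrow> h' x e) (at 0)"
        using dh[of x 0] by (simp add: has_field_derivative_iff)
      from filterlim_compose[OF this t0] show "(\<lambda>k. q k x) \<longlonglongrightarrow> h' x e"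
        by (simp add: q_def)
    qed
    show "AE x in lborel. norm (q k x) \<le> indicator S x *\<^sub>R C" for k
    proof (rule AE_I2)
      fix x
      show "norm (q k x) \<le> indicator S x *\<^sub>R C"
      proof (cases "x \<in> S")
        case True
        obtain z where z: "0 < z" "z < t k" "h (t k *\<^sub>R e + x) - h (0 *\<^sub>R e + x) = (t k - 0) * h' (z *\<^sub>R e + x) e"
          using MVT2[OF t(1)[of k], of "\<lambda>s. h (s *\<^sub>R e + x)" "\<lambda>s. h' (s *\<^sub>R e + x) e"] dh by blast
        have "norm (z *\<^sub>R e) \<le> 1 * norm e"
          unfolding norm_scaleR using z t(2)[of k] by (intro mult_right_mono) auto
        then have "z *\<^sub>R e + x \<in> S'"
          using True norm_triangle_ineq[of "z *\<^sub>R e" x] by (auto simp: S_def S'_def)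
        then have "\<bar>h' (z *\<^sub>R e + x) e\<bar> \<le> C" by (rule C)
        then show ?thesis
          using True z(3) t(1)[of k] by (simp add: q_def)
      next
        case False
        have "norm (t k *\<^sub>R e) \<le> 1 * norm e"
          unfolding norm_scaleR using t[of k] by (intro mult_right_mono) auto
        moreover have "norm x > R + norm e"
          using False by (simp add: S_def)
        moreover have "norm x \<le> norm (t k *\<^sub>R e + x) + norm (t k *\<^sub>R e)"
          using norm_triangle_ineq4[of "t k *\<^sub>R e + x" "t k *\<^sub>R e"] by simp
        ultimately have "norm (t k *\<^sub>R e + x) > R" "norm x > R"
          using norm_ge_zero[of e] by linarith+
        then have "t k *\<^sub>R e + x \<notin> K" "x \<notin> K"
          using R[of x] R[of "t k *\<^sub>R e + x"] by linarith+
        then show ?thesis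
          using False K(2) by (simp add: q_def)
      qed
    qed
  qed
  have "(LINT x|lborel. q k x) = 0" for k
    using inth lborel_integrable_translation[OF inth] lborel_integral_translation[of h "t k *\<^sub>R e"]
    by (simp add: q_def borel_measurable_integrable)
  with lim show ?thesis
    by (simp add: LIMSEQ_const_iff)
qed

lemma integral_by_parts_dir_deriv:
  fixes f g :: "'a::euclidean_space \<Rightarrow> real"
  assumes "smooth_on UNIV f" "test_function U g"
  shows "(LINT x|lborel. f x * dir_deriv e g x) = - (LINT x|lborel. dir_deriv e f x * g x)"
proof -
  obtain K where K: "compact K" "K \<subseteq> U" "\<And>x. x \<notin> K \<Longrightarrow> g x = 0"
    using test_functionE[OF assms(2)] by blast
  note g = test_function_smooth[OF assms(2)]
  have c: "continuous_on UNIV f" "continuous_on UNIV g"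
    "continuous_on UNIV (dir_deriv e f)" "continuous_on UNIV (dir_deriv e g)"
    using assms(1) g by (auto intro: smooth_on_continuous smooth_on_dir_deriv)
  have "(LINT x|lborel. f x * dir_deriv e g x + dir_deriv e f x * g x) = 0"
  proof (rule integral_derivative_eq_0[where K=K and h="\<lambda>x. f x * g x"])
    show "((\<lambda>x. f x * g x) has_derivative (\<lambda>e. f x * dir_deriv e g x + dir_deriv e f x * g x)) (at x)" for x
      by (intro has_derivative_mult smooth_on_has_derivative assms g)
  qed (use K in \<open>auto intro!: continuous_intros c\<close>)
  moreover have "integrable lborel (\<lambda>x. f x * dir_deriv e g x)" "integrable lborel (\<lambda>x. dir_deriv e f x * g x)"
    using K dir_deriv_zero_outside[OF compact_imp_closed[OF K(1)] K(3)]
    by (auto intro!: integrable_lborel_compact_support[OF K(1)] continuous_intros c)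
  ultimately show ?thesis
    by simp
qed

lemma integral_lebesgue_on_test_function:
  fixes f :: "'a::euclidean_space \<Rightarrow> 'b::euclidean_space"
  assumes "open U" "continuous_on UNIV f" "\<And>x. x \<notin> U \<Longrightarrow> f x = 0"
  shows "(LINT x|lebesgue_on U. f x) = (LINT x|lborel. f x)"
proof -
  have "(\<lambda>x. indicator U x *\<^sub>R f x) = f"
    using assms by (auto simp: indicator_def fun_eq_iff)
  then show ?thesis
    using assms by (simp add: integral_lebesgue_on_borel borel_measurable_continuous_onI)
qed

subsection \<open>Square integrable functions\<close>

lemma L2_measurable: "f \<in> L2 U \<Longrightarrow> f \<in> borel_measurable (lebesgue_on U)"
  by (simp add: L2_def)

lemma L2_integrable: "f \<in> L2 U \<Longrightarrow> integrable (lebesgue_on U) (\<lambda>x. (norm (f x))\<^sup>2)"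
  by (simp add: L2_def)

lemma inner_le_squares: "\<bar>x \<bullet> y\<bar> \<le> ((norm x)\<^sup>2 + (norm y)\<^sup>2) / 2"
proof -
  have "\<bar>x \<bullet> y\<bar> \<le> norm x * norm y"
    by (rule Cauchy_Schwarz_ineq2)
  moreover have "2 * (norm x * norm y) \<le> (norm x)\<^sup>2 + (norm y)\<^sup>2"
    using sum_squares_bound[of "norm x" "norm y"] by (simp add: mult.assoc)
  ultimately show ?thesis
    by (simp add: field_simps)
qed

lemma L2_inner_integrable:
  assumes "f \<in> L2 U" "g \<in> L2 U"
  shows "integrable (lebesgue_on U) (\<lambda>x. f x \<bullet> g x)"
proof (rule Bochner_Integration.integrable_bound)
  show "integrable (lebesgue_on U) (\<lambda>x. ((norm (f x))\<^sup>2 + (norm (g x))\<^sup>2) / 2)"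
    by (intro Bochner_Integration.integrable_divide Bochner_Integration.integrable_add L2_integrable assms)
  show "(\<lambda>x. f x \<bullet> g x) \<in> borel_measurable (lebesgue_on U)"
    by (intro borel_measurable_inner L2_measurable assms)
  show "AE x in lebesgue_on U. norm (f x \<bullet> g x) \<le> norm (((norm (f x))\<^sup>2 + (norm (g x))\<^sup>2) / 2)"
    using inner_le_squares by (auto intro!: AE_I2 order.trans[OF inner_le_squares])
qed

lemma L2_boundI:
  assumes "f \<in> borel_measurable (lebesgue_on U)" "integrable (lebesgue_on U) g"
    and "\<And>x. x \<in> U \<Longrightarrow> (norm (f x))\<^sup>2 \<le> g x"
  shows "f \<in> L2 U"
  unfolding L2_def mem_Collect_eq
  using assms by (auto intro!: Bochner_Integration.integrable_bound[OF assms(2)] AE_I2 order.trans[OF assms(3)])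

lemma L2_add:
  assumes "f \<in> L2 U" "g \<in> L2 U"
  shows "(\<lambda>x. f x + g x) \<in> L2 U"
proof (rule L2_boundI)
  show "integrable (lebesgue_on U) (\<lambda>x. (norm (f x))\<^sup>2 + 2 * (f x \<bullet> g x) + (norm (g x))\<^sup>2)"
    by (intro Bochner_Integration.integrable_add Bochner_Integration.integrable_mult_right
        L2_integrable L2_inner_integrable assms)
  show "(\<lambda>x. f x + g x) \<in> borel_measurable (lebesgue_on U)"
    by (intro borel_measurable_add L2_measurable assms)
qed (auto simp: power2_norm_eq_inner algebra_simps inner_commute)

lemma L2_scale: "f \<in> L2 U \<Longrightarrow> (\<lambda>x. c *\<^sub>R f x) \<in> L2 U"
  by (simp add: L2_def power_mult_distrib borel_measurable_scaleR)

lemma L2_diff: "f \<in> L2 U \<Longrightarrow> g \<in> L2 U \<Longrightarrow> (\<lambda>x. f x - g x) \<in> L2 U"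
  using L2_add[OF _ L2_scale[of g U "-1"]] by simp

lemma L2_0: "(\<lambda>x. 0) \<in> L2 U"
  by (simp add: L2_def)

lemma L2_sum: "(\<And>i. i \<in> I \<Longrightarrow> f i \<in> L2 U) \<Longrightarrow> (\<lambda>x. \<Sum>i\<in>I. f i x) \<in> L2 U"
  by (induction I rule: infinite_finite_induct) (auto intro: L2_0 L2_add)

lemma L2_lim_memD: "L2_lim U F f \<Longrightarrow> f \<in> L2 U" "L2_lim U F f \<Longrightarrow> F k \<in> L2 U"
  by (auto simp: L2_lim_def)

lemma L2_lim_const: "g \<in> L2 U \<Longrightarrow> L2_lim U (\<lambda>_. g) g"
  by (simp add: L2_lim_def)

lemma L2_lim_inner_null:
  assumes F: "\<And>k. F k \<in> L2 U" "(\<lambda>k. LINT x|lebesgue_on U. (norm (F k x))\<^sup>2) \<longlonglongrightarrow> 0"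
    and g: "g \<in> L2 U"
  shows "(\<lambda>k. LINT x|lebesgue_on U. F k x \<bullet> g x) \<longlonglongrightarrow> 0"
proof (rule LIMSEQ_I)
  define B where "B = (LINT x|lebesgue_on U. (norm (g x))\<^sup>2)"
  have B: "B \<ge> 0" by (simp add: B_def)
  fix e :: real assume e: "e > 0"
  \<comment> \<open>Young's inequality with weight t bounds the pairing by (|F|^2 / t + t B) / 2.
    This t makes the second term at most e, and the first is below e once |F|^2 < t e; the + 1
    covers B = 0.\<close>
  define t where "t = e / (B + 1)"
  have t: "t > 0" using e B by (simp add: t_def)
  have bound: "\<bar>LINT x|lebesgue_on U. F k x \<bullet> g x\<bar> \<le> ((LINT x|lebesgue_on U. (norm (F k x))\<^sup>2) / t + t * B) / 2" for k
  proof -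
    have "\<bar>LINT x|lebesgue_on U. F k x \<bullet> g x\<bar> \<le> (LINT x|lebesgue_on U. \<bar>F k x \<bullet> g x\<bar>)"
      by (rule integral_abs_bound)
    also have "\<dots> \<le> (LINT x|lebesgue_on U. ((norm (F k x))\<^sup>2 / t + t * (norm (g x))\<^sup>2) / 2)"
    proof (rule integral_mono)
      fix x
      have "\<bar>F k x \<bullet> g x\<bar> = \<bar>((1 / sqrt t) *\<^sub>R F k x) \<bullet> (sqrt t *\<^sub>R g x)\<bar>"
        using t by simp
      also have "\<dots> \<le> ((norm (F k x))\<^sup>2 / t + t * (norm (g x))\<^sup>2) / 2"
        using t by (intro order.trans[OF inner_le_squares]) (simp add: power_mult_distrib power_divide)
      finally show "\<bar>F k x \<bullet> g x\<bar> \<le> ((norm (F k x))\<^sup>2 / t + t * (norm (g x))\<^sup>2) / 2" .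
    qed (intro integrable_abs Bochner_Integration.integrable_divide Bochner_Integration.integrable_add
          Bochner_Integration.integrable_mult_right L2_integrable L2_inner_integrable F g)+
    also have "\<dots> = ((LINT x|lebesgue_on U. (norm (F k x))\<^sup>2) / t + t * B) / 2"
      unfolding B_def using L2_integrable[OF F(1)[of k]] L2_integrable[OF g] by simp
    finally show ?thesis .
  qed
  have "eventually (\<lambda>k. (LINT x|lebesgue_on U. (norm (F k x))\<^sup>2) < t * e) sequentially"
    using order_tendstoD(2)[OF F(2), of "t * e"] t e by simp
  then obtain N where N: "\<And>k. k \<ge> N \<Longrightarrow> (LINT x|lebesgue_on U. (norm (F k x))\<^sup>2) < t * e"
    by (auto simp: eventually_sequentially)
  show "\<exists>N. \<forall>k\<ge>N. norm ((LINT x|lebesgue_on U. F k x \<bullet> g x) - 0) < e"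
  proof (intro exI allI impI)
    fix k assume "k \<ge> N"
    then have "(LINT x|lebesgue_on U. (norm (F k x))\<^sup>2) / t < e"
      using N[of k] t by (simp add: field_simps)
    moreover have "t * B \<le> e"
      using e B by (simp add: t_def field_simps)
    ultimately show "norm ((LINT x|lebesgue_on U. F k x \<bullet> g x) - 0) < e"
      using bound[of k] by simp
  qed
qed

text \<open>The product is expanded around the limits: the mixed terms are null by
  \<open>L2_lim_inner_null\<close>, the product of the errors by 2 |x y| <= x^2 + y^2. The later
  passages from test functions to traces and eigenfunctions are instances.\<close>

lemma L2_lim_inner:
  assumes F: "L2_lim U F f" and G: "L2_lim U G g"
  shows "(\<lambda>k. LINT x|lebesgue_on U. F k x \<bullet> G k x) \<longlonglongrightarrow> (LINT x|lebesgue_on U. f x \<bullet> g x)"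
proof -
  note mem = L2_lim_memD[OF F] L2_lim_memD[OF G]
  have dF: "(\<lambda>x. F k x - f x) \<in> L2 U" and dG: "(\<lambda>x. G k x - g x) \<in> L2 U" for k
    using mem by (auto intro: L2_diff)
  have lF: "(\<lambda>k. LINT x|lebesgue_on U. (norm (F k x - f x))\<^sup>2) \<longlonglongrightarrow> 0"
   and lG: "(\<lambda>k. LINT x|lebesgue_on U. (norm (G k x - g x))\<^sup>2) \<longlonglongrightarrow> 0"
    using F G by (auto simp: L2_lim_def)
  have "(\<lambda>k. LINT x|lebesgue_on U. (F k x - f x) \<bullet> (G k x - g x)) \<longlonglongrightarrow> 0"
  proof (rule Lim_null_comparison)
    show "(\<lambda>k. ((LINT x|lebesgue_on U. (norm (F k x - f x))\<^sup>2) + (LINT x|lebesgue_on U. (norm (G k x - g x))\<^sup>2)) / 2) \<longlonglongrightarrow> 0"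
      using tendsto_divide[OF tendsto_add[OF lF lG] tendsto_const[of "2::real"]] by simp
    show "eventually (\<lambda>k. norm (LINT x|lebesgue_on U. (F k x - f x) \<bullet> (G k x - g x)) \<le>
      ((LINT x|lebesgue_on U. (norm (F k x - f x))\<^sup>2) + (LINT x|lebesgue_on U. (norm (G k x - g x))\<^sup>2)) / 2) sequentially"
    proof (rule always_eventually, rule allI)
      fix k
      have "norm (LINT x|lebesgue_on U. (F k x - f x) \<bullet> (G k x - g x)) \<le> (LINT x|lebesgue_on U. \<bar>(F k x - f x) \<bullet> (G k x - g x)\<bar>)"
        using integral_abs_bound by simp
      also have "\<dots> \<le> (LINT x|lebesgue_on U. ((norm (F k x - f x))\<^sup>2 + (norm (G k x - g x))\<^sup>2) / 2)"
        by (intro integral_mono inner_le_squares integrable_abs L2_inner_integrable dF dG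
            Bochner_Integration.integrable_divide Bochner_Integration.integrable_add L2_integrable)
      also have "\<dots> = ((LINT x|lebesgue_on U. (norm (F k x - f x))\<^sup>2) + (LINT x|lebesgue_on U. (norm (G k x - g x))\<^sup>2)) / 2"
        using L2_integrable[OF dF] L2_integrable[OF dG] by simp
      finally show "norm (LINT x|lebesgue_on U. (F k x - f x) \<bullet> (G k x - g x)) \<le>
        ((LINT x|lebesgue_on U. (norm (F k x - f x))\<^sup>2) + (LINT x|lebesgue_on U. (norm (G k x - g x))\<^sup>2)) / 2" .
    qed
  qed
  from tendsto_add[OF tendsto_add[OF tendsto_add[OF this L2_lim_inner_null[OF dF lF mem(3)]] L2_lim_inner_null[OF dG lG mem(1)]] tendsto_const]
  have "(\<lambda>k. (LINT x|lebesgue_on U. (F k x - f x) \<bullet> (G k x - g x)) +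
      (LINT x|lebesgue_on U. (F k x - f x) \<bullet> g x) + (LINT x|lebesgue_on U. (G k x - g x) \<bullet> f x)
      + (LINT x|lebesgue_on U. f x \<bullet> g x)) \<longlonglongrightarrow> 0 + 0 + 0 + (LINT x|lebesgue_on U. f x \<bullet> g x)" .
  moreover have "(LINT x|lebesgue_on U. F k x \<bullet> G k x) =
      (LINT x|lebesgue_on U. (F k x - f x) \<bullet> (G k x - g x)) +
      (LINT x|lebesgue_on U. (F k x - f x) \<bullet> g x) + (LINT x|lebesgue_on U. (G k x - g x) \<bullet> f x)
      + (LINT x|lebesgue_on U. f x \<bullet> g x)" for k
  proof -
    have "(LINT x|lebesgue_on U. F k x \<bullet> G k x) = (LINT x|lebesgue_on U. (F k x - f x) \<bullet> (G k x - g x) +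
      (F k x - f x) \<bullet> g x + (G k x - g x) \<bullet> f x + f x \<bullet> g x)"
      by (intro Bochner_Integration.integral_cong) (auto simp: algebra_simps inner_commute)
    also have "\<dots> = (LINT x|lebesgue_on U. (F k x - f x) \<bullet> (G k x - g x)) +
      (LINT x|lebesgue_on U. (F k x - f x) \<bullet> g x) + (LINT x|lebesgue_on U. (G k x - g x) \<bullet> f x)
      + (LINT x|lebesgue_on U. f x \<bullet> g x)"
      using L2_inner_integrable[OF dF[of k] dG[of k]] L2_inner_integrable[OF dF[of k] mem(3)]
        L2_inner_integrable[OF dG[of k] mem(1)] L2_inner_integrable[OF mem(1,3)]
      by (simp only: Bochner_Integration.integral_add Bochner_Integration.integrable_add)
    finally show ?thesis .
  qed
  ultimately show ?thesis
    by simp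
qed

lemma L2_bounded:
  assumes "U \<in> lmeasurable" "f \<in> borel_measurable (lebesgue_on U)" "\<And>x. x \<in> U \<Longrightarrow> norm (f x) \<le> C"
  shows "f \<in> L2 U"
proof (rule L2_boundI[OF assms(2)])
  show "integrable (lebesgue_on U) (\<lambda>x. C\<^sup>2)"
    using finite_measure.integrable_const[OF finite_measure_lebesgue_on[OF assms(1)]] .
  show "(norm (f x))\<^sup>2 \<le> C\<^sup>2" if "x \<in> U" for x
    using assms(3)[OF that] by (rule power_mono) simp
qed

lemma test_function_L2:
  assumes "open U" "bounded U" "test_function V f"
  shows "f \<in> L2 U"
proof -
  obtain C where C: "C > 0" "\<And>x. \<bar>f x\<bar> \<le> C"
    using test_function_bounded[OF assms(3)] by blast
  have "f \<in> borel_measurable lebesgue"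
    using borel_measurable_continuous_onI[OF smooth_on_continuous[OF test_function_smooth[OF assms(3)]]]
    by (intro measurable_completion) simp
  then show ?thesis
    using assms(1,2) C(2)
    by (intro L2_bounded[of _ _ C] measurable_restrict_space1) (auto simp: lmeasurable_open)
qed

section \<open>The strong maximum principle for weakly subharmonic functions\<close>

lemma bump_nonneg: "(\<And>w. w > 0 \<Longrightarrow> poly p w \<ge> 0) \<Longrightarrow> bump p c r x \<ge> 0"
  by (simp add: bump_def flat_def)

lemma continuous_on_flat [continuous_intros]:
  "continuous_on S g \<Longrightarrow> continuous_on S (\<lambda>x. flat p (g x))"
  using DERIV_continuous_on[OF flat_has_derivative[of p, THEN DERIV_subset[OF _ subset_UNIV]]]
  by (rule continuous_on_compose2) auto

lemma bump_radius_has_derivative: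
  assumes "r > 0"
  shows "((\<lambda>r. bump p c r x) has_real_derivative
    (2 * ((x - c) \<bullet> (x - c)) / r ^ 3) * bump (flat_deriv p) c r x) (at r)"
proof -
  define q where "q = (x - c) \<bullet> (x - c)"
  have "((\<lambda>r. 1 - q / r\<^sup>2) has_real_derivative (2 * q / r ^ 3)) (at r)"
    using assms by (auto intro!: derivative_eq_intros simp: field_simps power2_eq_square power3_eq_cube)
  from DERIV_chain2[OF flat_has_derivative this] show ?thesis
    by (simp add: bump_def q_def mult.commute)
qed

text \<open>The gradient of \<open>bump 1 c r\<close> is a multiple of \<open>(x - c) * bump p c r\<close>, so the derivative
  in \<open>r\<close> of the normalised mean \<open>M r\<close> of \<open>f\<close> against \<open>bump p c r\<close> is a positive multiple of
  the integral of \<open>f\<close> against \<open>laplacian (bump 1 c r)\<close>. Thus \<open>M\<close> is nondecreasing, and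
  \<open>M r \<longlonglongrightarrow> 0\<close> as \<open>r \<rightarrow> 0\<close>.\<close>

lemma strong_maximum_principle_cbox:
  fixes f :: "'a::euclidean_space \<Rightarrow> real"
  assumes R: "R > 0" and cont: "continuous_on UNIV f" and nonpos: "\<And>x. f x \<le> 0" and zero: "f c = 0"
    and ab: "cball c R \<subseteq> cbox a b"
    and sub: "\<And>r. 0 < r \<Longrightarrow> r < R \<Longrightarrow> 0 \<le> integral (cbox a b) (\<lambda>x. f x * laplacian (bump 1 c r) x)"
    and x: "x \<in> ball c R"
  shows "f x = 0"
proof -
  define p where "p = flat_deriv 1"
  have p: "poly p w = w\<^sup>2" for w
    by (simp add: p_def flat_deriv_def poly_monom)
  define n where "n = DIM('a)"
  \<comment> \<open>The power of r keeps the mass of the kernel independent of r, and the factor 2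
    gives \<open>der\<close> the plain coefficient r / r^n. The domain is a fixed box, so that only
    the integrand depends on r.\<close>
  define M where "M r = integral (cbox a b) (\<lambda>x. (2 / r ^ n) * bump p c r x * f x)" for r
  have cf: "continuous_on S f" for S
    using cont continuous_on_subset by blast
  have cb: "continuous_on S (bump q c r)" for S q r
    using smooth_on_continuous[OF smooth_on_bump] continuous_on_subset by blast
  have bumpc: "continuous_on ({0<..} \<times> cbox a b) (\<lambda>y. bump q c (fst y) (snd y))" for q
    unfolding bump_def by (intro continuous_intros) auto
  have intM: "(\<lambda>x. (2 / r ^ n) * bump p c r x * f x) integrable_on cbox a b" for r
    by (intro integrable_continuous continuous_intros cf cb)
  have der: "(M has_real_derivative
      r / r ^ n * integral (cbox a b) (\<lambda>x. f x * laplacian (bump 1 c r) x)) (at r)" if r: "r > 0" for r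
  proof -
    define D where "D r x = (2 / r ^ n) * ((2 * ((x - c) \<bullet> (x - c)) / r ^ 3) * bump (flat_deriv p) c r x) * f x
        + (- (2 * n / r ^ (n + 1))) * bump p c r x * f x" for r x
    have "(M has_real_derivative integral (cbox a b) (D r)) (at r within {0<..})"
      unfolding M_def[abs_def]
    proof (rule leibniz_rule_field_derivative[OF _ intM])
      fix r t assume "r \<in> {0::real<..}"
      then have r: "r > 0" by simp
      have "((\<lambda>r. 2 / r ^ n) has_real_derivative (- (2 * n / r ^ (n + 1)))) (at r)"
      proof -
        obtain m where m: "n = Suc m"
          using DIM_positive[where 'a='a] by (cases n) (auto simp: n_def)
        have "((\<lambda>r. 2 / r ^ Suc m) has_real_derivative
            (0 * r ^ Suc m - 2 * ((1 + real m) * (1 * r ^ m))) / (r ^ Suc m * r ^ Suc m)) (at r)"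
          using r by (intro DERIV_divide DERIV_const DERIV_power_Suc DERIV_ident) auto
        moreover have "(0 * r ^ Suc m - 2 * ((1 + real m) * (1 * r ^ m))) / (r ^ Suc m * r ^ Suc m) =
            - (2 * n / r ^ (n + 1))"
          using r by (simp add: m divide_simps)
        ultimately show ?thesis
          by (simp only: m)
      qed
      note E = DERIV_cmult_right[OF DERIV_mult[OF this bump_radius_has_derivative[OF r, of p c t]], of "f t"]
      show "((\<lambda>r. (2 / r ^ n) * bump p c r t * f t) has_real_derivative D r t) (at r within {0<..})"
        by (rule has_field_derivative_at_within, rule DERIV_cong[OF E])
          (simp only: D_def, simp add: algebra_simps)
    next
      show "continuous_on ({0<..} \<times> cbox a b) (\<lambda>(x, t). D x t)"
        unfolding D_def split_beta
        by (intro continuous_intros bumpc continuous_on_compose2[OF cont]) auto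
    qed (use r in auto)
    then have "(M has_real_derivative integral (cbox a b) (D r)) (at r)"
      using r by (subst (asm) at_within_open) auto
    moreover have "D r = (\<lambda>x. r / r ^ n * (f x * laplacian (bump 1 c r) x))"
      using r by (auto simp: fun_eq_iff laplacian_bump D_def p_def[symmetric] n_def[symmetric]
          field_simps power2_eq_square power3_eq_cube power4_eq_xxxx)
    ultimately show ?thesis
      by simp
  qed
  have mono: "M r \<le> M s" if "0 < r" "r \<le> s" "s < R" for r s
    using that(2)
  proof (rule DERIV_nonneg_imp_nondecreasing)
    fix t assume t: "r \<le> t" "t \<le> s"
    then have "0 \<le> t / t ^ n * integral (cbox a b) (\<lambda>x. f x * laplacian (bump 1 c t) x)"
      using that by (intro mult_nonneg_nonneg sub) auto
    then show "\<exists>y. DERIV M t :> y \<and> y \<ge> 0"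
      using der[of t] t that by auto
  qed
  obtain K where K: "K > 0" "\<And>y. \<bar>bump p (0::'a) 1 y\<bar> \<le> K"
    using test_function_bounded[OF test_function_bump[of 1 0 UNIV p]] by auto
  \<comment> \<open>All radii share one bound, since translation and scaling carry every bump to the
    one with centre 0 and radius 1.\<close>
  have bK: "\<bar>bump p c r y\<bar> \<le> K" if "r > 0" for r y
  proof -
    have "bump p c r y = bump p 0 1 ((1 / r) *\<^sub>R (y - c))"
      unfolding bump_def diff_zero inner_scaleR_left inner_scaleR_right by (simp add: power2_eq_square)
    then show ?thesis
      using K(2) by simp
  qed
  \<comment> \<open>Monotonicity allows the radius to shrink until |f| < e on the ball. There the
    kernel is at most 2 K / r^n and the ball has volume r^n times \<open>unit_ball_vol n\<close>, so
    the bound does not depend on r.\<close>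
  have lower: "M s \<ge> - (2 * K * unit_ball_vol n) * e" if s: "0 < s" "s < R" and e: "e > 0" for s e
  proof -
    obtain d where d: "d > 0" "\<And>y. dist y c < d \<Longrightarrow> \<bar>f y\<bar> < e"
      using cont e zero unfolding continuous_on_iff dist_real_def by (metis UNIV_I diff_zero)
    define r where "r = min s (d / 2)"
    have r: "0 < r" "r \<le> s" "r < d" using s d by (auto simp: r_def)
    have "integral (cball c r) (\<lambda>x. - (2 * K * e / r ^ n) * 1) = - (2 * K * e / r ^ n) * measure lebesgue (cball c r)"
      by (simp only: integral_mult_right lmeasure_integral[OF lmeasurable_cball])
    then have "- (2 * K * unit_ball_vol n) * e = integral (cball c r) (\<lambda>x. - (2 * K * e / r ^ n))"
      using r by (simp add: content_cball n_def measure_completion)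
    also have "\<dots> = integral (cbox a b) (\<lambda>x. if x \<in> cball c r then - (2 * K * e / r ^ n) else 0)"
      using r s ab by (subst integral_restrict_Int) (auto simp: inf.absorb1 subset_iff intro!: arg_cong2[of _ _ _ _ integral])
    also have "\<dots> \<le> M r"
      unfolding M_def
    proof (rule integral_le[OF _ intM])
      have "(\<lambda>x. - (2 * K * e / r ^ n)) integrable_on (cball c r \<inter> cbox a b)"
        using r s ab by (subst inf.absorb1) (auto simp: subset_iff intro!: integrable_on_const)
      then show "(\<lambda>x. if x \<in> cball c r then - (2 * K * e / r ^ n) else 0) integrable_on cbox a b"
        by (subst integrable_restrict_Int) (simp add: Int_commute)
      show "(if x \<in> cball c r then - (2 * K * e / r ^ n) else 0) \<le> (2 / r ^ n) * bump p c r x * f x" for x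
      proof (cases "x \<in> cball c r")
        case True
        have "\<bar>bump p c r x * f x\<bar> \<le> K * e"
          unfolding abs_mult using True r by (intro mult_mono bK less_imp_le[OF d(2)]) (auto simp: dist_commute K less_imp_le)
        then have "- (K * e) \<le> bump p c r x * f x" by linarith
        then have "(2 / r ^ n) * - (K * e) \<le> (2 / r ^ n) * (bump p c r x * f x)"
          using r by (intro mult_left_mono) auto
        then show ?thesis
          using True by (simp add: mult_ac)
      next
        case False
        then show ?thesis
          using r by (simp add: bump_eq_0)
      qed
    qed
    also have "\<dots> \<le> M s"
      using mono r s by blast
    finally show ?thesis .
  qed
  have M0: "M s = 0" if s: "0 < s" "s < R" for s
  proof (rule antisym)
    show "M s \<le> 0"
    proof -
      have "M s \<le> integral (cbox a b) (\<lambda>x. 0)"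
        unfolding M_def using s
        by (intro integral_le[OF intM integrable_0] mult_nonneg_nonpos bump_nonneg nonpos mult_nonneg_nonneg)
          (auto simp: p)
      then show ?thesis by simp
    qed
    have "((\<lambda>e. - (2 * K * unit_ball_vol n) * e) \<longlongrightarrow> - (2 * K * unit_ball_vol n) * 0) (at_right 0)"
      by (intro tendsto_intros)
    then have "- (2 * K * unit_ball_vol n) * 0 \<le> M s"
      by (rule tendsto_upperbound) (use lower[OF s] in \<open>auto simp: eventually_at_filter\<close>)
    then show "0 \<le> M s" by simp
  qed
  \<comment> \<open>A radius with x strictly inside the support makes the bump positive at x. A
    continuous integrand of one sign whose integral M s is 0 vanishes there.\<close>
  obtain s where s: "dist c x < s" "s < R"
    using x dense by auto
  then have s0: "s > 0" using zero_le_dist[of c x] by linarith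
  have "- ((2 / s ^ n) * bump p c s x * f x) = 0"
  proof (rule has_integral_0_cbox_imp_0[of a b "\<lambda>x. - ((2 / s ^ n) * bump p c s x * f x)"])
    show "continuous_on (cbox a b) (\<lambda>x. - ((2 / s ^ n) * bump p c s x * f x))"
      by (intro continuous_intros cf cb)
    show "0 \<le> - ((2 / s ^ n) * bump p c s x * f x)" for x
      using mult_nonneg_nonpos[OF mult_nonneg_nonneg[OF _ bump_nonneg] nonpos, of "2 / s ^ n" p c s x x] s0
      by (auto simp: p)
    have "((\<lambda>x. (2 / s ^ n) * bump p c s x * f x) has_integral 0) (cbox a b)"
      using M0[OF s0 s(2)] intM[of s] by (simp add: M_def has_integral_iff)
    from has_integral_neg[OF this]
    show "((\<lambda>x. - ((2 / s ^ n) * bump p c s x * f x)) has_integral 0) (cbox a b)"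
      by simp
    have "ball c R \<subseteq> box a b"
      using interior_maximal[OF order.trans[OF ball_subset_cball ab] open_ball] by (simp add: interior_cbox)
    then show "box a b \<noteq> {}" using R by auto
    show "x \<in> cbox a b" using ab x by auto
  qed
  moreover have "bump p c s x > 0"
  proof -
    have "(norm (x - c))\<^sup>2 < s\<^sup>2"
      using s s0 by (intro power_strict_mono) (auto simp: dist_norm norm_minus_commute)
    then show ?thesis
      using s0 by (simp add: bump_def flat_def p power2_norm_eq_inner field_simps)
  qed
  ultimately show ?thesis
    using s0 by auto
qed

section \<open>Traces of solutions with vanishing Neumann data\<close>

lemma dir_deriv_fst:
  assumes "\<And>x. f differentiable (at x)"
  shows "dir_deriv v (\<lambda>z. f (fst z)) = (\<lambda>z. dir_deriv (fst v) f (fst z))"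
  by (rule dir_deriv_eq)
    (rule has_derivative_compose[OF has_derivative_fst[OF has_derivative_ident] has_derivative_dir_deriv[OF assms]])

lemma dir_deriv_snd:
  assumes "\<And>x. f differentiable (at x)"
  shows "dir_deriv v (\<lambda>z. f (snd z)) = (\<lambda>z. dir_deriv (snd v) f (snd z))"
  by (rule dir_deriv_eq)
    (rule has_derivative_compose[OF has_derivative_snd[OF has_derivative_ident] has_derivative_dir_deriv[OF assms]])

lemma differentiable_fst_snd:
  fixes f :: "'a::euclidean_space \<Rightarrow> real" and g :: "'b::euclidean_space \<Rightarrow> real" and z :: "'a \<times> 'b"
  shows "(\<And>x. f differentiable (at x)) \<Longrightarrow> (\<lambda>z. f (fst z)) differentiable (at z)"
    and "(\<And>x. g differentiable (at x)) \<Longrightarrow> (\<lambda>z. g (snd z)) differentiable (at z)"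
  by (rule differentiableI[OF has_derivative_compose[OF has_derivative_fst[OF has_derivative_ident] has_derivative_dir_deriv]]; blast)
    (rule differentiableI[OF has_derivative_compose[OF has_derivative_snd[OF has_derivative_ident] has_derivative_dir_deriv]]; blast)

lemma smooth_on_tensor:
  fixes f :: "'a::euclidean_space \<Rightarrow> real" and g :: "'b::euclidean_space \<Rightarrow> real"
  assumes "smooth_on UNIV f" "smooth_on UNIV g"
  shows "smooth_on UNIV (\<lambda>z. f (fst z) * g (snd z))"
proof -
  define F where "F = {\<lambda>z::'a \<times> 'b. f (fst z) | f. smooth_on UNIV f} \<union> {\<lambda>z. g (snd z) | g. smooth_on UNIV g}"
  have 1: "(\<lambda>z. f (fst z)) \<in> F" if "smooth_on UNIV f" for f
    using that unfolding F_def by blast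
  have 2: "(\<lambda>z. g (snd z)) \<in> F" if "smooth_on UNIV g" for g
    using that unfolding F_def by blast
  have cases: "(\<exists>f. smooth_on UNIV f \<and> k = (\<lambda>z. f (fst z))) \<or> (\<exists>g. smooth_on UNIV g \<and> k = (\<lambda>z. g (snd z)))"
    if "k \<in> F" for k
    using that unfolding F_def by blast
  show ?thesis
  proof (rule smooth_on_alg[OF alg.mult[OF alg.base[OF 1[OF assms(1)]] alg.base[OF 2[OF assms(2)]]]])
    show "k differentiable (at x)" if "k \<in> F" for k x
      using cases[OF that] by (elim disjE exE) (simp_all add: differentiable_fst_snd smooth_on_differentiable)
    show "dir_deriv v k \<in> alg F" if "k \<in> F" for k v
      using cases[OF that]
    proof (elim disjE exE conjE)
      fix f assume "smooth_on UNIV f" "k = (\<lambda>z. f (fst z))"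
      then show ?thesis
        using alg.base[OF 1[OF smooth_on_dir_deriv[of f "fst v"]]] by (simp add: dir_deriv_fst smooth_on_differentiable)
    next
      fix g assume "smooth_on UNIV g" "k = (\<lambda>z. g (snd z))"
      then show ?thesis
        using alg.base[OF 2[OF smooth_on_dir_deriv[of g "snd v"]]] by (simp add: dir_deriv_snd smooth_on_differentiable)
    qed
  qed
qed

lemma test_function_tensor:
  assumes "test_function U f" "smooth_on UNIV g" "compact L" "\<And>y. y \<notin> L \<Longrightarrow> g y = 0"
  shows "test_function (U \<times> UNIV) (\<lambda>z. f (fst z) * g (snd z))"
proof -
  obtain K where K: "compact K" "K \<subseteq> U" "\<And>x. x \<notin> K \<Longrightarrow> f x = 0"
    using test_functionE[OF assms(1)] by blast
  show ?thesis
  proof (rule test_functionI[OF smooth_on_tensor[OF test_function_smooth[OF assms(1)] assms(2)]])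
    show "compact (K \<times> L)" using K assms by (intro compact_Times)
    show "K \<times> L \<subseteq> U \<times> UNIV" using K by auto
    show "f (fst z) * g (snd z) = 0" if "z \<notin> K \<times> L" for z
      using that K(3)[of "fst z"] assms(4)[of "snd z"] by (cases z) auto
  qed
qed

lemma grad_tensor:
  assumes "smooth_on UNIV f" "smooth_on UNIV g"
  shows "grad (\<lambda>z. f (fst z) * g (snd z)) z = (g (snd z) *\<^sub>R grad f (fst z), f (fst z) *\<^sub>R grad g (snd z))"
proof (rule vector_eq_rdot[THEN iffD1], rule allI)
  fix v
  have "dir_deriv v (\<lambda>z. f (fst z) * g (snd z)) z =
      f (fst z) * dir_deriv (snd v) g (snd z) + dir_deriv (fst v) f (fst z) * g (snd z)"
    using assms by (simp add: dir_deriv_mult differentiable_fst_snd smooth_on_differentiable dir_deriv_fst dir_deriv_snd)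
  then show "grad (\<lambda>z. f (fst z) * g (snd z)) z \<bullet> v =
      (g (snd z) *\<^sub>R grad f (fst z), f (fst z) *\<^sub>R grad g (snd z)) \<bullet> v"
    using smooth_on_tensor[OF assms] assms
    by (simp add: dir_deriv_eq_grad smooth_on_differentiable inner_prod_def)
qed

lemma inner_grad_scaled:
  fixes v :: "'a::euclidean_space \<times> real \<Rightarrow> real"
  assumes "smooth_on UNIV v"
  shows "grad v z \<bullet> (c *\<^sub>R grad f x, t) =
    c * (\<Sum>b\<in>Basis. dir_deriv (b, 0) v z * dir_deriv b f x) + dir_deriv (0, 1) v z * t"
proof -
  have "grad v z \<bullet> (b, 0) = dir_deriv (b, 0) v z" "grad v z \<bullet> (0, 1) = dir_deriv (0, 1) v z" for b
    using assms by (simp_all add: dir_deriv_eq_grad smooth_on_differentiable)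
  then have *: "fst (grad v z) \<bullet> b = dir_deriv (b, 0) v z" "snd (grad v z) = dir_deriv (0, 1) v z" for b
    by (simp_all add: inner_prod_def)
  have "fst (grad v z) \<bullet> grad f x = (\<Sum>b\<in>Basis. (fst (grad v z) \<bullet> b) * dir_deriv b f x)"
    by (simp add: grad_eq[of f] inner_sum_right mult.commute)
  then show ?thesis
    by (simp add: inner_prod_def *)
qed

section \<open>Power weights and Fubini on the half space\<close>

lemma powr_integrable_lborel:
  assumes "-1 < (a::real)"
  shows "integrable lborel (\<lambda>y. indicator {0<..<h} y * y powr a)"
proof -
  have "(\<lambda>y. y powr a) absolutely_integrable_on {0..max h 0}"
    by (intro nonnegative_absolutely_integrable_1 integrable_on_powr_from_0) (use assms in auto)
  then have "set_integrable lebesgue {0<..<h} (\<lambda>y. y powr a)"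
    by (rule set_integrable_subset) auto
  then have "integrable lebesgue (\<lambda>y. indicator {0<..<h} y * y powr a)"
    by (simp add: set_integrable_def)
  then show ?thesis
    by (subst (asm) integrable_completion) auto
qed

lemma integrable_lborel_tensor:
  fixes f :: "'a::euclidean_space \<Rightarrow> real" and g :: "'b::euclidean_space \<Rightarrow> real"
  assumes "integrable lborel f" "integrable lborel g"
  shows "integrable lborel (\<lambda>z. f (fst z) * g (snd z))"
proof -
  have [measurable]: "f \<in> borel_measurable lborel" "g \<in> borel_measurable lborel"
    using assms by auto
  have "integrable (lborel \<Otimes>\<^sub>M lborel) (\<lambda>z. f (fst z) * g (snd z))"
  proof (rule lborel_pair.Fubini_integrable)
    show "integrable lborel (\<lambda>x. LINT y|lborel. norm (f (fst (x, y)) * g (snd (x, y))))"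
      using assms by (simp add: abs_mult integrable_abs)
  qed (use assms in auto)
  then show ?thesis
    by (simp add: lborel_prod)
qed

text \<open>Fubini with a weight that may blow up at y = 0: the integrand is dominated by the
  indicator of \<open>K\<close> times C |w(y)|, where C bounds A on K x [0,h]. Outside that strip
  \<open>w\<close> vanishes, so A may grow in y.\<close>

lemma weighted_integral_swap:
  fixes A :: "'a::euclidean_space \<times> real \<Rightarrow> real"
  assumes w: "integrable lborel w" "\<And>y. y \<notin> {0..h} \<Longrightarrow> w y = 0"
    and A: "continuous_on UNIV A" "compact K" "\<And>x y. x \<notin> K \<Longrightarrow> A (x, y) = 0"
  shows "integrable lborel (\<lambda>z. w (snd z) * A z)" (is ?thesis1)
    and "(LINT z|lborel. w (snd z) * A z) = (LINT y|lborel. w y * (LINT x|lborel. A (x, y)))" (is ?thesis2)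
    and "(LINT z|lborel. w (snd z) * A z) = (LINT x|lborel. LINT y|lborel. w y * A (x, y))" (is ?thesis3)
    and "integrable lborel (\<lambda>x. LINT y|lborel. w y * A (x, y))" (is ?thesis4)
    and "integrable lborel (\<lambda>y. w y * A (x, y))" (is ?thesis5)
proof -
  have [measurable]: "w \<in> borel_measurable borel" "A \<in> borel_measurable borel"
    using w(1) A(1) by (auto intro: borel_measurable_continuous_onI)
  have "bounded (A ` (K \<times> {0..h}))"
    using A by (intro compact_imp_bounded compact_continuous_image compact_Times) (auto intro: continuous_on_subset)
  then obtain C where "\<forall>z\<in>A ` (K \<times> {0..h}). norm z \<le> C"
    unfolding bounded_iff by blast
  then have C: "\<bar>A (x, y)\<bar> \<le> C" if "x \<in> K" "y \<in> {0..h}" for x y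
    using that by auto
  have bound: "\<bar>w y * A (x, y)\<bar> \<le> (indicator K x * C) * \<bar>w y\<bar>" for x y
    using w(2)[of y] A(3)[of x y] mult_left_mono[OF C[of x y], of "\<bar>w y\<bar>"]
    by (cases "x \<in> K"; cases "y \<in> {0..h}") (auto simp: abs_mult mult.commute)
  have intK: "integrable lborel (\<lambda>x. indicator K x * C)"
    using borel_integrable_compact[OF A(2), of "\<lambda>_. C"] by simp
  have "snd \<in> borel_measurable (borel :: ('a \<times> real) measure)"
    by (intro borel_measurable_continuous_onI continuous_intros)
  then have [measurable]: "(\<lambda>z::'a \<times> real. w (snd z)) \<in> borel_measurable borel"
    by (rule measurable_compose) measurable
  show 1: ?thesis1
  proof (rule Bochner_Integration.integrable_bound[OF integrable_lborel_tensor[OF intK integrable_abs[OF w(1)]]])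
    show "(\<lambda>z. w (snd z) * A z) \<in> borel_measurable lborel"
      by simp
    show "AE z in lborel. norm (w (snd z) * A z) \<le> norm (indicator K (fst z) * C * \<bar>w (snd z)\<bar>)"
    proof (rule AE_I2)
      show "norm (w (snd z) * A z) \<le> norm (indicator K (fst z) * C * \<bar>w (snd z)\<bar>)" for z
        using order.trans[OF bound[of "snd z" "fst z"] abs_ge_self] by simp
    qed
  qed
  then have int: "integrable (lborel \<Otimes>\<^sub>M lborel) (\<lambda>z. w (snd z) * A z)"
    by (simp add: lborel_prod)
  have eq: "(\<lambda>(x, y). w y * A (x, y)) = (\<lambda>z. w (snd z) * A z)"
    by auto
  show ?thesis2
    using lborel_pair.integral_snd[of "\<lambda>x y. w y * A (x, y)"] int by (simp add: lborel_prod eq)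
  show ?thesis3
    using lborel_pair.integral_fst'[OF int] by (simp add: lborel_prod)
  show ?thesis4
    using lborel_pair.integrable_fst'[OF int] by simp
  have "continuous_on UNIV (\<lambda>y. A (x, y))"
    by (rule continuous_on_compose2[OF A(1)]) (auto intro!: continuous_intros)
  then have [measurable]: "(\<lambda>y. A (x, y)) \<in> borel_measurable borel"
    by (rule borel_measurable_continuous_onI)
  show ?thesis5
  proof (rule Bochner_Integration.integrable_bound[OF integrable_mult_right[OF integrable_abs[OF w(1)], of "indicator K x * C"]])
    show "AE y in lborel. norm (w y * A (x, y)) \<le> norm (indicator K x * C * \<bar>w y\<bar>)"
      using order.trans[OF bound[of _ x] abs_ge_self] by (intro AE_I2) simp
  qed simp
qed

lemma integral_lebesgue_on_eq:
  fixes f F :: "'a::euclidean_space \<Rightarrow> 'b::euclidean_space"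
  assumes "U \<in> sets borel" "F \<in> borel_measurable borel" "\<And>x. indicator U x *\<^sub>R f x = F x"
  shows "(LINT x|lebesgue_on U. f x) = (LINT x|lborel. F x)"
  using assms by (subst integral_restrict_space) (auto intro!: integral_completion)

section \<open>The vertical weight on a slab of height h and its primitive\<close>

locale weight =
  fixes a h :: real
  assumes a: "-1 < a" "a < 1" and h: "0 < h"
begin

definition cutoff :: "real \<Rightarrow> real" where
  "cutoff = bump 1 0 h"

definition w :: "real \<Rightarrow> real" where
  "w y = indicator {0<..<h} y * (y powr a * cutoff y)"

text \<open>The primitive of \<open>- w\<close> that vanishes at h, so integration by parts in y
  meets no term at the top of the slab. It is continuous up to y = 0 even when y^a is unbounded
  there.\<close>

definition W :: "real \<Rightarrow> real" where
  "W t = integral {t..h} w"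

lemma cutoff_bounds: "0 \<le> cutoff y" "cutoff y \<le> 1"
  by (auto simp: cutoff_def bump_def flat_def)

lemma cutoff_pos: "\<bar>y\<bar> < h \<Longrightarrow> cutoff y > 0"
  using h power_strict_mono[of "\<bar>y\<bar>" h 2] by (auto simp: cutoff_def bump_def flat_def power2_eq_square)

lemma smooth_cutoff: "smooth_on UNIV cutoff"
  by (simp add: cutoff_def smooth_on_bump)

lemma cutoff_eq_0: "h \<le> \<bar>y\<bar> \<Longrightarrow> cutoff y = 0"
  using h power_mono[of h "\<bar>y\<bar>" 2] by (auto simp: cutoff_def bump_def flat_def power2_eq_square field_simps)

lemma grad_cutoff: "grad cutoff y = - (2 / h\<^sup>2) * y * bump (flat_deriv 1) 0 h y"
  by (simp add: grad_eq cutoff_def dir_deriv_bump)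

lemma grad_cutoff_eq_0: "h \<le> \<bar>y\<bar> \<Longrightarrow> grad cutoff y = 0"
  using h power_mono[of h "\<bar>y\<bar>" 2]
  by (auto simp: grad_cutoff bump_def flat_def power2_eq_square field_simps)

lemma grad_cutoff_nonpos: "0 \<le> y \<Longrightarrow> grad cutoff y \<le> 0"
proof -
  assume "0 \<le> y"
  moreover have "0 \<le> bump (flat_deriv 1) 0 h y"
    by (rule bump_nonneg) (simp add: flat_deriv_def poly_monom)
  ultimately show ?thesis
    unfolding grad_cutoff by (intro mult_nonpos_nonneg) (auto intro: mult_nonpos_nonneg)
qed

lemma w_nonneg: "0 \<le> w y"
  by (simp add: w_def cutoff_bounds)

lemma borel_measurable_cutoff [measurable]: "cutoff \<in> borel_measurable borel"
  by (intro borel_measurable_continuous_onI smooth_on_continuous smooth_cutoff)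

lemma borel_measurable_w [measurable]: "w \<in> borel_measurable borel"
  unfolding w_def[abs_def] by measurable

lemma integrable_w: "integrable lborel w"
proof (rule Bochner_Integration.integrable_bound[OF powr_integrable_lborel[OF a(1), of h]])
  show "AE y in lborel. norm (w y) \<le> norm (indicator {0<..<h} y * y powr a)"
    using cutoff_bounds by (auto simp: w_def indicator_def abs_mult intro!: AE_I2 mult_left_le)
qed simp

lemma w_integrable_on: "w integrable_on {s..t}"
  by (rule integrable_on_subinterval[OF integrable_on_lborel[OF integrable_w]]) simp

lemma W_h: "W h = 0"
  by (simp add: W_def)

lemma W_bounds:
  assumes "0 \<le> t"
  shows "0 \<le> W t" "W t \<le> W 0"
  unfolding W_def using assms
  by (auto intro!: integral_nonneg integral_subset_le w_integrable_on w_nonneg)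

lemma continuous_on_W: "continuous_on {0..h} W"
  unfolding W_def[abs_def] by (rule indefinite_integral_continuous_1'[OF w_integrable_on])

lemma W_has_derivative:
  assumes t: "0 < t" "t < h"
  shows "(W has_real_derivative - w t) (at t)"
proof -
  have "continuous_on {0<..<h} (\<lambda>y. y powr a * cutoff y)"
    by (intro continuous_intros continuous_on_subset[OF smooth_on_continuous[OF smooth_cutoff]]) auto
  then have "isCont (\<lambda>y. y powr a * cutoff y) t"
    using t by (simp add: continuous_on_eq_continuous_at)
  moreover have "\<forall>\<^sub>F y in nhds t. w y = y powr a * cutoff y"
    using t eventually_nhds_in_open[of "{0<..<h}" t] by (auto simp: w_def elim: eventually_mono)
  ultimately have "isCont w t"
    by (simp add: isCont_cong)
  then have "((\<lambda>u. integral {0..u} w) has_vector_derivative w t) (at t within ({0..h} - {}))"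
    using t by (intro integral_has_vector_derivative_continuous_at w_integrable_on)
      (auto simp: continuous_at_imp_continuous_within)
  then have "((\<lambda>u. integral {0..u} w) has_real_derivative w t) (at t within {0..h})"
    by (simp add: has_real_derivative_iff_has_vector_derivative)
  then have "((\<lambda>u. integral {0..u} w) has_real_derivative w t) (at t)"
    using t by (subst (asm) at_within_interior) auto
  from DERIV_diff[OF DERIV_const[of "W 0"] this]
  have "((\<lambda>u. W 0 - integral {0..u} w) has_real_derivative - w t) (at t)"
    by simp
  then show ?thesis
  proof (rule has_field_derivative_transform_within_open[of _ _ _ "{0<..<h}"])
    show "W 0 - integral {0..u} w = W u" if "u \<in> {0<..<h}" for u
      using Henstock_Kurzweil_Integration.integral_combine[of 0 u h w] that w_integrable_on by (simp add: W_def)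
  qed (use t in auto)
qed

text \<open>The final estimate is divided by \<open>W 0\<close>. By the mean value theorem
  \<open>W 0\<close> is h times a value of \<open>w\<close> inside the interval, where
  \<open>w\<close> is positive.\<close>

lemma W_0_pos: "W 0 > 0"
proof -
  obtain l z where z: "0 < z" "z < h" "(W has_real_derivative l) (at z)" "W h - W 0 = (h - 0) * l"
    using MVT[OF h continuous_on_W] W_has_derivative real_differentiable_def by blast
  then have "l = - w z"
    using W_has_derivative DERIV_unique by blast
  moreover have "w z > 0"
    using z cutoff_pos[of z] by (simp add: w_def)
  ultimately show ?thesis
    using z h by (simp add: W_h mult_pos_pos)
qed

text \<open>Not a derivative: this is \<open>W\<close> cut off to the slab, since \<open>W\<close>
  itself is constant rather than zero for negative arguments.\<close>

definition W' :: "real \<Rightarrow> real" where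
  "W' y = indicator {0<..<h} y * W y"

lemma integrable_W': "integrable lborel W'"
  and borel_measurable_W' [measurable]: "W' \<in> borel_measurable borel"
proof -
  have "integrable lborel (\<lambda>y. indicator {0..h} y *\<^sub>R W y)"
    by (rule borel_integrable_compact[OF compact_Icc continuous_on_W])
  then have "(\<lambda>y. indicator {0..h} y *\<^sub>R W y) \<in> borel_measurable borel"
    by auto
  then have "(\<lambda>y. indicator {0<..<h} y * (indicator {0..h} y *\<^sub>R W y)) \<in> borel_measurable borel"
    by (intro borel_measurable_times) auto
  also have "(\<lambda>y. indicator {0<..<h} y * (indicator {0..h} y *\<^sub>R W y)) = W'"
    by (auto simp: W'_def indicator_def fun_eq_iff)
  finally show m: "W' \<in> borel_measurable borel" .
  show "integrable lborel W'"
    by (rule Bochner_Integration.integrable_bound[OF \<open>integrable lborel (\<lambda>y. indicator {0..h} y *\<^sub>R W y)\<close>])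
      (use m in \<open>auto simp: W'_def indicator_def\<close>)
qed


lemma W'_bounds: "0 \<le> W' y" "W' y \<le> W 0"
  using W_bounds[of y] W_0_pos by (auto simp: W'_def indicator_def)

text \<open>Inside the slab the x-part contributes w Laplace \<phi> to the divergence and the y-part
  contributes - w Laplace \<phi>, so the field is divergence free. Its flux leaves only through y =
  0, where the vertical component tends to \<open>W 0\<close> Laplace \<phi>.\<close>

definition Z :: "('a::euclidean_space \<Rightarrow> real) \<Rightarrow> 'a \<times> real \<Rightarrow> 'a \<times> real" where
  "Z \<phi> z = (w (snd z) *\<^sub>R grad \<phi> (fst z), W' (snd z) * laplacian \<phi> (fst z))"

text \<open>Integrate by parts in \<open>x\<close>, then in \<open>y\<close> using that \<open>- w\<close> is the derivative of \<open>W\<close>.\<close>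

lemma trace_identity_smooth:
  fixes v :: "'a::euclidean_space \<times> real \<Rightarrow> real"
  assumes \<phi>: "test_function \<Omega> \<phi>" and v: "smooth_on UNIV v"
  shows "(LINT z|lborel. grad v z \<bullet> Z \<phi> z) = - W 0 * (LINT x|lborel. v (x, 0) * laplacian \<phi> x)"
proof -
  obtain K where K: "compact K" "K \<subseteq> \<Omega>" "\<And>x. x \<notin> K \<Longrightarrow> \<phi> x = 0"
    using test_functionE[OF \<phi>] by blast
  note s\<phi> = test_function_smooth[OF \<phi>]
  have K1: "dir_deriv b \<phi> x = 0" if "x \<notin> K" for b x
    using dir_deriv_zero_outside[OF compact_imp_closed[OF K(1)] K(3) that] .
  have K2: "dir_deriv c (dir_deriv b \<phi>) x = 0" if "x \<notin> K" for b c x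
    using dir_deriv_zero_outside[OF compact_imp_closed[OF K(1)] K1 that] .
  have KL: "laplacian \<phi> x = 0" if "x \<notin> K" for x
    using K2[OF that] by (simp add: laplacian_def)
  have cont: "continuous_on S (dir_deriv b \<phi>)" "continuous_on S (dir_deriv c (dir_deriv b \<phi>))"
    "continuous_on S (laplacian \<phi>)" for S b c
    using s\<phi> by (auto intro!: continuous_on_subset[OF smooth_on_continuous] smooth_on_dir_deriv smooth_on_laplacian)
  have contv: "continuous_on S v" "continuous_on S (dir_deriv c v)" for S c
    using v by (auto intro!: continuous_on_subset[OF smooth_on_continuous] smooth_on_dir_deriv)
  \<comment> \<open>The integrand is split by adding and subtracting w Q: P + Q is the x-divergence
    of v grad \<phi>, and W' V - w Q is the y-derivative of v W Laplace \<phi>. Each piece is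
    integrated first in its own variable.\<close>
  define P where "P z = (\<Sum>b\<in>Basis. dir_deriv (b, 0) v z * dir_deriv b \<phi> (fst z))" for z
  define Q where "Q z = v z * laplacian \<phi> (fst z)" for z
  define V where "V z = dir_deriv (0, 1) v z * laplacian \<phi> (fst z)" for z
  have cfst: "continuous_on UNIV (\<lambda>z. f (fst z))" if "continuous_on UNIV f" for f :: "'a \<Rightarrow> real"
    by (rule continuous_on_compose2[OF that]) (auto intro!: continuous_intros)
  have cP: "continuous_on UNIV P"
    unfolding P_def by (intro continuous_intros contv cfst cont)
  have cQ: "continuous_on UNIV Q" and cV: "continuous_on UNIV V"
    unfolding Q_def V_def by (intro continuous_intros contv cfst cont)+
  have zP: "P (x, y) = 0" and zQ: "Q (x, y) = 0" and zV: "V (x, y) = 0" if "x \<notin> K" for x y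
    using K1[OF that] KL[OF that] by (simp_all add: P_def Q_def V_def)
  have cPQ: "continuous_on UNIV (\<lambda>z. P z + Q z)"
    by (intro continuous_intros cP cQ)
  have w0: "w y = 0" and W0: "W' y = 0" if "y \<notin> {0..h}" for y
    using that by (auto simp: w_def W'_def)
  have inner0: "(LINT x|lborel. P (x, y) + Q (x, y)) = 0" for y
  proof -
    have dv: "((\<lambda>x. v (x, y)) has_derivative (\<lambda>e. dir_deriv (e, 0) v (x, y))) (at x)" for x
    proof (rule has_derivative_compose[OF _ smooth_on_has_derivative[OF v]])
      show "((\<lambda>x. (x, y)) has_derivative (\<lambda>e. (e, 0))) (at x)"
        by (auto intro!: derivative_eq_intros)
    qed
    have cy: "continuous_on UNIV (\<lambda>x. f (x, y))" if "continuous_on UNIV f" for f :: "'a \<times> real \<Rightarrow> real"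
      by (rule continuous_on_compose2[OF that]) (auto intro!: continuous_intros)
    define T where "T b x = v (x, y) * dir_deriv b (dir_deriv b \<phi>) x + dir_deriv (b, 0) v (x, y) * dir_deriv b \<phi> x" for b x
    have cT: "continuous_on UNIV (T b)" for b
      unfolding T_def by (intro continuous_intros cont cy contv)
    have "(LINT x|lborel. T b x) = 0" for b
    proof -
      have "((\<lambda>x. v (x, y) * dir_deriv b \<phi> x) has_derivative
        (\<lambda>e. v (x, y) * dir_deriv e (dir_deriv b \<phi>) x + dir_deriv (e, 0) v (x, y) * dir_deriv b \<phi> x)) (at x)" for x
        by (intro has_derivative_mult dv smooth_on_has_derivative smooth_on_dir_deriv s\<phi>)
      from integral_derivative_eq_0[OF this cT[of b, unfolded T_def] K(1)] show ?thesis
        by (simp add: T_def K1)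
    qed
    moreover have "P (x, y) + Q (x, y) = (\<Sum>b\<in>Basis. T b x)" for x
      by (simp add: P_def Q_def T_def laplacian_def sum.distrib sum_distrib_left)
    moreover have "integrable lborel (T b)" for b
      by (rule integrable_lborel_compact_support[OF K(1) cT]) (simp add: T_def K1 K2)
    ultimately show ?thesis
      by (simp add: Bochner_Integration.integral_sum)
  qed
  have inner1: "(LINT y|lborel. W' y * V (x, y)) - (LINT y|lborel. w y * Q (x, y)) = - W 0 * (v (x, 0) * laplacian \<phi> x)" for x
  proof -
    note int = weighted_integral_swap(5)[OF integrable_W' W0 cV K(1) zV, where x=x]
      weighted_integral_swap(5)[OF integrable_w w0 cQ K(1) zQ, where x=x]
    define f' where "f' y = v (x, y) * (- w y) + dir_deriv (0, 1) v (x, y) * W y" for y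
    have dvy: "((\<lambda>y. v (x, y)) has_real_derivative dir_deriv (0, 1) v (x, y)) (at y)" for y
    proof -
      have "((\<lambda>y. (x, y)) has_derivative (\<lambda>e. (0, e))) (at y)"
        by (auto intro!: derivative_eq_intros)
      from has_derivative_compose[OF this smooth_on_has_derivative[OF v]]
      have D: "((\<lambda>y. v (x, y)) has_derivative (\<lambda>e. dir_deriv (0, e) v (x, y))) (at y)" .
      have "dir_deriv (0, e) v (x, y) = dir_deriv (0, 1) v (x, y) * e" for e
      proof -
        have "dir_deriv (e *\<^sub>R (0, 1)) v (x, y) = e *\<^sub>R dir_deriv (0, 1) v (x, y)"
          by (rule linear_cmul[OF has_derivative_linear[OF smooth_on_has_derivative[OF v]]])
        moreover have "e *\<^sub>R (0, 1) = (0 :: 'a, e)"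
          by simp
        ultimately show ?thesis
          by (metis real_scaleR_def mult.commute)
      qed
      then have "(\<lambda>e. dir_deriv (0, e) v (x, y)) = (*) (dir_deriv (0, 1) v (x, y))"
        by (rule ext)
      with D show ?thesis
        unfolding has_field_derivative_def by (rule back_subst)
    qed
    \<comment> \<open>The interior form of the theorem is used because the derivative of
      \<open>W\<close> is known only for 0 < y < h; at the ends continuity suffices.\<close>
    have "(f' has_integral v (x, h) * W h - v (x, 0) * W 0) {0..h}"
    proof (rule fundamental_theorem_of_calculus_interior)
      show "((\<lambda>y. v (x, y) * W y) has_vector_derivative f' y) (at y)" if "y \<in> {0<..<h}" for y
      proof -
        have "((\<lambda>y. v (x, y) * W y) has_real_derivative f' y) (at y)"
          unfolding f'_def by (rule DERIV_mult'[OF dvy W_has_derivative]) (use that in auto)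
        then show ?thesis
          by (rule has_real_derivative_iff_has_vector_derivative[THEN iffD1])
      qed
      show "continuous_on {0..h} (\<lambda>y. v (x, y) * W y)"
        by (rule continuous_on_mult[OF DERIV_continuous_on[OF has_field_derivative_at_within[OF dvy]] continuous_on_W])
    qed (use h in auto)
    then have "((\<lambda>y. laplacian \<phi> x * f' y) has_integral laplacian \<phi> x * (v (x, h) * W h - v (x, 0) * W 0)) {0..h}"
      by (rule has_integral_mult_right)
    moreover have "laplacian \<phi> x * (v (x, h) * W h - v (x, 0) * W 0) = - W 0 * (v (x, 0) * laplacian \<phi> x)"
      by (simp add: W_h)
    ultimately have "((\<lambda>y. if y \<in> {0..h} then laplacian \<phi> x * f' y else 0) has_integral - W 0 * (v (x, 0) * laplacian \<phi> x)) UNIV"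
      unfolding has_integral_restrict_UNIV by simp
    \<comment> \<open>The endpoints are excepted because \<open>W'\<close> is 0 at y = 0, where
      \<open>W\<close> is not.\<close>
    then have I1: "((\<lambda>y. W' y * V (x, y) - w y * Q (x, y)) has_integral - W 0 * (v (x, 0) * laplacian \<phi> x)) UNIV"
    proof (rule has_integral_spike_finite[of "{0, h}", rotated 2])
      show "W' y * V (x, y) - w y * Q (x, y) = (if y \<in> {0..h} then laplacian \<phi> x * f' y else 0)"
        if "y \<in> UNIV - {0, h}" for y
      proof (cases "y \<in> {0<..<h}")
        case True
        then have "W' y = W y" by (simp add: W'_def)
        with True show ?thesis
          by (simp add: f'_def V_def Q_def algebra_simps)
      next
        case False
        then show ?thesis
          using that W0[of y] w0[of y] by auto
      qed
    qed simp
    have I2: "((\<lambda>y. W' y * V (x, y) - w y * Q (x, y)) has_integral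
        (LINT y|lborel. W' y * V (x, y) - w y * Q (x, y))) UNIV"
      using int by (intro has_integral_integral_lborel Bochner_Integration.integrable_diff)
    show ?thesis
      using has_integral_unique[OF I2 I1] int by simp
  qed
  have "grad v z \<bullet> Z \<phi> z = w (snd z) * (P z + Q z) + (W' (snd z) * V z - w (snd z) * Q z)" for z
    unfolding Z_def inner_grad_scaled[OF v] by (simp add: P_def V_def algebra_simps)
  then have "(LINT z|lborel. grad v z \<bullet> Z \<phi> z) =
      (LINT z|lborel. w (snd z) * (P z + Q z) + (W' (snd z) * V z - w (snd z) * Q z))"
    by simp
  also have "\<dots> = (LINT z|lborel. w (snd z) * (P z + Q z)) +
      ((LINT z|lborel. W' (snd z) * V z) - (LINT z|lborel. w (snd z) * Q z))"
    using weighted_integral_swap(1)[OF integrable_w w0 cPQ K(1)] weighted_integral_swap(1)[OF integrable_w w0 cQ K(1) zQ]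
      weighted_integral_swap(1)[OF integrable_W' W0 cV K(1) zV] zP zQ
    by simp
  also have "(LINT z|lborel. w (snd z) * (P z + Q z)) = 0"
    using weighted_integral_swap(2)[OF integrable_w w0 cPQ K(1)] zP zQ by (simp add: inner0)
  also have "(LINT z|lborel. W' (snd z) * V z) - (LINT z|lborel. w (snd z) * Q z) =
      (LINT x|lborel. (LINT y|lborel. W' y * V (x, y)) - (LINT y|lborel. w y * Q (x, y)))"
    using weighted_integral_swap(3,4)[OF integrable_w w0 cQ K(1) zQ]
      weighted_integral_swap(3,4)[OF integrable_W' W0 cV K(1) zV]
    by simp
  also have "\<dots> = - W 0 * (LINT x|lborel. v (x, 0) * laplacian \<phi> x)"
    unfolding inner1 by (rule integral_mult_right_zero)
  finally show ?thesis
    by simp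
qed

end

section \<open>The pairing of the weights y^a and y^(-a), and the limit to traces\<close>

lemma snd_measurable [measurable]: "snd \<in> borel_measurable (borel :: ('a::euclidean_space \<times> 'b::euclidean_space) measure)"
  and fst_measurable [measurable]: "fst \<in> borel_measurable (borel :: ('a::euclidean_space \<times> 'b::euclidean_space) measure)"
  by (intro borel_measurable_continuous_onI continuous_intros)+

lemma borel_measurable_lebesgue_on_borel:
  fixes f :: "'a::euclidean_space \<Rightarrow> 'b::euclidean_space"
  shows "f \<in> borel_measurable borel \<Longrightarrow> f \<in> borel_measurable (lebesgue_on U)"
  by (intro measurable_restrict_space1 measurable_completion) simp

lemma test_function_measurable:
  assumes "test_function \<Omega> \<phi>"
  shows "\<phi> \<in> borel_measurable borel" "grad \<phi> \<in> borel_measurable borel" "laplacian \<phi> \<in> borel_measurable borel"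
  using test_function_smooth[OF assms]
  by (auto intro!: borel_measurable_continuous_onI continuous_on_grad smooth_on_continuous smooth_on_laplacian)

lemma test_function_grad_bounded:
  assumes "test_function \<Omega> \<phi>"
  obtains C where "C > 0" "\<And>x. norm (grad \<phi> x) \<le> C"
proof -
  obtain K where K: "compact K" "K \<subseteq> \<Omega>" "\<And>x. x \<notin> K \<Longrightarrow> \<phi> x = 0"
    using test_functionE[OF assms] by blast
  have "bounded (grad \<phi> ` K)"
    using continuous_on_grad[OF test_function_smooth[OF assms]]
    by (intro compact_imp_bounded compact_continuous_image K) (auto intro: continuous_on_subset)
  then obtain C where C: "C > 0" "\<forall>x\<in>K. norm (grad \<phi> x) \<le> C"
    by (auto simp: bounded_pos)
  show ?thesis
  proof (rule that[OF C(1)])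
    show "norm (grad \<phi> x) \<le> C" for x
      using C grad_zero_outside[OF compact_imp_closed[OF K(1)] K(3)] by (cases "x \<in> K") auto
  qed
qed

context weight
begin

text \<open>The powers y^(a/2) and y^(-a/2) cancel, so the plain pairing is one of L2 functions:
  \<open>Du\<close> is square integrable with weight y^a, the fields \<open>Y\<close> and
  \<open>Z\<close> with weight y^(-a).\<close>

lemma weighted_inner:
  assumes "snd z > 0"
  shows "weighted a f z \<bullet> weighted (- a) g z = f z \<bullet> g z"
  using assms by (simp add: weighted_def mult.assoc[symmetric] powr_add[symmetric])

abbreviation slab :: "'a::euclidean_space set \<Rightarrow> ('a \<times> real) set" where
  "slab \<Omega> \<equiv> \<Omega> \<times> {0<..<h}"

lemma slab_borel: "open \<Omega> \<Longrightarrow> slab \<Omega> \<in> sets borel"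
  by (intro borel_open open_Times) auto

lemma powr_integrable_slab:
  assumes "open \<Omega>" "bounded \<Omega>" "-1 < b"
  shows "integrable (lebesgue_on (slab \<Omega>)) (\<lambda>z. snd z powr b)"
proof -
  have "integrable lborel (\<lambda>x. indicator \<Omega> x :: real)"
    using assms lmeasurable_open[of \<Omega>]
    by (intro integrable_real_indicator) (auto simp: fmeasurable_def)
  from integrable_lborel_tensor[OF this powr_integrable_lborel[OF assms(3), of h]]
  have "integrable lborel (\<lambda>z. indicator (slab \<Omega>) z *\<^sub>R snd z powr b)"
    by (simp add: indicator_times mult.assoc)
  then show ?thesis
    using assms slab_borel by (subst integrable_lebesgue_on_borel) auto
qed

text \<open>After multiplication by y^(-a) the assumed bound becomes C (y^a + y^(-a)), integrable at
  0 because |a| < 1. The power y^(2a) serves components of size y^a, the 1 serves bounded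
  ones.\<close>

lemma weighted_L2:
  fixes g :: "'a::euclidean_space \<times> real \<Rightarrow> 'b::euclidean_space"
  assumes \<Omega>: "open \<Omega>" "bounded \<Omega>" and g: "g \<in> borel_measurable borel"
    and bound: "\<And>z. z \<in> slab \<Omega> \<Longrightarrow> (norm (g z))\<^sup>2 \<le> C * (snd z powr (2 * a) + 1)"
  shows "weighted (- a) g \<in> L2 (slab \<Omega>)"
proof (rule L2_boundI)
  show "weighted (- a) g \<in> borel_measurable (lebesgue_on (slab \<Omega>))"
    using g unfolding weighted_def[abs_def] by (intro borel_measurable_lebesgue_on_borel) measurable
  show "integrable (lebesgue_on (slab \<Omega>)) (\<lambda>z. C * (snd z powr a + snd z powr (- a)))"
    using powr_integrable_slab[OF \<Omega>, of a] powr_integrable_slab[OF \<Omega>, of "- a"] a by simp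
  show "(norm (weighted (- a) g z))\<^sup>2 \<le> C * (snd z powr a + snd z powr (- a))" if "z \<in> slab \<Omega>" for z
  proof -
    have y: "snd z > 0" using that by auto
    have "(norm (weighted (- a) g z))\<^sup>2 = snd z powr (- a) * (norm (g z))\<^sup>2"
      using y by (simp add: weighted_def power_mult_distrib powr_power)
    also have "\<dots> \<le> snd z powr (- a) * (C * (snd z powr (2 * a) + 1))"
      by (intro mult_left_mono bound that) simp
    also have "\<dots> = C * (snd z powr (- a) * snd z powr (2 * a) + snd z powr (- a))"
      by (simp add: algebra_simps)
    also have "snd z powr (- a) * snd z powr (2 * a) = snd z powr a"
      by (simp add: powr_add[symmetric])
    finally show ?thesis .
  qed
qed

lemma weighted_pairing_integrable:
  assumes "weighted a f \<in> L2 (slab \<Omega>)" "weighted (- a) g \<in> L2 (slab \<Omega>)"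
  shows "integrable (lebesgue_on (slab \<Omega>)) (\<lambda>z. f z \<bullet> g z)"
proof -
  have "integrable (lebesgue_on (slab \<Omega>)) (\<lambda>z. weighted a f z \<bullet> weighted (- a) g z)"
    by (rule L2_inner_integrable[OF assms])
  then show ?thesis
    by (rule Bochner_Integration.integrable_cong[THEN iffD1, rotated 2]) (auto simp: weighted_inner)
qed

lemma weighted_pairing_eq:
  "(LINT z|lebesgue_on (slab \<Omega>). weighted a f z \<bullet> weighted (- a) g z) = (LINT z|lebesgue_on (slab \<Omega>). f z \<bullet> g z)"
  by (rule Bochner_Integration.integral_cong) (auto simp: weighted_inner)

text \<open>Not the derivative of \<open>w\<close>: only the cutoff is differentiated, as in the
  y-component of y^a grad \<psi>.\<close>

definition w' :: "real \<Rightarrow> real" where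
  "w' y = indicator {0<..<h} y * (y powr a * grad cutoff y)"

text \<open>The field \<open>y powr a *\<^sub>R grad \<psi>\<close> for the test function \<open>\<psi> (x, y) = \<phi> x * cutoff y\<close>.\<close>

definition Y :: "('a::euclidean_space \<Rightarrow> real) \<Rightarrow> 'a \<times> real \<Rightarrow> 'a \<times> real" where
  "Y \<phi> z = (w (snd z) *\<^sub>R grad \<phi> (fst z), w' (snd z) * \<phi> (fst z))"

lemma w'_nonpos: "w' y \<le> 0"
  using grad_cutoff_nonpos[of y] by (auto simp: w'_def indicator_def mult_nonneg_nonpos)

lemma borel_measurable_w' [measurable]: "w' \<in> borel_measurable borel"
proof -
  have [measurable]: "grad cutoff \<in> borel_measurable borel"
    by (intro borel_measurable_continuous_onI continuous_on_grad smooth_cutoff)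
  show ?thesis
    unfolding w'_def[abs_def] by measurable
qed

lemma w_bound: "\<bar>w y\<bar> \<le> y powr a"
  using cutoff_bounds by (auto simp: w_def indicator_def abs_mult intro!: mult_left_le)

lemma weighted_ZY_L2:
  assumes \<Omega>: "open \<Omega>" "bounded \<Omega>" and \<phi>: "test_function \<Omega> \<phi>"
  shows "weighted (- a) (Z \<phi>) \<in> L2 (slab \<Omega>)" "weighted (- a) (Y \<phi>) \<in> L2 (slab \<Omega>)"
proof -
  note [measurable] = test_function_measurable[OF \<phi>]
  obtain C1 where C1: "C1 > 0" "\<And>x. norm (grad \<phi> x) \<le> C1"
    using test_function_grad_bounded[OF \<phi>] by blast
  obtain C2 where C2: "C2 > 0" "\<And>x. \<bar>laplacian \<phi> x\<bar> \<le> C2"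
    using test_function_bounded[OF test_function_laplacian[OF \<phi>]] by blast
  obtain C3 where C3: "C3 > 0" "\<And>x. \<bar>\<phi> x\<bar> \<le> C3"
    using test_function_bounded[OF \<phi>] by blast
  have "bounded (grad cutoff ` {0..h})"
    using continuous_on_grad[OF smooth_cutoff]
    by (intro compact_imp_bounded compact_continuous_image) (auto intro: continuous_on_subset)
  then obtain C4 where C4: "C4 > 0" "\<forall>y\<in>{0..h}. norm (grad cutoff y) \<le> C4"
    by (auto simp: bounded_pos)
  have sq: "(u * v)\<^sup>2 \<le> B\<^sup>2 * (y powr (2 * a))" if "\<bar>u\<bar> \<le> y powr a" "\<bar>v\<bar> \<le> B" for u v y B :: real
  proof -
    have "\<bar>u * v\<bar> \<le> y powr a * B"
      unfolding abs_mult using that by (intro mult_mono) auto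
    then have le: "(u * v)\<^sup>2 \<le> (y powr a * B)\<^sup>2"
      by (rule power2_le_iff_abs_le[THEN iffD2, rotated]) (use that in \<open>auto intro: order.trans[OF abs_ge_zero]\<close>)
    have "(y powr a)\<^sup>2 = y powr (2 * a)"
      by (simp add: power2_eq_square powr_add[symmetric])
    then have "(y powr a * B)\<^sup>2 = B\<^sup>2 * (y powr (2 * a))"
      by (simp add: power_mult_distrib)
    with le show ?thesis by simp
  qed
  have first: "(norm (w y *\<^sub>R grad \<phi> x))\<^sup>2 \<le> C1\<^sup>2 * y powr (2 * a)" for x y
    using sq[OF w_bound, of "norm (grad \<phi> x)" C1 y] C1(2)[of x] by (simp add: power_mult_distrib)
  show "weighted (- a) (Z \<phi>) \<in> L2 (slab \<Omega>)"
  proof (rule weighted_L2[OF \<Omega>])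
    show "Z \<phi> \<in> borel_measurable borel"
      unfolding Z_def[abs_def] by measurable
    show "(norm (Z \<phi> z))\<^sup>2 \<le> max (C1\<^sup>2) ((W 0 * C2)\<^sup>2) * (snd z powr (2 * a) + 1)" for z
    proof -
      have "\<bar>W' (snd z) * laplacian \<phi> (fst z)\<bar> \<le> W 0 * C2"
        unfolding abs_mult using W'_bounds[of "snd z"] W_0_pos C2 by (intro mult_mono) auto
      then have "(W' (snd z) * laplacian \<phi> (fst z))\<^sup>2 \<le> (W 0 * C2)\<^sup>2"
        using W_0_pos C2 by (simp add: power2_le_iff_abs_le)
      then have "(norm (Z \<phi> z))\<^sup>2 \<le> C1\<^sup>2 * snd z powr (2 * a) + (W 0 * C2)\<^sup>2 * 1"
        using first[of "snd z" "fst z"] by (simp add: Z_def norm_Pair)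
      also have "\<dots> \<le> max (C1\<^sup>2) ((W 0 * C2)\<^sup>2) * snd z powr (2 * a) + max (C1\<^sup>2) ((W 0 * C2)\<^sup>2) * 1"
        by (intro add_mono mult_right_mono) auto
      finally show ?thesis
        by (simp add: distrib_left)
    qed
  qed
  show "weighted (- a) (Y \<phi>) \<in> L2 (slab \<Omega>)"
  proof (rule weighted_L2[OF \<Omega>])
    show "Y \<phi> \<in> borel_measurable borel"
      unfolding Y_def[abs_def] by measurable
    show "(norm (Y \<phi> z))\<^sup>2 \<le> (C1\<^sup>2 + (C4 * C3)\<^sup>2) * (snd z powr (2 * a) + 1)" if z: "z \<in> slab \<Omega>" for z
    proof -
      have "\<bar>grad cutoff (snd z) * \<phi> (fst z)\<bar> \<le> C4 * C3"
        unfolding abs_mult using C4 C3 z by (intro mult_mono) auto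
      from sq[OF _ this, of "snd z powr a" "snd z"]
      have "(w' (snd z) * \<phi> (fst z))\<^sup>2 \<le> (C4 * C3)\<^sup>2 * snd z powr (2 * a)"
        using z by (auto simp: w'_def mult.assoc)
      then have "(norm (Y \<phi> z))\<^sup>2 \<le> C1\<^sup>2 * snd z powr (2 * a) + (C4 * C3)\<^sup>2 * snd z powr (2 * a)"
        using first[of "snd z" "fst z"] by (simp add: Y_def norm_Pair)
      also have "\<dots> \<le> (C1\<^sup>2 + (C4 * C3)\<^sup>2) * (snd z powr (2 * a) + 1)"
        by (simp add: algebra_simps)
      finally show ?thesis .
    qed
  qed
qed

text \<open>Both sides pass to the limit along the smooth functions of \<open>has_trace\<close>: the
  left because the weighted gradients converge in L2 and \<open>Z\<close> lies in the dual weighted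
  space, the right because the restrictions to y = 0 converge in L2.\<close>

lemma trace_identity:
  assumes \<Omega>: "open \<Omega>" "bounded \<Omega>" and \<phi>: "test_function \<Omega> \<phi>"
    and trace: "has_trace a \<Omega> h u Du u0"
  shows "(LINT z|lebesgue_on (slab \<Omega>). Du z \<bullet> Z \<phi> z) = - W 0 * (LINT x|lebesgue_on \<Omega>. u0 x * laplacian \<phi> x)"
proof -
  obtain v where v: "\<And>k. smooth_on UNIV (v k)"
    and Dv: "L2_lim (slab \<Omega>) (\<lambda>k. weighted a (grad (v k))) (weighted a Du)"
    and v0: "L2_lim \<Omega> (\<lambda>k x. v k (x, 0)) u0"
    using trace unfolding has_trace_def by blast
  note [measurable] = test_function_measurable[OF \<phi>]
  have out: "grad \<phi> x = 0" "laplacian \<phi> x = 0" if "x \<notin> \<Omega>" for x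
  proof -
    obtain K where K: "compact K" "K \<subseteq> \<Omega>" "\<And>x. x \<notin> K \<Longrightarrow> \<phi> x = 0"
      using test_functionE[OF \<phi>] by blast
    show "grad \<phi> x = 0"
      by (rule grad_zero_outside[OF compact_imp_closed[OF K(1)] K(3)]) (use that K(2) in auto)
    obtain L where L: "compact L" "L \<subseteq> \<Omega>" "\<And>x. x \<notin> L \<Longrightarrow> laplacian \<phi> x = 0"
      using test_functionE[OF test_function_laplacian[OF \<phi>]] by blast
    show "laplacian \<phi> x = 0"
      by (rule L(3)) (use that L(2) in auto)
  qed
  have smooth: "(LINT z|lebesgue_on (slab \<Omega>). grad (v k) z \<bullet> Z \<phi> z) =
      - W 0 * (LINT x|lebesgue_on \<Omega>. v k (x, 0) * laplacian \<phi> x)" for k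
  proof -
    have [measurable]: "grad (v k) \<in> borel_measurable borel"
      by (intro borel_measurable_continuous_onI continuous_on_grad v)
    have "(LINT z|lebesgue_on (slab \<Omega>). grad (v k) z \<bullet> Z \<phi> z) = (LINT z|lborel. grad (v k) z \<bullet> Z \<phi> z)"
    proof (rule integral_lebesgue_on_eq[OF slab_borel[OF \<Omega>(1)]])
      show "(\<lambda>z. grad (v k) z \<bullet> Z \<phi> z) \<in> borel_measurable borel"
        unfolding Z_def by measurable
      show "indicator (slab \<Omega>) z *\<^sub>R (grad (v k) z \<bullet> Z \<phi> z) = grad (v k) z \<bullet> Z \<phi> z" for z
        using out[of "fst z"] by (cases z) (auto simp: indicator_def Z_def w_def W'_def zero_prod_def[symmetric])
    qed
    also have "\<dots> = - W 0 * (LINT x|lborel. v k (x, 0) * laplacian \<phi> x)"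
      by (rule trace_identity_smooth[OF \<phi> v])
    also have "(LINT x|lborel. v k (x, 0) * laplacian \<phi> x) = (LINT x|lebesgue_on \<Omega>. v k (x, 0) * laplacian \<phi> x)"
    proof (rule integral_lebesgue_on_test_function[OF \<Omega>(1), symmetric])
      have "continuous_on UNIV (\<lambda>x. v k (x, 0))"
        by (rule continuous_on_compose2[OF smooth_on_continuous[OF v]]) (auto intro!: continuous_intros)
      then show "continuous_on UNIV (\<lambda>x. v k (x, 0) * laplacian \<phi> x)"
        by (rule continuous_on_mult[OF _ smooth_on_continuous[OF smooth_on_laplacian[OF test_function_smooth[OF \<phi>]]]])
    qed (use out in auto)
    finally show ?thesis .
  qed
  have "(\<lambda>k. LINT z|lebesgue_on (slab \<Omega>). grad (v k) z \<bullet> Z \<phi> z) \<longlonglongrightarrow> (LINT z|lebesgue_on (slab \<Omega>). Du z \<bullet> Z \<phi> z)"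
    using L2_lim_inner[OF Dv L2_lim_const[OF weighted_ZY_L2(1)[OF \<Omega> \<phi>]]] by (simp only: weighted_pairing_eq)
  moreover have "(\<lambda>k. LINT x|lebesgue_on \<Omega>. v k (x, 0) * laplacian \<phi> x) \<longlonglongrightarrow> (LINT x|lebesgue_on \<Omega>. u0 x * laplacian \<phi> x)"
    using L2_lim_inner[OF v0 L2_lim_const[OF test_function_L2[OF \<Omega> test_function_laplacian[OF \<phi>]]]] by simp
  then have "(\<lambda>k. - W 0 * (LINT x|lebesgue_on \<Omega>. v k (x, 0) * laplacian \<phi> x)) \<longlonglongrightarrow> - W 0 * (LINT x|lebesgue_on \<Omega>. u0 x * laplacian \<phi> x)"
    by (intro tendsto_mult tendsto_const)
  ultimately show ?thesis
    unfolding smooth by (rule LIMSEQ_unique)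
qed

text \<open>The positive part of u0 is zero wherever \<phi> is not, so the boundary term of the
  equation vanishes. The domain shrinks to the slab because the cutoff and its derivative are 0 from
  height h on.\<close>

lemma weak_equation_identity:
  assumes \<Omega>: "open \<Omega>" and \<phi>: "test_function \<Omega> \<phi>"
    and u0: "\<And>x. \<phi> x \<noteq> 0 \<Longrightarrow> u0 x \<le> 0"
    and weak: "\<And>\<psi>. test_function (\<Omega> \<times> UNIV) \<psi> \<Longrightarrow>
      (LINT z|lebesgue_on (\<Omega> \<times> {0<..}). (snd z) powr a * (Du z \<bullet> grad \<psi> z)) =
        lam * (LINT x|lebesgue_on \<Omega>. max (u0 x) 0 * \<psi> (x, 0))"
  shows "(LINT z|lebesgue_on (slab \<Omega>). Du z \<bullet> Y \<phi> z) = 0"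
proof -
  define \<psi> where "\<psi> z = \<phi> (fst z) * cutoff (snd z)" for z
  have "test_function (\<Omega> \<times> UNIV) \<psi>"
    unfolding \<psi>_def
  proof (rule test_function_tensor[OF \<phi> smooth_cutoff])
    show "compact {-h..h}" by simp
    show "cutoff y = 0" if "y \<notin> {-h..h}" for y
      using that by (intro cutoff_eq_0) auto
  qed
  from weak[OF this]
  have "(LINT z|lebesgue_on (\<Omega> \<times> {0<..}). (snd z) powr a * (Du z \<bullet> grad \<psi> z)) = 0"
    using u0 by (subst (asm) Bochner_Integration.integral_cong[OF refl, where g="\<lambda>x. 0"]) (auto simp: \<psi>_def max_def)
  moreover have "(LINT z|lebesgue_on (\<Omega> \<times> {0<..}). (snd z) powr a * (Du z \<bullet> grad \<psi> z)) =
      (LINT z|lebesgue_on (slab \<Omega>). Du z \<bullet> Y \<phi> z)"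
  proof -
    have "open (\<Omega> \<times> {0::real<..})" by (intro open_Times \<Omega>) auto
    then have s: "\<Omega> \<times> {0::real<..} \<in> sets lebesgue" "slab \<Omega> \<in> sets lebesgue"
      using slab_borel[OF \<Omega>] by auto
    have g: "grad \<psi> z = (cutoff (snd z) *\<^sub>R grad \<phi> (fst z), \<phi> (fst z) *\<^sub>R grad cutoff (snd z))" for z
      unfolding \<psi>_def by (rule grad_tensor[OF test_function_smooth[OF \<phi>] smooth_cutoff])
    have "indicator (\<Omega> \<times> {0<..}) z *\<^sub>R (snd z powr a * (Du z \<bullet> grad \<psi> z)) = indicator (slab \<Omega>) z *\<^sub>R (Du z \<bullet> Y \<phi> z)" for z
    proof (cases "z \<in> slab \<Omega>")
      case True
      then show ?thesis
        by (auto simp: g Y_def w_def w'_def inner_prod_def algebra_simps)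
    next
      case False
      then show ?thesis
        using cutoff_eq_0[of "snd z"] grad_cutoff_eq_0[of "snd z"]
        by (cases "h \<le> snd z") (auto simp: g indicator_def zero_prod_def[symmetric])
    qed
    then show ?thesis
      using s by (simp add: integral_restrict_space)
  qed
  ultimately show ?thesis by simp
qed

text \<open>\<open>Y\<close> and \<open>Z\<close> have the same x-component, so Du . (Z - Y)
  contains u_y only. The part from \<open>Y\<close> is - u_y w' \<phi> <= 0, since u_y and w' are
  both nonpositive; the part from \<open>Z\<close> is at most W 0 C |u_y|. The common factor
  \<open>W 0\<close> then cancels.\<close>

lemma trace_laplacian_bound:
  assumes \<Omega>: "open \<Omega>" "bounded \<Omega>" and \<phi>: "test_function \<Omega> \<phi>" "\<And>x. 0 \<le> \<phi> x"
    and C: "\<And>x. \<bar>laplacian \<phi> x\<bar> \<le> C"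
    and trace: "has_trace a \<Omega> h u Du u0" and Du: "weighted a Du \<in> L2 (slab \<Omega>)"
    and weak: "(LINT z|lebesgue_on (slab \<Omega>). Du z \<bullet> Y \<phi> z) = 0"
    and mono: "AE z in lebesgue_on (slab \<Omega>). snd (Du z) \<le> 0"
  shows "- (LINT x|lebesgue_on \<Omega>. u0 x * laplacian \<phi> x) \<le> C * (LINT z|lebesgue_on (slab \<Omega>). \<bar>snd (Du z)\<bar>)"
    and "integrable (lebesgue_on (slab \<Omega>)) (\<lambda>z. \<bar>snd (Du z)\<bar>)"
proof -
  \<comment> \<open>Pairing with the constant field (0,1), which has finite norm for the weight
    y^(-a) on the slab, makes u_y integrable.\<close>
  have "weighted (- a) (\<lambda>z. (0 :: 'a, 1 :: real)) \<in> L2 (slab \<Omega>)"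
    by (rule weighted_L2[OF \<Omega>, of _ 1]) (auto simp: norm_Pair)
  from weighted_pairing_integrable[OF Du this]
  show int: "integrable (lebesgue_on (slab \<Omega>)) (\<lambda>z. \<bar>snd (Du z)\<bar>)"
    by (simp add: inner_prod_def integrable_abs)
  note iZ = weighted_pairing_integrable[OF Du weighted_ZY_L2(1)[OF \<Omega> \<phi>(1)]]
  note iY = weighted_pairing_integrable[OF Du weighted_ZY_L2(2)[OF \<Omega> \<phi>(1)]]
  have "- W 0 * (LINT x|lebesgue_on \<Omega>. u0 x * laplacian \<phi> x) = (LINT z|lebesgue_on (slab \<Omega>). Du z \<bullet> Z \<phi> z - Du z \<bullet> Y \<phi> z)"
    using trace_identity[OF \<Omega> \<phi>(1) trace] weak iZ iY by simp
  also have "\<dots> \<le> (LINT z|lebesgue_on (slab \<Omega>). (W 0 * C) * \<bar>snd (Du z)\<bar>)"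
  proof (rule integral_mono_AE)
    show "AE z in lebesgue_on (slab \<Omega>). Du z \<bullet> Z \<phi> z - Du z \<bullet> Y \<phi> z \<le> (W 0 * C) * \<bar>snd (Du z)\<bar>"
      using mono
    proof (rule AE_mp, intro AE_I2 impI)
      fix z assume "snd (Du z) \<le> 0"
      then have "0 \<le> snd (Du z) * (w' (snd z) * \<phi> (fst z))"
        using w'_nonpos[of "snd z"] \<phi>(2)[of "fst z"] by (intro mult_nonpos_nonpos mult_nonpos_nonneg)
      moreover have "snd (Du z) * (W' (snd z) * laplacian \<phi> (fst z)) \<le> \<bar>snd (Du z)\<bar> * (W 0 * C)"
      proof -
        have "\<bar>W' (snd z) * laplacian \<phi> (fst z)\<bar> \<le> W 0 * C"
          unfolding abs_mult using W'_bounds[of "snd z"] W_0_pos C by (intro mult_mono) auto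
        then have "\<bar>snd (Du z) * (W' (snd z) * laplacian \<phi> (fst z))\<bar> \<le> \<bar>snd (Du z)\<bar> * (W 0 * C)"
          unfolding abs_mult[of "snd (Du z)"] by (intro mult_left_mono) auto
        then show ?thesis by linarith
      qed
      moreover have "Du z \<bullet> Z \<phi> z - Du z \<bullet> Y \<phi> z =
          snd (Du z) * (W' (snd z) * laplacian \<phi> (fst z)) - snd (Du z) * (w' (snd z) * \<phi> (fst z))"
        by (simp add: Z_def Y_def inner_prod_def)
      ultimately show "Du z \<bullet> Z \<phi> z - Du z \<bullet> Y \<phi> z \<le> (W 0 * C) * \<bar>snd (Du z)\<bar>"
        by (simp add: mult.commute)
    qed
  qed (use iZ iY int in auto)
  also have "\<dots> = W 0 * (C * (LINT z|lebesgue_on (slab \<Omega>). \<bar>snd (Du z)\<bar>))"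
    by simp
  finally have "W 0 * - (LINT x|lebesgue_on \<Omega>. u0 x * laplacian \<phi> x) \<le> W 0 * (C * (LINT z|lebesgue_on (slab \<Omega>). \<bar>snd (Du z)\<bar>))"
    by simp
  then show "- (LINT x|lebesgue_on \<Omega>. u0 x * laplacian \<phi> x) \<le> C * (LINT z|lebesgue_on (slab \<Omega>). \<bar>snd (Du z)\<bar>)"
    using W_0_pos by (rule mult_left_le_imp_le)
qed

end

text \<open>The constant C does not depend on the height of the slab, and the integral of |u_y| over
  the slabs of height 1/(k+1) tends to 0.\<close>

lemma thin_eigen_trace_subharmonic:
  fixes \<Omega> :: "'a::euclidean_space set"
  assumes \<Omega>: "open \<Omega>" "bounded \<Omega>" and a: "-1 < a" "a < 1"
    and sol: "thin_eigen_solution \<Omega> a lam u Du u0"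
    and mono: "AE z in lebesgue_on (\<Omega> \<times> {0<..}). snd (Du z) \<le> 0"
    and \<phi>: "test_function \<Omega> \<phi>" "\<And>x. 0 \<le> \<phi> x" "\<And>x. \<phi> x \<noteq> 0 \<Longrightarrow> u0 x \<le> 0"
  shows "0 \<le> (LINT x|lebesgue_on \<Omega>. u0 x * laplacian \<phi> x)"
proof -
  obtain C where C: "C > 0" "\<And>x. \<bar>laplacian \<phi> x\<bar> \<le> C"
    using test_function_bounded[OF test_function_laplacian[OF \<phi>(1)]] by blast
  define S where "S k = \<Omega> \<times> {0<..<1 / real (Suc k)}" for k
  have S: "S k \<in> sets lebesgue" for k
    using \<Omega> unfolding S_def by (intro lmeasurable_open[THEN fmeasurableD] bounded_Times open_Times) auto
  have Sm: "S k \<subseteq> S 0" for k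
  proof -
    have "{0<..<1 / real (Suc k)} \<subseteq> {0<..<1 / real (Suc 0)}"
      by (rule greaterThanLessThan_subseteq_greaterThanLessThan[THEN iffD2]) simp
    then show ?thesis unfolding S_def by blast
  qed
  have monoS: "AE z in lebesgue_on (S k). snd (Du z) \<le> 0" for k
  proof -
    have "open (\<Omega> \<times> {0::real<..})" by (intro open_Times \<Omega>) auto
    then have "AE z in lebesgue. z \<in> \<Omega> \<times> {0<..} \<longrightarrow> snd (Du z) \<le> 0"
      using mono by (subst (asm) AE_restrict_space_iff) auto
    then show ?thesis
      using S[of k] by (subst AE_restrict_space_iff) (auto simp: S_def elim: AE_mp)
  qed
  have bound: "- (LINT x|lebesgue_on \<Omega>. u0 x * laplacian \<phi> x) \<le> C * (LINT z|lebesgue_on (S k). \<bar>snd (Du z)\<bar>)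
      \<and> integrable (lebesgue_on (S k)) (\<lambda>z. \<bar>snd (Du z)\<bar>)" for k
  proof -
    interpret weight a "1 / real (Suc k)"
      using a by unfold_locales auto
    have "has_trace a \<Omega> (1 / real (Suc k)) u Du u0" "weighted a Du \<in> L2 (slab \<Omega>)"
      using sol unfolding thin_eigen_solution_def in_H1_def by auto
    moreover have "(LINT z|lebesgue_on (slab \<Omega>). Du z \<bullet> Y \<phi> z) = 0"
      using sol unfolding thin_eigen_solution_def
      by (intro weak_equation_identity[OF \<Omega>(1) \<phi>(1,3)]) blast+
    ultimately show ?thesis
      using trace_laplacian_bound[OF \<Omega> \<phi>(1,2) C(2)] monoS[of k] unfolding S_def by blast
  qed
  \<comment> \<open>The slab \<open>S 0\<close> dominates, and every point with y > 0 eventually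
    leaves the slabs.\<close>
  have "(\<lambda>k. LINT z|lebesgue. indicator (S k) z *\<^sub>R \<bar>snd (Du z)\<bar>) \<longlonglongrightarrow> (LINT z|(lebesgue :: ('a \<times> real) measure). 0 :: real)"
  proof (rule integral_dominated_convergence[where w="\<lambda>z. indicator (S 0) z *\<^sub>R \<bar>snd (Du z)\<bar>"])
    show "integrable lebesgue (\<lambda>z. indicator (S 0) z *\<^sub>R \<bar>snd (Du z)\<bar>)"
      using bound[of 0] S by (simp add: integrable_restrict_space)
    show "(\<lambda>z. indicator (S k) z *\<^sub>R \<bar>snd (Du z)\<bar>) \<in> borel_measurable lebesgue" for k
      using bound[of k] S[of k] by (auto simp: integrable_restrict_space)
    show "AE z in lebesgue. (\<lambda>k. indicator (S k) z *\<^sub>R \<bar>snd (Du z)\<bar>) \<longlonglongrightarrow> 0"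
    proof (rule AE_I2)
      fix z :: "'a \<times> real"
      have "\<forall>\<^sub>F k in sequentially. indicator (S k) z *\<^sub>R \<bar>snd (Du z)\<bar> = 0"
      proof (cases "snd z > 0")
        case True
        then have "\<forall>\<^sub>F k in sequentially. inverse (real (Suc k)) < snd z"
          using order_tendstoD(2)[OF LIMSEQ_inverse_real_of_nat] by blast
        then show ?thesis
          by eventually_elim (auto simp: S_def indicator_def inverse_eq_divide)
      next
        case False
        then show ?thesis
          by (intro always_eventually) (auto simp: S_def indicator_def)
      qed
      then show "(\<lambda>k. indicator (S k) z *\<^sub>R \<bar>snd (Du z)\<bar>) \<longlonglongrightarrow> 0"
        by (rule tendsto_eventually)
    qed
    show "AE z in lebesgue. norm (indicator (S k) z *\<^sub>R \<bar>snd (Du z)\<bar>) \<le> indicator (S 0) z *\<^sub>R \<bar>snd (Du z)\<bar>" for k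
      using Sm[of k] by (auto simp: indicator_def)
  qed simp
  then have "(\<lambda>k. C * (LINT z|lebesgue_on (S k). \<bar>snd (Du z)\<bar>)) \<longlonglongrightarrow> C * 0"
    using S by (intro tendsto_mult tendsto_const) (simp add: integral_restrict_space)
  then have "- (LINT x|lebesgue_on \<Omega>. u0 x * laplacian \<phi> x) \<le> C * 0"
    by (rule Lim_bounded2) (use bound in auto)
  then show ?thesis by simp
qed

section \<open>The spectral fractional Laplacian off the support\<close>

text \<open>A smooth substitute for the absolute value, under which test functions are stable.\<close>

definition soft_abs :: "real \<Rightarrow> real \<Rightarrow> real" where
  "soft_abs d t = (t\<^sup>2 + d\<^sup>2) powr (1 / 2) - d"

lemma soft_abs_bounds:
  assumes "d > 0"
  shows "\<bar>t\<bar> - d \<le> soft_abs d t" "0 \<le> soft_abs d t" "soft_abs d t \<le> \<bar>t\<bar>" "soft_abs d 0 = 0"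
proof -
  have eq: "soft_abs d t = sqrt (t\<^sup>2 + d\<^sup>2) - d" for t
    by (simp add: soft_abs_def powr_half_sqrt)
  show "\<bar>t\<bar> - d \<le> soft_abs d t"
    unfolding eq using real_sqrt_ge_abs1[of t d] by linarith
  show "0 \<le> soft_abs d t"
    unfolding eq using real_sqrt_ge_abs2[of d t] assms by linarith
  show "soft_abs d t \<le> \<bar>t\<bar>"
    unfolding eq using sqrt_sum_squares_le_sum_abs[of t d] assms by linarith
  show "soft_abs d 0 = 0"
    unfolding eq using assms by simp
qed

lemma powr_sum_squares_has_derivative:
  fixes \<psi> :: "'a::euclidean_space \<Rightarrow> real"
  assumes "d > 0" "\<psi> differentiable (at x)"
  shows "((\<lambda>x. ((\<psi> x)\<^sup>2 + d\<^sup>2) powr m) has_derivative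
    (\<lambda>v. (2 * m) * (((\<psi> x)\<^sup>2 + d\<^sup>2) powr (m - 1) * (\<psi> x * dir_deriv v \<psi> x)))) (at x)"
proof -
  have pos: "(\<psi> x)\<^sup>2 + d\<^sup>2 > 0"
    using assms(1) by (simp add: add_nonneg_pos)
  have "((\<lambda>t. (t\<^sup>2 + d\<^sup>2) powr m) has_real_derivative m * ((\<psi> x)\<^sup>2 + d\<^sup>2) powr (m - 1) * (2 * \<psi> x)) (at (\<psi> x))"
    using pos by (auto intro!: derivative_eq_intros)
  from has_derivative_compose[OF has_derivative_dir_deriv[OF assms(2)] this[unfolded has_field_derivative_def]]
  show ?thesis
    by (simp add: mult_ac)
qed

text \<open>All exponents are treated together, since differentiation lowers m by one and produces
  the smooth factor \<psi> times a derivative of \<psi>. This is why \<open>soft_abs\<close> is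
  written with \<open>powr\<close> rather than with a square root.\<close>

lemma smooth_on_powr_sum_squares:
  fixes \<psi> :: "'a::euclidean_space \<Rightarrow> real"
  assumes "d > 0" and \<psi>: "smooth_on UNIV \<psi>"
  shows "smooth_on UNIV (\<lambda>x. ((\<psi> x)\<^sup>2 + d\<^sup>2) powr m)"
proof -
  define F where "F = {f :: 'a \<Rightarrow> real. smooth_on UNIV f} \<union> range (\<lambda>m x. ((\<psi> x)\<^sup>2 + d\<^sup>2) powr m)"
  have 1: "f \<in> F" if "smooth_on UNIV f" for f
    using that by (simp add: F_def)
  have 2: "(\<lambda>x. ((\<psi> x)\<^sup>2 + d\<^sup>2) powr m) \<in> F" for m
    unfolding F_def by blast
  have cases: "smooth_on UNIV f \<or> (\<exists>m. f = (\<lambda>x. ((\<psi> x)\<^sup>2 + d\<^sup>2) powr m))" if "f \<in> F" for f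
    using that by (auto simp: F_def)
  note der = powr_sum_squares_has_derivative[OF assms(1) smooth_on_differentiable[OF \<psi>]]
  show ?thesis
  proof (rule smooth_on_alg[OF alg.base[OF 2]])
    show "f differentiable (at x)" if "f \<in> F" for f x
      using cases[OF that] by (elim disjE exE) (simp_all add: smooth_on_differentiable differentiableI[OF der])
    show "dir_deriv v f \<in> alg F" if "f \<in> F" for f v
      using cases[OF that]
    proof (elim disjE exE)
      assume "smooth_on UNIV f"
      then show ?thesis
        by (intro alg.base 1 smooth_on_dir_deriv)
    next
      fix m assume f: "f = (\<lambda>x. ((\<psi> x)\<^sup>2 + d\<^sup>2) powr m)"
      have "dir_deriv v f = (\<lambda>x. (2 * m) * (((\<psi> x)\<^sup>2 + d\<^sup>2) powr (m - 1) * (\<psi> x * dir_deriv v \<psi> x)))"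
        unfolding f by (rule dir_deriv_eq[OF der])
      also have "\<dots> \<in> alg F"
        by (intro alg.mult[OF alg.const alg.mult[OF alg.base[OF 2] alg.mult[OF alg.base alg.base]]] 1 \<psi> smooth_on_dir_deriv)
      finally show ?thesis .
    qed
  qed
qed

text \<open>The - d in \<open>soft_abs\<close> sends 0 to 0 and so keeps the support inside that of
  \<psi>. The chain rule multiplies the gradient by \<psi> / sqrt (\<psi>^2 + d^2), which is at most
  1 in absolute value.\<close>

lemma test_function_soft_abs:
  assumes d: "d > 0" and \<psi>: "test_function U \<psi>"
  shows "test_function U (\<lambda>x. soft_abs d (\<psi> x))"
    and "norm (grad (\<lambda>x. soft_abs d (\<psi> x)) x) \<le> norm (grad \<psi> x)"
proof -
  note s = test_function_smooth[OF \<psi>]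
  obtain K where K: "compact K" "K \<subseteq> U" "\<And>x. x \<notin> K \<Longrightarrow> \<psi> x = 0"
    using test_functionE[OF \<psi>] by blast
  have "(\<lambda>x. ((\<psi> x)\<^sup>2 + d\<^sup>2) powr (1 / 2) + (- d)) \<in> alg {f. smooth_on UNIV f}"
    by (rule alg.add[OF alg.base alg.const]) (simp add: smooth_on_powr_sum_squares d s)
  from smooth_on_in_alg[OF this] have sm: "smooth_on UNIV (\<lambda>x. soft_abs d (\<psi> x))"
    by (simp add: soft_abs_def)
  show "test_function U (\<lambda>x. soft_abs d (\<psi> x))"
  proof (rule test_functionI[OF sm K(1,2)])
    show "soft_abs d (\<psi> x) = 0" if "x \<notin> K" for x
      using K(3)[OF that] soft_abs_bounds(4)[OF d] by simp
  qed
  define q where "q = ((\<psi> x)\<^sup>2 + d\<^sup>2) powr (- 1 / 2)"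
  have "((\<lambda>x. soft_abs d (\<psi> x)) has_derivative (\<lambda>v. q * (\<psi> x * dir_deriv v \<psi> x))) (at x)"
    using has_derivative_diff[OF powr_sum_squares_has_derivative[OF d smooth_on_differentiable[OF s], where m="1 / 2"]
        has_derivative_const[of d]]
    by (simp add: soft_abs_def q_def)
  from frechet_derivative_at[OF this, symmetric]
  have "dir_deriv v (\<lambda>x. soft_abs d (\<psi> x)) x = q * \<psi> x * dir_deriv v \<psi> x" for v
    by (simp add: dir_deriv_def[of v "\<lambda>x. soft_abs d (\<psi> x)"])
  then have g: "grad (\<lambda>x. soft_abs d (\<psi> x)) x = (q * \<psi> x) *\<^sub>R grad \<psi> x"
    by (simp add: grad_eq scaleR_sum_right)
  have "\<bar>q * \<psi> x\<bar> \<le> 1"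
  proof -
    have pos: "(\<psi> x)\<^sup>2 + d\<^sup>2 > 0"
      using d by (simp add: add_nonneg_pos)
    then have "q = 1 / sqrt ((\<psi> x)\<^sup>2 + d\<^sup>2)"
      by (simp add: q_def powr_minus powr_half_sqrt inverse_eq_divide)
    then show ?thesis
      using real_sqrt_ge_abs1[of "\<psi> x" d] pos by (simp add: abs_mult)
  qed
  then show "norm (grad (\<lambda>x. soft_abs d (\<psi> x)) x) \<le> norm (grad \<psi> x)"
    unfolding g norm_scaleR by (rule mult_left_le_one_le[rotated 2]) auto
qed

subsection \<open>The Dirichlet form in terms of the eigensystem\<close>

definition L2_inner :: "'a::euclidean_space set \<Rightarrow> ('a \<Rightarrow> 'b::euclidean_space) \<Rightarrow> ('a \<Rightarrow> 'b) \<Rightarrow> real" where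
  "L2_inner U f g = (LINT x|lebesgue_on U. f x \<bullet> g x)"

lemma L2_inner_commute: "L2_inner U f g = L2_inner U g f"
  by (simp add: L2_inner_def inner_commute)

lemma L2_inner_diff_left:
  "f \<in> L2 U \<Longrightarrow> g \<in> L2 U \<Longrightarrow> h \<in> L2 U \<Longrightarrow> L2_inner U (\<lambda>x. f x - g x) h = L2_inner U f h - L2_inner U g h"
  by (simp add: L2_inner_def inner_diff_left L2_inner_integrable)

lemma L2_inner_add_left:
  "f \<in> L2 U \<Longrightarrow> g \<in> L2 U \<Longrightarrow> h \<in> L2 U \<Longrightarrow> L2_inner U (\<lambda>x. f x + g x) h = L2_inner U f h + L2_inner U g h"
  by (simp add: L2_inner_def inner_add_left L2_inner_integrable)

lemma L2_inner_sum_left: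
  assumes "\<And>i. i \<in> I \<Longrightarrow> f i \<in> L2 U" "g \<in> L2 U"
  shows "L2_inner U (\<lambda>x. \<Sum>i\<in>I. c i *\<^sub>R f i x) g = (\<Sum>i\<in>I. c i * L2_inner U (f i) g)"
  using assms by (simp add: L2_inner_def inner_sum_left L2_inner_integrable)

lemma L2_inner_nonneg: "0 \<le> L2_inner U f f"
  by (simp add: L2_inner_def)

lemma L2_lim_L2_inner: "L2_lim U F f \<Longrightarrow> L2_lim U G g \<Longrightarrow> (\<lambda>k. L2_inner U (F k) (G k)) \<longlonglongrightarrow> L2_inner U f g"
  unfolding L2_inner_def by (rule L2_lim_inner)

lemma test_function_grad_L2:
  assumes "open U" "bounded U" "test_function V f"
  shows "grad f \<in> L2 U"
proof -
  have "(\<lambda>x. \<Sum>b\<in>Basis. dir_deriv b f x *\<^sub>R b) \<in> L2 U"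
  proof (rule L2_sum)
    fix b :: 'a assume "b \<in> Basis"
    have "dir_deriv b f \<in> L2 U"
      by (rule test_function_L2[OF assms(1,2) test_function_dir_deriv[OF assms(3)]])
    then show "(\<lambda>x. dir_deriv b f x *\<^sub>R b) \<in> L2 U"
      by (simp add: L2_def power_mult_distrib borel_measurable_scaleR)
  qed
  then show ?thesis
    by (simp add: grad_eq[abs_def])
qed

lemma test_function_laplacian_by_parts:
  assumes \<Omega>: "open \<Omega>" "bounded \<Omega>" and \<psi>: "test_function \<Omega> \<psi>" and \<eta>: "test_function \<Omega> \<eta>"
  shows "L2_inner \<Omega> \<psi> (laplacian \<eta>) = - L2_inner \<Omega> (grad \<psi>) (grad \<eta>)"
proof -
  note s = test_function_smooth[OF \<psi>] test_function_smooth[OF \<eta>]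
  note t = test_function_dir_deriv[OF \<eta>] test_function_dir_deriv[OF \<psi>]
  have borel: "(LINT x|lebesgue_on \<Omega>. f x * g x) = (LINT x|lborel. f x * g x)"
    if "test_function \<Omega> f" "test_function \<Omega> g" for f g
  proof (rule integral_lebesgue_on_test_function[OF \<Omega>(1)])
    note tf = that
    show "continuous_on UNIV (\<lambda>x. f x * g x)"
      by (intro continuous_on_mult smooth_on_continuous test_function_smooth[OF tf(1)] test_function_smooth[OF tf(2)])
    obtain K where K: "compact K" "K \<subseteq> \<Omega>" "\<And>x. x \<notin> K \<Longrightarrow> f x = 0"
      using test_functionE[OF tf(1)] by blast
    show "f x * g x = 0" if "x \<notin> \<Omega>" for x
      using that K(2) K(3)[of x] by auto
  qed
  have int: "integrable (lebesgue_on \<Omega>) (\<lambda>x. f x * g x)"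
    if "test_function \<Omega> f" "test_function \<Omega> g" for f g :: "'a \<Rightarrow> real"
    using L2_inner_integrable[OF test_function_L2[OF \<Omega> that(1)] test_function_L2[OF \<Omega> that(2)]] by simp
  have "L2_inner \<Omega> \<psi> (laplacian \<eta>) = (LINT x|lebesgue_on \<Omega>. (\<Sum>b\<in>Basis. \<psi> x * dir_deriv b (dir_deriv b \<eta>) x))"
    by (simp add: L2_inner_def laplacian_def sum_distrib_left)
  also have "\<dots> = (\<Sum>b\<in>Basis. LINT x|lebesgue_on \<Omega>. \<psi> x * dir_deriv b (dir_deriv b \<eta>) x)"
    by (intro Bochner_Integration.integral_sum int \<psi> test_function_dir_deriv \<eta>)
  also have "\<dots> = (\<Sum>b\<in>Basis. - (LINT x|lebesgue_on \<Omega>. dir_deriv b \<psi> x * dir_deriv b \<eta> x))"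
    using borel[OF \<psi> test_function_dir_deriv[OF t(1)]] borel[OF t(2) t(1)] integral_by_parts_dir_deriv[OF s(1) t(1)]
    by simp
  also have "\<dots> = - (LINT x|lebesgue_on \<Omega>. (\<Sum>b\<in>Basis. dir_deriv b \<psi> x * dir_deriv b \<eta> x))"
    by (simp add: sum_negf Bochner_Integration.integral_sum int[OF t(2) t(1)])
  also have "(\<lambda>x. \<Sum>b\<in>Basis. dir_deriv b \<psi> x * dir_deriv b \<eta> x) = (\<lambda>x. grad \<psi> x \<bullet> grad \<eta> x)"
    by (rule ext, subst euclidean_inner) (simp add: grad_inner_Basis)
  finally show ?thesis
    by (simp add: L2_inner_def)
qed

locale eigensystem =
  fixes \<Omega> :: "'a::euclidean_space set" and \<mu> :: "nat \<Rightarrow> real" and \<phi> :: "nat \<Rightarrow> 'a \<Rightarrow> real"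
  assumes open_\<Omega>: "open \<Omega>" and bounded_\<Omega>: "bounded \<Omega>" and eig: "dirichlet_eigensystem \<Omega> \<mu> \<phi>"
begin

abbreviation ip :: "('a \<Rightarrow> 'b::euclidean_space) \<Rightarrow> ('a \<Rightarrow> 'b) \<Rightarrow> real" where
  "ip \<equiv> L2_inner \<Omega>"

definition coef :: "('a \<Rightarrow> real) \<Rightarrow> nat \<Rightarrow> real" where
  "coef f k = ip f (\<phi> k)"

definition D\<phi> :: "nat \<Rightarrow> 'a \<Rightarrow> 'a" where
  "D\<phi> k = (SOME G. in_H10 \<Omega> (\<phi> k) G \<and>
       (\<forall>\<psi>. test_function \<Omega> \<psi> \<longrightarrow>
          (LINT x|lebesgue_on \<Omega>. G x \<bullet> grad \<psi> x) = \<mu> k * (LINT x|lebesgue_on \<Omega>. \<phi> k x * \<psi> x)))"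

lemma D\<phi>: "in_H10 \<Omega> (\<phi> k) (D\<phi> k)"
  "test_function \<Omega> \<psi> \<Longrightarrow> ip (D\<phi> k) (grad \<psi>) = \<mu> k * coef \<psi> k"
proof -
  have "\<exists>G. in_H10 \<Omega> (\<phi> k) G \<and>
       (\<forall>\<psi>. test_function \<Omega> \<psi> \<longrightarrow>
          (LINT x|lebesgue_on \<Omega>. G x \<bullet> grad \<psi> x) = \<mu> k * (LINT x|lebesgue_on \<Omega>. \<phi> k x * \<psi> x))"
    using eig unfolding dirichlet_eigensystem_def dirichlet_eigenfunction_def by blast
  note * = someI_ex[OF this, folded D\<phi>_def]
  show "in_H10 \<Omega> (\<phi> k) (D\<phi> k)"
    using * by blast
  show "ip (D\<phi> k) (grad \<psi>) = \<mu> k * coef \<psi> k" if "test_function \<Omega> \<psi>"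
    using conjunct2[OF *, rule_format, OF that] by (simp add: L2_inner_def coef_def mult.commute)
qed

text \<open>These sequences carry identities that are stated for test functions over to the
  eigenfunctions.\<close>

definition approx :: "nat \<Rightarrow> nat \<Rightarrow> 'a \<Rightarrow> real" where
  "approx k = (SOME \<psi>. (\<forall>i. test_function \<Omega> (\<psi> i)) \<and> L2_lim \<Omega> \<psi> (\<phi> k) \<and> L2_lim \<Omega> (\<lambda>i. grad (\<psi> i)) (D\<phi> k))"

lemma approx: "test_function \<Omega> (approx k i)" "L2_lim \<Omega> (approx k) (\<phi> k)" "L2_lim \<Omega> (\<lambda>i. grad (approx k i)) (D\<phi> k)"
  using someI_ex[OF D\<phi>(1)[of k, unfolded in_H10_def], folded approx_def] by blast+

lemma \<phi>_L2: "\<phi> k \<in> L2 \<Omega>" and D\<phi>_L2: "D\<phi> k \<in> L2 \<Omega>"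
  using L2_lim_memD(1)[OF approx(2)] L2_lim_memD(1)[OF approx(3)] .

lemma test_L2: "test_function \<Omega> \<psi> \<Longrightarrow> \<psi> \<in> L2 \<Omega>" and test_grad_L2: "test_function \<Omega> \<psi> \<Longrightarrow> grad \<psi> \<in> L2 \<Omega>"
  by (rule test_function_L2[OF open_\<Omega> bounded_\<Omega>], assumption)
    (rule test_function_grad_L2[OF open_\<Omega> bounded_\<Omega>], assumption)

lemma orthonormal: "ip (\<phi> j) (\<phi> k) = (if j = k then 1 else 0)"
  using eig unfolding dirichlet_eigensystem_def by (simp add: L2_inner_def)

text \<open>The weak equation of \<phi> j accepts only test functions; testing with those that
  approximate \<phi> k and passing to the limit gives \<mu> j times the L2 product of the two
  eigenfunctions.\<close>

lemma orthogonal_D: "ip (D\<phi> j) (D\<phi> k) = (if j = k then \<mu> j else 0)"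
proof (rule LIMSEQ_unique)
  show "(\<lambda>i. ip (D\<phi> j) (grad (approx k i))) \<longlonglongrightarrow> ip (D\<phi> j) (D\<phi> k)"
    by (rule L2_lim_L2_inner[OF L2_lim_const[OF D\<phi>_L2] approx(3)])
  have "(\<lambda>i. \<mu> j * ip (approx k i) (\<phi> j)) \<longlonglongrightarrow> \<mu> j * ip (\<phi> k) (\<phi> j)"
    by (intro tendsto_mult tendsto_const L2_lim_L2_inner[OF approx(2) L2_lim_const[OF \<phi>_L2]])
  then show "(\<lambda>i. ip (D\<phi> j) (grad (approx k i))) \<longlonglongrightarrow> (if j = k then \<mu> j else 0)"
    by (simp add: D\<phi>(2)[OF approx(1)] coef_def orthonormal if_distrib cong: if_cong) auto
qed

lemma \<mu>_nonneg: "0 \<le> \<mu> k"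
  using L2_inner_nonneg[of \<Omega> "D\<phi> k"] by (simp add: orthogonal_D)

lemma L2_sums_pairing:
  assumes "L2_sums \<Omega> \<phi> c f" "g \<in> L2 \<Omega>"
  shows "(\<lambda>k. c k * coef g k) sums ip f g"
proof -
  have "(\<lambda>N. ip (\<lambda>x. \<Sum>k<N. c k * \<phi> k x) g) \<longlonglongrightarrow> ip f g"
    using assms(1) unfolding L2_sums_def by (rule L2_lim_L2_inner[OF _ L2_lim_const[OF assms(2)]])
  moreover have "ip (\<lambda>x. \<Sum>k<N. c k * \<phi> k x) g = (\<Sum>k<N. c k * coef g k)" for N
    using L2_inner_sum_left[of "{..<N}" \<phi> \<Omega> g c] \<phi>_L2 assms(2)
    by (simp add: coef_def L2_inner_commute[of _ g])
  ultimately show ?thesis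
    by (simp add: sums_def)
qed

text \<open>Pairing the series with \<phi> k isolates one term. This identifies the coefficients
  that \<open>spectral_frac_laplacian\<close> merely asserts to exist.\<close>

lemma L2_sums_coef:
  assumes "L2_sums \<Omega> \<phi> c f"
  shows "c k = coef f k"
proof -
  have "(\<lambda>j. c j * coef (\<phi> k) j) sums coef f k"
    using L2_sums_pairing[OF assms \<phi>_L2] by (simp add: coef_def)
  moreover have "(\<lambda>j. c j * coef (\<phi> k) j) = (\<lambda>j. if j = k then c j else 0)"
    by (auto simp: coef_def orthonormal fun_eq_iff)
  ultimately show ?thesis
    using sums_single[of k c] sums_unique2 by metis
qed

lemma parseval:
  assumes "f \<in> L2 \<Omega>" "g \<in> L2 \<Omega>"
  shows "(\<lambda>k. coef f k * coef g k) sums ip f g"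
proof (rule L2_sums_pairing[OF _ assms(2)])
  show "L2_sums \<Omega> \<phi> (coef f) f"
    using eig assms(1) unfolding dirichlet_eigensystem_def coef_def L2_inner_def by simp
qed

lemma coef_summable:
  assumes "f \<in> L2 \<Omega>" "g \<in> L2 \<Omega>"
  shows "summable (\<lambda>k. \<bar>coef f k * coef g k\<bar>)"
proof (rule summable_comparison_test)
  show "summable (\<lambda>k. (coef f k * coef f k + coef g k * coef g k) / 2)"
    using parseval[OF assms(1,1)] parseval[OF assms(2,2)]
    by (intro summable_divide summable_add) (auto simp: sums_iff)
  have "\<bar>x * y\<bar> \<le> (x * x + y * y) / 2" for x y :: real
    using inner_le_squares[of x y] by (simp add: power2_eq_square)
  then show "\<exists>N. \<forall>k\<ge>N. norm \<bar>coef f k * coef g k\<bar> \<le> (coef f k * coef f k + coef g k * coef g k) / 2"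
    by simp
qed

text \<open>Two integrations by parts: the first is classical on the test functions that approximate
  \<phi> k and passes to the limit, the second is the weak eigenvalue equation tested with
  \<eta>.\<close>

lemma laplacian_coef:
  assumes "test_function \<Omega> \<eta>"
  shows "coef (laplacian \<eta>) k = - \<mu> k * coef \<eta> k"
proof -
  have "(\<lambda>i. ip (approx k i) (laplacian \<eta>)) \<longlonglongrightarrow> ip (\<phi> k) (laplacian \<eta>)"
    by (rule L2_lim_L2_inner[OF approx(2) L2_lim_const[OF test_L2[OF test_function_laplacian[OF assms]]]])
  moreover have "(\<lambda>i. - ip (grad (approx k i)) (grad \<eta>)) \<longlonglongrightarrow> - ip (D\<phi> k) (grad \<eta>)"
    by (intro tendsto_minus L2_lim_L2_inner[OF approx(3) L2_lim_const[OF test_grad_L2[OF assms]]])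
  ultimately have "ip (\<phi> k) (laplacian \<eta>) = - ip (D\<phi> k) (grad \<eta>)"
    unfolding test_function_laplacian_by_parts[OF open_\<Omega> bounded_\<Omega> approx(1) assms] by (rule LIMSEQ_unique)
  then show ?thesis
    unfolding D\<phi>(2)[OF assms] coef_def[of "laplacian \<eta>"] by (simp add: L2_inner_commute[of _ "laplacian \<eta>"])
qed

text \<open>Bessel's inequality for the gradients \<open>D\<phi> k\<close>, which are orthogonal
  with squared norms \<mu> k. The product of grad \<psi> with \<open>D\<phi> k\<close> is \<mu> k
  times \<open>coef \<psi> k\<close>, so the projection \<open>R\<close> has the coefficients of
  \<psi> itself and no division by \<mu> k occurs.\<close>

lemma dirichlet_bessel:
  assumes \<psi>: "test_function \<Omega> \<psi>"
  shows "(\<Sum>k<N. \<mu> k * (coef \<psi> k)\<^sup>2) \<le> ip (grad \<psi>) (grad \<psi>)"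
proof -
  define R where "R x = (\<Sum>k<N. coef \<psi> k *\<^sub>R D\<phi> k x)" for x
  have R: "R \<in> L2 \<Omega>"
    unfolding R_def[abs_def] by (intro L2_sum L2_scale D\<phi>_L2)
  note g = test_grad_L2[OF \<psi>]
  have Rk: "ip R (D\<phi> k) = \<mu> k * coef \<psi> k" if "k < N" for k
  proof -
    have "ip R (D\<phi> k) = (\<Sum>j<N. coef \<psi> j * ip (D\<phi> j) (D\<phi> k))"
      unfolding R_def[abs_def] by (rule L2_inner_sum_left[OF D\<phi>_L2 D\<phi>_L2])
    also have "\<dots> = (\<Sum>j<N. if j = k then \<mu> j * coef \<psi> j else 0)"
      by (intro sum.cong) (auto simp: orthogonal_D)
    finally show ?thesis
      using that by simp
  qed
  have Rg: "ip R (grad \<psi>) = (\<Sum>k<N. \<mu> k * (coef \<psi> k)\<^sup>2)"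
    unfolding R_def[abs_def] L2_inner_sum_left[OF D\<phi>_L2 g]
    by (intro sum.cong) (auto simp: D\<phi>(2)[OF \<psi>] power2_eq_square)
  have RR: "ip R R = (\<Sum>k<N. \<mu> k * (coef \<psi> k)\<^sup>2)"
  proof -
    have "ip R R = (\<Sum>k<N. coef \<psi> k * ip (D\<phi> k) R)"
      using L2_inner_sum_left[of "{..<N}" D\<phi> \<Omega> R "coef \<psi>", OF D\<phi>_L2 R] unfolding R_def[abs_def, symmetric] .
    also have "\<dots> = (\<Sum>k<N. \<mu> k * (coef \<psi> k)\<^sup>2)"
      by (intro sum.cong) (auto simp: L2_inner_commute[of _ _ R] Rk power2_eq_square)
    finally show ?thesis .
  qed
  have "0 \<le> ip (\<lambda>x. grad \<psi> x - R x) (\<lambda>x. grad \<psi> x - R x)"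
    by (rule L2_inner_nonneg)
  also have "\<dots> = ip (grad \<psi>) (grad \<psi>) - 2 * ip R (grad \<psi>) + ip R R"
    using g R L2_diff[OF g R] L2_inner_commute[of \<Omega> "grad \<psi>" "\<lambda>x. grad \<psi> x - R x"] L2_inner_commute[of \<Omega> R "\<lambda>x. grad \<psi> x - R x"]
      L2_inner_commute[of \<Omega> "grad \<psi>" R]
    by (simp add: L2_inner_diff_left)
  finally show ?thesis
    by (simp add: Rg RR)
qed

section \<open>The quadratic form of t - Laplace and the dual form of its resolvent\<close>

definition energy :: "real \<Rightarrow> ('a \<Rightarrow> real) \<Rightarrow> real" where
  "energy t \<psi> = ip (grad \<psi>) (grad \<psi>) + t * ip \<psi> \<psi>"

lemma resolvent_summable:
  assumes "f \<in> L2 \<Omega>" "g \<in> L2 \<Omega>" "t > 0"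
  shows "summable (\<lambda>k. coef f k * coef g k / (t + \<mu> k))"
proof (rule summable_comparison_test)
  show "summable (\<lambda>k. \<bar>coef f k * coef g k\<bar> / t)"
    by (intro summable_divide coef_summable assms)
  show "\<exists>N. \<forall>k\<ge>N. norm (coef f k * coef g k / (t + \<mu> k)) \<le> \<bar>coef f k * coef g k\<bar> / t"
  proof (intro exI allI impI)
    fix k
    have "\<bar>coef f k * coef g k\<bar> / (t + \<mu> k) \<le> \<bar>coef f k * coef g k\<bar> / t"
      using \<mu>_nonneg[of k] assms(3) by (intro divide_left_mono mult_pos_pos) auto
    then show "norm (coef f k * coef g k / (t + \<mu> k)) \<le> \<bar>coef f k * coef g k\<bar> / t"
      using \<mu>_nonneg[of k] assms(3) by simp
  qed
qed

text \<open>Completing the square in each mode gives 2 x y - (t + m) y^2 <= x^2 / (t + m). The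
  Dirichlet integral of \<psi> dominates its spectral partial sums by
  \<open>dirichlet_bessel\<close>.\<close>

lemma energy_upper:
  assumes \<psi>: "test_function \<Omega> \<psi>" and f: "f \<in> L2 \<Omega>" and t: "t > 0"
  shows "2 * ip f \<psi> - energy t \<psi> \<le> (\<Sum>k. coef f k * coef f k / (t + \<mu> k))"
proof (rule LIMSEQ_le_const2)
  let ?A = "\<lambda>N. 2 * (\<Sum>k<N. coef f k * coef \<psi> k) - t * (\<Sum>k<N. coef \<psi> k * coef \<psi> k) - ip (grad \<psi>) (grad \<psi>)"
  have "?A \<longlonglongrightarrow> 2 * ip f \<psi> - t * ip \<psi> \<psi> - ip (grad \<psi>) (grad \<psi>)"
    using parseval[OF f test_L2[OF \<psi>]] parseval[OF test_L2[OF \<psi>] test_L2[OF \<psi>]]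
    by (intro tendsto_intros) (auto simp: sums_def)
  then show "?A \<longlonglongrightarrow> 2 * ip f \<psi> - energy t \<psi>"
    by (simp add: energy_def algebra_simps)
  show "\<exists>N. \<forall>n\<ge>N. ?A n \<le> (\<Sum>k. coef f k * coef f k / (t + \<mu> k))"
  proof (intro exI allI impI)
    fix N
    have step: "2 * (x * y) - t * (y * y) - m * y\<^sup>2 \<le> x * x / (t + m)" if "m \<ge> 0" for x y m :: real
    proof -
      have "0 \<le> (x - (t + m) * y)\<^sup>2 / (t + m)"
        using t that by simp
      also have "\<dots> = x * x / (t + m) - 2 * (x * y) + (t + m) * (y * y)"
        using t that by (simp add: power2_eq_square field_simps)
      finally show ?thesis
        by (simp add: power2_eq_square algebra_simps)
    qed
    have "?A N \<le> 2 * (\<Sum>k<N. coef f k * coef \<psi> k) - t * (\<Sum>k<N. coef \<psi> k * coef \<psi> k) - (\<Sum>k<N. \<mu> k * (coef \<psi> k)\<^sup>2)"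
      using dirichlet_bessel[OF \<psi>, of N] by simp
    also have "\<dots> = (\<Sum>k<N. 2 * (coef f k * coef \<psi> k) - t * (coef \<psi> k * coef \<psi> k) - \<mu> k * (coef \<psi> k)\<^sup>2)"
      by (simp add: sum_subtractf sum_distrib_left)
    also have "\<dots> \<le> (\<Sum>k<N. coef f k * coef f k / (t + \<mu> k))"
      by (intro sum_mono step \<mu>_nonneg)
    also have "\<dots> \<le> (\<Sum>k. coef f k * coef f k / (t + \<mu> k))"
      using t \<mu>_nonneg by (intro sum_le_suminf resolvent_summable[OF f f t]) (auto intro!: divide_nonneg_nonneg add_nonneg_nonneg)
    finally show "?A N \<le> (\<Sum>k. coef f k * coef f k / (t + \<mu> k))" .
  qed
qed

text \<open>Equality in the square holds at y = x / (t + m), that is, when \<psi> is the resolvent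
  applied to f. Its first N modes, with each \<phi> k replaced by approximating test functions, come
  as close as desired to the partial sum.\<close>

lemma energy_lower:
  assumes f: "f \<in> L2 \<Omega>" and t: "t > 0" and e: "e > 0"
  obtains \<psi> where "test_function \<Omega> \<psi>"
    "(\<Sum>k<N. coef f k * coef f k / (t + \<mu> k)) - e < 2 * ip f \<psi> - energy t \<psi>"
proof -
  define v where "v k = coef f k / (t + \<mu> k)" for k
  define \<psi> where "\<psi> i x = (\<Sum>k<N. v k * approx k i x)" for i x
  have \<psi>: "test_function \<Omega> (\<psi> i)" for i
    unfolding \<psi>_def[abs_def] by (intro test_function_sum test_function_scale approx(1))
  have g: "grad (\<psi> i) = (\<lambda>x. \<Sum>k<N. v k *\<^sub>R grad (approx k i) x)" for i
    unfolding \<psi>_def[abs_def] by (rule ext, rule grad_sum_scale[OF test_function_smooth[OF approx(1)]])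
  have \<psi>': "\<psi> i = (\<lambda>x. \<Sum>k<N. v k *\<^sub>R approx k i x)" for i
    by (simp add: \<psi>_def[abs_def])
  have A: "approx k i \<in> L2 \<Omega>" "grad (approx k i) \<in> L2 \<Omega>" for k i
    by (rule test_L2[OF approx(1)], rule test_grad_L2[OF approx(1)])
  have bil: "ip (\<lambda>x. \<Sum>k<N. v k *\<^sub>R F k x) (\<lambda>x. \<Sum>k<N. v k *\<^sub>R F k x) = (\<Sum>j<N. v j * (\<Sum>k<N. v k * ip (F k) (F j)))"
    if F: "\<And>k. F k \<in> L2 \<Omega>" for F :: "nat \<Rightarrow> 'a \<Rightarrow> 'b::euclidean_space"
  proof -
    have S: "(\<lambda>x. \<Sum>k<N. v k *\<^sub>R F k x) \<in> L2 \<Omega>"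
      by (intro L2_sum L2_scale F)
    show ?thesis
      unfolding L2_inner_sum_left[OF F S]
      by (intro sum.cong refl) (simp add: L2_inner_commute[of _ "F _" "\<lambda>x. \<Sum>k<N. v k *\<^sub>R F k x"] L2_inner_sum_left[OF F F])
  qed
  have e1: "ip f (\<psi> i) = (\<Sum>k<N. v k * ip (approx k i) f)" for i
    unfolding \<psi>' L2_inner_commute[of _ f] by (rule L2_inner_sum_left[OF A(1) f])
  have e2: "energy t (\<psi> i) = (\<Sum>j<N. v j * (\<Sum>k<N. v k * ip (grad (approx k i)) (grad (approx j i))))
      + t * (\<Sum>j<N. v j * (\<Sum>k<N. v k * ip (approx k i) (approx j i)))" for i
    unfolding energy_def g unfolding \<psi>' by (simp only: bil[of "\<lambda>k. approx k i", OF A(1)] bil[of "\<lambda>k. grad (approx k i)", OF A(2)])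
  have "(\<lambda>i. 2 * ip f (\<psi> i) - energy t (\<psi> i)) \<longlonglongrightarrow>
      2 * (\<Sum>k<N. v k * ip (\<phi> k) f) - ((\<Sum>j<N. v j * (\<Sum>k<N. v k * ip (D\<phi> k) (D\<phi> j)))
      + t * (\<Sum>j<N. v j * (\<Sum>k<N. v k * ip (\<phi> k) (\<phi> j))))"
    unfolding e1 e2
    by (intro tendsto_intros L2_lim_L2_inner[OF approx(2) L2_lim_const[OF f]] L2_lim_L2_inner[OF approx(2) approx(2)]
        L2_lim_L2_inner[OF approx(3) approx(3)])
  moreover have "2 * (\<Sum>k<N. v k * ip (\<phi> k) f) - ((\<Sum>j<N. v j * (\<Sum>k<N. v k * ip (D\<phi> k) (D\<phi> j)))
      + t * (\<Sum>j<N. v j * (\<Sum>k<N. v k * ip (\<phi> k) (\<phi> j)))) = (\<Sum>k<N. coef f k * coef f k / (t + \<mu> k))"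
  proof -
    have a1: "(\<Sum>k<N. v k * ip (D\<phi> k) (D\<phi> j)) = v j * \<mu> j" if "j < N" for j
    proof -
      have "(\<Sum>k<N. v k * ip (D\<phi> k) (D\<phi> j)) = (\<Sum>k<N. if k = j then v k * \<mu> k else 0)"
        by (intro sum.cong) (auto simp: orthogonal_D)
      then show ?thesis using that by simp
    qed
    have a2: "(\<Sum>k<N. v k * ip (\<phi> k) (\<phi> j)) = v j" if "j < N" for j
    proof -
      have "(\<Sum>k<N. v k * ip (\<phi> k) (\<phi> j)) = (\<Sum>k<N. if k = j then v k else 0)"
        by (intro sum.cong) (auto simp: orthonormal)
      then show ?thesis using that by simp
    qed
    have "2 * (\<Sum>k<N. v k * ip (\<phi> k) f) - ((\<Sum>j<N. v j * (\<Sum>k<N. v k * ip (D\<phi> k) (D\<phi> j)))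
      + t * (\<Sum>j<N. v j * (\<Sum>k<N. v k * ip (\<phi> k) (\<phi> j)))) =
      2 * (\<Sum>k<N. v k * coef f k) - ((\<Sum>j<N. v j * (v j * \<mu> j)) + t * (\<Sum>j<N. v j * v j))"
      by (simp add: a1 a2 coef_def L2_inner_commute[of _ f])
    also have "\<dots> = (\<Sum>k<N. 2 * (v k * coef f k) - (v k * (v k * \<mu> k) + t * (v k * v k)))"
      by (simp add: sum_subtractf sum.distrib sum_distrib_left)
    also have "\<dots> = (\<Sum>k<N. coef f k * coef f k / (t + \<mu> k))"
    proof (rule sum.cong[OF refl])
      fix k
      have "v k * (v k * \<mu> k) + t * (v k * v k) = v k * coef f k"
      proof -
        have "(t + \<mu> k) * v k = coef f k"
          using \<mu>_nonneg[of k] t by (simp add: v_def)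
        then have "v k * ((t + \<mu> k) * v k) = v k * coef f k"
          by simp
        then show ?thesis
          by (simp add: algebra_simps)
      qed
      then show "2 * (v k * coef f k) - (v k * (v k * \<mu> k) + t * (v k * v k)) = coef f k * coef f k / (t + \<mu> k)"
        by (simp add: v_def)
    qed
    finally show ?thesis .
  qed
  ultimately have "(\<lambda>i. 2 * ip f (\<psi> i) - energy t (\<psi> i)) \<longlonglongrightarrow> (\<Sum>k<N. coef f k * coef f k / (t + \<mu> k))"
    by simp
  from order_tendstoD(1)[OF this, of "(\<Sum>k<N. coef f k * coef f k / (t + \<mu> k)) - e"] e
  obtain i where "(\<Sum>k<N. coef f k * coef f k / (t + \<mu> k)) - e < 2 * ip f (\<psi> i) - energy t (\<psi> i)"
    by (auto simp: eventually_sequentially)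
  with \<psi> that show ?thesis by blast
qed

text \<open>First Beurling-Deny criterion for the Dirichlet form, smoothed so that test functions
  are mapped to test functions.\<close>

lemma energy_soft_abs:
  assumes \<psi>: "test_function \<Omega> \<psi>" and d: "d > 0" and t: "t > 0"
  shows "energy t (\<lambda>x. soft_abs d (\<psi> x)) \<le> energy t \<psi>"
proof -
  note S = test_function_soft_abs[OF d \<psi>]
  have "ip (grad (\<lambda>x. soft_abs d (\<psi> x))) (grad (\<lambda>x. soft_abs d (\<psi> x))) \<le> ip (grad \<psi>) (grad \<psi>)"
    unfolding L2_inner_def
  proof (rule integral_mono)
    show "grad (\<lambda>x. soft_abs d (\<psi> x)) x \<bullet> grad (\<lambda>x. soft_abs d (\<psi> x)) x \<le> grad \<psi> x \<bullet> grad \<psi> x" for x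
      using S(2)[of x] by (simp add: power2_norm_eq_inner[symmetric])
  qed (intro L2_inner_integrable test_grad_L2 S(1) \<psi>)+
  moreover have "ip (\<lambda>x. soft_abs d (\<psi> x)) (\<lambda>x. soft_abs d (\<psi> x)) \<le> ip \<psi> \<psi>"
    unfolding L2_inner_def
  proof (rule integral_mono)
    show "soft_abs d (\<psi> x) \<bullet> soft_abs d (\<psi> x) \<le> \<psi> x \<bullet> \<psi> x" for x
      using soft_abs_bounds(2,3)[OF d, of "\<psi> x"] mult_mono[of "soft_abs d (\<psi> x)" "\<bar>\<psi> x\<bar>" "soft_abs d (\<psi> x)" "\<bar>\<psi> x\<bar>"]
      by simp
  qed (intro L2_inner_integrable test_L2 S(1) \<psi>)+
  ultimately show ?thesis
    using t by (auto simp: energy_def intro!: add_mono mult_left_mono)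
qed

text \<open>The resolvent form of \<open>f\<close> is the supremum of \<open>2 * ip f \<psi> - energy t \<psi>\<close> over test functions,
  and it does not decrease when \<open>f\<close> is replaced by \<open>\<bar>f\<bar>\<close>, because \<open>\<psi>\<close> may be replaced by
  \<open>\<bar>\<psi>\<bar>\<close>. The claim is this comparison for \<open>f = g - \<eta>\<close>, where \<open>\<bar>f\<bar> = g + \<eta>\<close>.\<close>

lemma resolvent_positive:
  assumes g: "g \<in> L2 \<Omega>" "\<And>x. x \<in> \<Omega> \<Longrightarrow> 0 \<le> g x" and \<eta>: "\<eta> \<in> L2 \<Omega>" "\<And>x. x \<in> \<Omega> \<Longrightarrow> 0 \<le> \<eta> x"
    and disj: "\<And>x. x \<in> \<Omega> \<Longrightarrow> g x * \<eta> x = 0" and t: "t > 0"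
  shows "0 \<le> (\<Sum>k. coef g k * coef \<eta> k / (t + \<mu> k))"
proof -
  define f where "f x = g x - \<eta> x" for x
  define F where "F x = g x + \<eta> x" for x
  have f: "f \<in> L2 \<Omega>" and F: "F \<in> L2 \<Omega>"
    using g \<eta> unfolding f_def[abs_def] F_def[abs_def] by (auto intro: L2_diff L2_add)
  have abs_f: "\<bar>f x\<bar> = F x" if "x \<in> \<Omega>" for x
    using disj[OF that] g(2)[OF that] \<eta>(2)[OF that] by (auto simp: f_def F_def)
  define r where "r h k = coef h k * coef h k / (t + \<mu> k)" for h k
  note sum_f = resolvent_summable[OF f f t] and sum_F = resolvent_summable[OF F F t]
  have one: "(\<lambda>x. 1::real) \<in> L2 \<Omega>"
    by (rule L2_bounded[where C=1]) (use open_\<Omega> bounded_\<Omega> in \<open>auto intro: lmeasurable_open\<close>)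
  define m where "m = (LINT x|lebesgue_on \<Omega>. F x)"
  have intF: "integrable (lebesgue_on \<Omega>) F"
    using L2_inner_integrable[OF F one] by simp
  have m: "m \<ge> 0"
    unfolding m_def using abs_f by (intro integral_nonneg_AE AE_I2) (auto simp flip: abs_f)
  have key: "(\<Sum>k<N. coef f k * coef f k / (t + \<mu> k)) \<le> (\<Sum>k. coef F k * coef F k / (t + \<mu> k)) + e" if e: "e > 0" for N e
  proof -
    obtain \<psi> where \<psi>: "test_function \<Omega> \<psi>"
      "(\<Sum>k<N. coef f k * coef f k / (t + \<mu> k)) - e / 2 < 2 * ip f \<psi> - energy t \<psi>"
      using energy_lower[OF f t, of "e / 2" N] e by auto
    \<comment> \<open>Replacing |\<psi>| by \<open>soft_abs d\<close> costs at most d times the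
      integral m of F, counted twice in the functional. This d keeps the cost below e / 2, the other
      half being spent on the choice of \<psi>; the + 1 covers m = 0.\<close>
    define d where "d = e / (4 * (m + 1))"
    have d: "d > 0" and dm: "2 * (d * m) \<le> e / 2"
      using e m by (auto simp: d_def field_simps)
    note S = test_function_soft_abs(1)[OF d \<psi>(1)]
    have "ip f \<psi> \<le> (LINT x|lebesgue_on \<Omega>. F x * soft_abs d (\<psi> x) + d * F x)"
      unfolding L2_inner_def
    proof (rule integral_mono)
      show "integrable (lebesgue_on \<Omega>) (\<lambda>x. f x \<bullet> \<psi> x)"
        by (rule L2_inner_integrable[OF f test_L2[OF \<psi>(1)]])
      show "integrable (lebesgue_on \<Omega>) (\<lambda>x. F x * soft_abs d (\<psi> x) + d * F x)"
        using L2_inner_integrable[OF F test_L2[OF S]] intF by simp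
      fix x assume "x \<in> space (lebesgue_on \<Omega>)"
      then have x: "x \<in> \<Omega>" by simp
      have "f x * \<psi> x \<le> F x * \<bar>\<psi> x\<bar>"
        using abs_ge_self[of "f x * \<psi> x"] by (simp add: abs_mult abs_f[OF x])
      also have "\<dots> \<le> F x * (soft_abs d (\<psi> x) + d)"
        using soft_abs_bounds(1)[OF d, of "\<psi> x"] abs_f[OF x] abs_ge_zero[of "f x"] by (intro mult_left_mono) auto
      finally show "f x \<bullet> \<psi> x \<le> F x * soft_abs d (\<psi> x) + d * F x"
        by (simp add: algebra_simps)
    qed
    also have "\<dots> = ip F (\<lambda>x. soft_abs d (\<psi> x)) + d * m"
      using L2_inner_integrable[OF F test_L2[OF S]] intF by (simp add: L2_inner_def m_def)
    finally have "2 * ip f \<psi> - energy t \<psi> \<le> 2 * ip F (\<lambda>x. soft_abs d (\<psi> x)) - energy t (\<lambda>x. soft_abs d (\<psi> x)) + e / 2"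
      using energy_soft_abs[OF \<psi>(1) d t] dm by linarith
    with energy_upper[OF S F t] \<psi>(2) show ?thesis
      by linarith
  qed
  have "(\<Sum>k. coef f k * coef f k / (t + \<mu> k)) \<le> (\<Sum>k. coef F k * coef F k / (t + \<mu> k))"
  proof (rule field_le_epsilon)
    fix e :: real assume "e > 0"
    then show "(\<Sum>k. coef f k * coef f k / (t + \<mu> k)) \<le> (\<Sum>k. coef F k * coef F k / (t + \<mu> k)) + e"
      by (intro suminf_le_const sum_f key)
  qed
  then have "0 \<le> (\<Sum>k. coef F k * coef F k / (t + \<mu> k)) - (\<Sum>k. coef f k * coef f k / (t + \<mu> k))"
    by simp
  also have "\<dots> = (\<Sum>k. coef F k * coef F k / (t + \<mu> k) - coef f k * coef f k / (t + \<mu> k))"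
    by (rule suminf_diff[OF sum_F sum_f])
  \<comment> \<open>Polarisation of the resolvent form for F = g + \<eta> and f = g - \<eta>, mode
    by mode.\<close>
  also have "\<dots> = (\<Sum>k. 4 * (coef g k * coef \<eta> k / (t + \<mu> k)))"
  proof (rule suminf_cong)
    fix k
    have eqs: "coef F k = coef g k + coef \<eta> k" "coef f k = coef g k - coef \<eta> k"
      unfolding coef_def F_def[abs_def] f_def[abs_def]
      using g \<eta> \<phi>_L2 by (auto simp: L2_inner_add_left L2_inner_diff_left)
    show "coef F k * coef F k / (t + \<mu> k) - coef f k * coef f k / (t + \<mu> k) = 4 * (coef g k * coef \<eta> k / (t + \<mu> k))"
      unfolding eqs by (simp add: diff_divide_distrib[symmetric] algebra_simps)
  qed
  also have "\<dots> = 4 * (\<Sum>k. coef g k * coef \<eta> k / (t + \<mu> k))"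
    by (rule suminf_mult[OF resolvent_summable[OF g(1) \<eta>(1) t]])
  finally show ?thesis by simp
qed

end

subsection \<open>Fractional powers as integrals of resolvents\<close>

definition frac_kernel :: "real \<Rightarrow> real \<Rightarrow> real \<Rightarrow> real" where
  "frac_kernel \<sigma> m t = indicator {0<..} t * (t powr (\<sigma> - 1) * (m / (t + m)))"

lemma frac_kernel_measurable [measurable]: "frac_kernel \<sigma> m \<in> borel_measurable borel"
  unfolding frac_kernel_def[abs_def] by measurable

text \<open>The kernel is bounded by t^(\<sigma>-1) near 0 and by t^(\<sigma>-2) at infinity, where
  \<sigma> > 0 and \<sigma> < 1 respectively give integrability. On (0,1) it is at least 1/2, hence
  positivity. The value of the integral is pi / sin (pi \<sigma>).\<close>

lemma frac_kernel_1:
  assumes "0 < \<sigma>" "\<sigma> < 1"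
  shows "integrable lborel (frac_kernel \<sigma> 1)" "0 < integral\<^sup>L lborel (frac_kernel \<sigma> 1)"
proof -
  have 1: "integrable lborel (\<lambda>t. indicator {0<..<1} t * t powr (\<sigma> - 1))"
    by (rule powr_integrable_lborel) (use assms in simp)
  have "(\<lambda>t. t powr (\<sigma> - 2)) absolutely_integrable_on {1..}"
    using has_integral_powr_to_inf[of "\<sigma> - 2" 1] assms
    by (intro nonnegative_absolutely_integrable_1) (auto simp: integrable_on_def)
  then have "integrable lebesgue (\<lambda>t. indicator {1..} t * t powr (\<sigma> - 2))"
    by (simp add: set_integrable_def)
  then have 2: "integrable lborel (\<lambda>t. indicator {1..} t * t powr (\<sigma> - 2))"
    by (subst (asm) integrable_completion) auto
  show int: "integrable lborel (frac_kernel \<sigma> 1)"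
  proof (rule Bochner_Integration.integrable_bound[OF Bochner_Integration.integrable_add[OF 1 2]])
    show "AE t in lborel. norm (frac_kernel \<sigma> 1 t) \<le>
      norm (indicator {0<..<1} t * t powr (\<sigma> - 1) + indicator {1..} t * t powr (\<sigma> - 2))"
    proof (rule AE_I2)
      fix t :: real
      consider "t \<le> 0" | "0 < t" "t < 1" | "1 \<le> t" by linarith
      then show "norm (frac_kernel \<sigma> 1 t) \<le> norm (indicator {0<..<1} t * t powr (\<sigma> - 1) + indicator {1..} t * t powr (\<sigma> - 2))"
      proof cases
        case 2
        then have "t powr (\<sigma> - 1) * (1 / (t + 1)) \<le> t powr (\<sigma> - 1) * 1"
          by (intro mult_left_mono) auto
        with 2 show ?thesis by (simp add: frac_kernel_def)
      next
        case 3
        have "t powr (\<sigma> - 2) = t powr ((\<sigma> - 1) + (- 1))"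
          by simp
        also have "\<dots> = t powr (\<sigma> - 1) * t powr (- 1)"
          by (rule powr_add)
        finally have "t powr (\<sigma> - 2) = t powr (\<sigma> - 1) * t powr (- 1)" .
        then have "t powr (\<sigma> - 2) = t powr (\<sigma> - 1) * (1 / t)"
          using 3 by (simp add: powr_minus_divide)
        moreover have "t powr (\<sigma> - 1) * (1 / (t + 1)) \<le> t powr (\<sigma> - 1) * (1 / t)"
          using 3 by (intro mult_left_mono) (auto simp: field_simps)
        ultimately show ?thesis
          using 3 by (simp add: frac_kernel_def)
      qed (simp add: frac_kernel_def)
    qed
  qed simp
  have "(1 / 2 :: real) = (LINT t|(lborel :: real measure). indicator {0<..<1} t * (1 / 2))"
    by (simp add: measure_lborel_Ioo)
  also have "\<dots> \<le> integral\<^sup>L lborel (frac_kernel \<sigma> 1)"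
  proof (rule integral_mono[OF _ int])
    show "integrable lborel (\<lambda>t::real. indicator {0<..<1} t * (1 / 2 :: real))"
      by simp
    show "indicator {0<..<1} t * (1 / 2) \<le> frac_kernel \<sigma> 1 t" for t
    proof (cases "t \<in> {0<..<1}")
      case True
      then have "1 \<le> t powr (\<sigma> - 1)"
        using assms powr_mono'[of "\<sigma> - 1" 0 t] by simp
      then have "1 * (1 / 2) \<le> t powr (\<sigma> - 1) * (1 / (t + 1))"
        using True by (intro mult_mono) (auto simp: field_simps)
      with True show ?thesis by (simp add: frac_kernel_def)
    next
      case False
      then show ?thesis by (auto simp: frac_kernel_def indicator_def)
    qed
  qed
  finally show "0 < integral\<^sup>L lborel (frac_kernel \<sigma> 1)" by simp
qed

text \<open>Substituting t = m x scales the kernel by m^(\<sigma>-1) and dt by m. The substitution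
  fails at m = 0, where both sides are 0.\<close>

lemma frac_kernel_integral:
  assumes \<sigma>: "0 < \<sigma>" "\<sigma> < 1" and m: "0 \<le> m"
  shows "integrable lborel (frac_kernel \<sigma> m)"
    "integral\<^sup>L lborel (frac_kernel \<sigma> m) = integral\<^sup>L lborel (frac_kernel \<sigma> 1) * m powr \<sigma>"
proof -
  have "integrable lborel (frac_kernel \<sigma> m) \<and>
    integral\<^sup>L lborel (frac_kernel \<sigma> m) = integral\<^sup>L lborel (frac_kernel \<sigma> 1) * m powr \<sigma>"
  proof (cases "m = 0")
    case True
    then have "frac_kernel \<sigma> m = (\<lambda>t. 0)"
      by (simp add: frac_kernel_def fun_eq_iff)
    then show ?thesis
      using True by simp
  next
    case False
    then have m: "m > 0" using m by simp
    have scale: "(\<lambda>x. frac_kernel \<sigma> m (0 + m * x)) = (\<lambda>x. m powr (\<sigma> - 1) * frac_kernel \<sigma> 1 x)"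
    proof
      fix x
      show "frac_kernel \<sigma> m (0 + m * x) = m powr (\<sigma> - 1) * frac_kernel \<sigma> 1 x"
      proof (cases "x > 0")
        case True
        have "m * x + m = m * (x + 1)"
          by (simp add: distrib_left)
        then have "m / (m * x + m) = 1 / (x + 1)"
          using m by simp
        then show ?thesis
          using m True by (simp add: frac_kernel_def powr_mult)
      next
        case False
        then have "\<not> m * x > 0"
          using m by (simp add: zero_less_mult_iff)
        with False show ?thesis
          by (simp add: frac_kernel_def)
      qed
    qed
    have "integrable lborel (\<lambda>x. frac_kernel \<sigma> m (0 + m * x))"
      unfolding scale by (intro integrable_mult_right frac_kernel_1 \<sigma>)
    then have "integrable lborel (frac_kernel \<sigma> m)"
      using m by (subst (asm) lborel_integrable_real_affine_iff) auto
    moreover have "integral\<^sup>L lborel (frac_kernel \<sigma> m) = m * (m powr (\<sigma> - 1) * integral\<^sup>L lborel (frac_kernel \<sigma> 1))"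
      using lborel_integral_real_affine[of m "frac_kernel \<sigma> m" 0] m unfolding scale by simp
    moreover have "m * m powr (\<sigma> - 1) = m powr \<sigma>"
      using m powr_add[of m 1 "\<sigma> - 1"] by simp
    ultimately show ?thesis
      by (simp add: mult_ac)
  qed
  then show "integrable lborel (frac_kernel \<sigma> m)"
    "integral\<^sup>L lborel (frac_kernel \<sigma> m) = integral\<^sup>L lborel (frac_kernel \<sigma> 1) * m powr \<sigma>"
    by auto
qed

section \<open>Fractional forms of functions with disjoint supports\<close>

context eigensystem
begin

text \<open>Since the p k add up to <g, \<eta>> = 0, the weights m / (t + m) may be replaced by - t
  / (t + m), which gives - t times a nonnegative resolvent form. Integration against t^(\<sigma>-1)
  keeps the sign and turns m / (t + m) into C m^\<sigma>.\<close>

lemma fractional_form_nonpos: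
  assumes g: "g \<in> L2 \<Omega>" "\<And>x. x \<in> \<Omega> \<Longrightarrow> 0 \<le> g x" and \<eta>: "\<eta> \<in> L2 \<Omega>" "\<And>x. x \<in> \<Omega> \<Longrightarrow> 0 \<le> \<eta> x"
    and disj: "\<And>x. x \<in> \<Omega> \<Longrightarrow> g x * \<eta> x = 0" and \<sigma>: "0 < \<sigma>" "\<sigma> < 1"
    and sum: "summable (\<lambda>k. \<bar>coef g k * coef \<eta> k\<bar> * \<mu> k powr \<sigma>)"
  shows "(\<Sum>k. coef g k * coef \<eta> k * \<mu> k powr \<sigma>) \<le> 0"
proof -
  define p where "p k = coef g k * coef \<eta> k" for k
  define C where "C = integral\<^sup>L lborel (frac_kernel \<sigma> 1)"
  have C: "C > 0"
    unfolding C_def by (rule frac_kernel_1(2)[OF \<sigma>])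
  have abs_p: "summable (\<lambda>k. \<bar>p k\<bar>)"
    unfolding p_def by (rule coef_summable[OF g(1) \<eta>(1)])
  then have sum_p: "summable p"
    by (rule summable_rabs_cancel)
  have "ip g \<eta> = (LINT x|lebesgue_on \<Omega>. 0)"
    unfolding L2_inner_def by (rule Bochner_Integration.integral_cong) (use disj in auto)
  then have p0: "(\<Sum>k. p k) = 0"
    using parseval[OF g(1) \<eta>(1)] by (simp add: sums_iff p_def)
  have S: "(\<Sum>k. p k * (\<mu> k / (t + \<mu> k))) \<le> 0" if t: "t > 0" for t
  proof -
    have sr: "summable (\<lambda>k. p k / (t + \<mu> k))"
      unfolding p_def by (rule resolvent_summable[OF g(1) \<eta>(1) t])
    have "p k * (\<mu> k / (t + \<mu> k)) = p k - t * (p k / (t + \<mu> k))" for k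
      using t \<mu>_nonneg[of k] by (simp add: field_simps)
    then have "(\<Sum>k. p k * (\<mu> k / (t + \<mu> k))) = (\<Sum>k. p k) - t * (\<Sum>k. p k / (t + \<mu> k))"
      using suminf_diff[OF sum_p summable_mult[OF sr, of t]] suminf_mult[OF sr, of t] by simp
    moreover have "0 \<le> (\<Sum>k. p k / (t + \<mu> k))"
      unfolding p_def by (rule resolvent_positive[OF g \<eta> disj t])
    ultimately show ?thesis
      using t p0 by simp
  qed
  \<comment> \<open>Sum and integral may be exchanged because the integrals of the absolute values
    are C |p k| times the power \<sigma> of \<mu> k, summable by assumption.\<close>
  have "(LINT t|lborel. (\<Sum>k. p k * frac_kernel \<sigma> (\<mu> k) t)) = (\<Sum>k. LINT t|lborel. p k * frac_kernel \<sigma> (\<mu> k) t)"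
  proof (rule integral_suminf)
    show "integrable lborel (\<lambda>t. p k * frac_kernel \<sigma> (\<mu> k) t)" for k
      by (intro integrable_mult_right frac_kernel_integral \<sigma> \<mu>_nonneg)
    show "AE t in lborel. summable (\<lambda>k. norm (p k * frac_kernel \<sigma> (\<mu> k) t))"
    proof (intro AE_I2 summable_comparison_test[OF _ summable_mult2[OF abs_p]] exI allI impI)
      fix t k
      have "\<bar>frac_kernel \<sigma> (\<mu> k) t\<bar> \<le> t powr (\<sigma> - 1)"
      proof (cases "t > 0")
        case True
        then have "t powr (\<sigma> - 1) * (\<mu> k / (t + \<mu> k)) \<le> t powr (\<sigma> - 1) * 1"
          using \<mu>_nonneg[of k] by (intro mult_left_mono) (auto simp: field_simps)
        then show ?thesis
          using True \<mu>_nonneg[of k] by (simp add: frac_kernel_def)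
      qed (simp add: frac_kernel_def)
      then show "norm (norm (p k * frac_kernel \<sigma> (\<mu> k) t)) \<le> \<bar>p k\<bar> * t powr (\<sigma> - 1)"
        by (simp add: abs_mult mult_left_mono)
    qed
    have "(LINT t|lborel. norm (p k * frac_kernel \<sigma> (\<mu> k) t)) = C * (\<bar>p k\<bar> * \<mu> k powr \<sigma>)" for k
    proof -
      have "norm (p k * frac_kernel \<sigma> (\<mu> k) t) = \<bar>p k\<bar> * frac_kernel \<sigma> (\<mu> k) t" for t
        using \<mu>_nonneg[of k] by (cases "t > 0") (auto simp: frac_kernel_def abs_mult)
      then show ?thesis
        using frac_kernel_integral(2)[OF \<sigma> \<mu>_nonneg[of k]] by (simp add: C_def mult_ac)
    qed
    then show "summable (\<lambda>k. LINT t|lborel. norm (p k * frac_kernel \<sigma> (\<mu> k) t))"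
      using summable_mult[OF sum, of C] by (simp add: p_def)
  qed
  also have "\<dots> = (\<Sum>k. C * (p k * \<mu> k powr \<sigma>))"
    using frac_kernel_integral(2)[OF \<sigma> \<mu>_nonneg] by (simp add: C_def mult_ac)
  also have "\<dots> = C * (\<Sum>k. p k * \<mu> k powr \<sigma>)"
  proof (rule suminf_mult)
    have "summable (\<lambda>k. \<bar>p k * \<mu> k powr \<sigma>\<bar>)"
      using sum by (simp add: p_def abs_mult)
    then show "summable (\<lambda>k. p k * \<mu> k powr \<sigma>)"
      by (rule summable_rabs_cancel)
  qed
  finally have "C * (\<Sum>k. p k * \<mu> k powr \<sigma>) = (LINT t|lborel. (\<Sum>k. p k * frac_kernel \<sigma> (\<mu> k) t))"
    by simp
  also have "\<dots> \<le> (LINT t|(lborel :: real measure). 0)"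
  \<comment> \<open>This monotonicity rule asks integrability only of the larger function, here
    0.\<close>
  proof (rule integral_mono')
    fix t :: real
    show "(\<Sum>k. p k * frac_kernel \<sigma> (\<mu> k) t) \<le> 0"
    proof (cases "t > 0")
      case True
      have "summable (\<lambda>k. p k * (\<mu> k / (t + \<mu> k)))"
      proof (rule summable_comparison_test[OF _ abs_p], intro exI allI impI)
        fix k
        have "\<bar>p k\<bar> * (\<mu> k / (t + \<mu> k)) \<le> \<bar>p k\<bar> * 1"
          using True \<mu>_nonneg[of k] by (intro mult_left_mono) (auto simp: field_simps)
        then show "norm (p k * (\<mu> k / (t + \<mu> k))) \<le> \<bar>p k\<bar>"
          using True \<mu>_nonneg[of k] by (simp add: abs_mult)
      qed
      from suminf_mult[OF this, of "t powr (\<sigma> - 1)"]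
      have "(\<Sum>k. p k * frac_kernel \<sigma> (\<mu> k) t) = t powr (\<sigma> - 1) * (\<Sum>k. p k * (\<mu> k / (t + \<mu> k)))"
        using True by (simp add: frac_kernel_def mult_ac)
      then show ?thesis
        using S[OF True] by (simp add: mult_nonneg_nonpos)
    qed (simp add: frac_kernel_def)
  qed auto
  finally have "C * (\<Sum>k. p k * \<mu> k powr \<sigma>) \<le> 0"
    by simp
  then show ?thesis
    using C by (simp add: p_def mult_le_0_iff)
qed

text \<open>In coefficients \<mu>^s \<mu>^(1-s) = \<mu>, so the form of order 1 - s between g and
  \<eta> is, term by term, minus the L2 pairing of f with the Laplacian of \<eta>. Its series thus
  converges absolutely, as a pairing of two L2 functions.\<close>

lemma spectral_solution_subharmonic:
  assumes sol: "spectral_frac_laplacian \<Omega> \<mu> \<phi> s f g" and s: "0 < s" "s < 1"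
    and g: "\<And>x. x \<in> \<Omega> \<Longrightarrow> 0 \<le> g x"
    and \<eta>: "test_function \<Omega> \<eta>" "\<And>x. x \<in> \<Omega> \<Longrightarrow> 0 \<le> \<eta> x"
    and disj: "\<And>x. x \<in> \<Omega> \<Longrightarrow> g x * \<eta> x = 0"
  shows "f \<in> L2 \<Omega>" "0 \<le> ip f (laplacian \<eta>)"
proof -
  obtain c where c: "L2_sums \<Omega> \<phi> c f" and d: "L2_sums \<Omega> \<phi> (\<lambda>k. \<mu> k powr s * c k) g"
    using sol unfolding spectral_frac_laplacian_def by blast
  show f: "f \<in> L2 \<Omega>" using c unfolding L2_sums_def by (rule L2_lim_memD)
  have gL: "g \<in> L2 \<Omega>" using d unfolding L2_sums_def by (rule L2_lim_memD)
  note L = test_L2[OF test_function_laplacian[OF \<eta>(1)]]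
  have eq: "coef g k * coef \<eta> k * \<mu> k powr (1 - s) = - (coef f k * coef (laplacian \<eta>) k)" for k
  proof -
    have "\<mu> k powr s * \<mu> k powr (1 - s) = \<mu> k"
      using \<mu>_nonneg[of k] by (simp add: powr_add[symmetric])
    then have "\<mu> k powr s * c k * coef \<eta> k * \<mu> k powr (1 - s) = \<mu> k * (c k * coef \<eta> k)"
      by (metis (no_types, opaque_lifting) mult.assoc mult.commute)
    then show ?thesis
      unfolding laplacian_coef[OF \<eta>(1)] L2_sums_coef[OF c, symmetric] L2_sums_coef[OF d, symmetric] by simp
  qed
  have "(\<Sum>k. coef g k * coef \<eta> k * \<mu> k powr (1 - s)) \<le> 0"
  proof (rule fractional_form_nonpos[OF gL g test_L2[OF \<eta>(1)] \<eta>(2) disj])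
    have "\<bar>coef g k * coef \<eta> k\<bar> * \<mu> k powr (1 - s) = \<bar>coef f k * coef (laplacian \<eta>) k\<bar>" for k
      using arg_cong[OF eq[of k], of abs] by (simp add: abs_mult)
    then show "summable (\<lambda>k. \<bar>coef g k * coef \<eta> k\<bar> * \<mu> k powr (1 - s))"
      using coef_summable[OF f L] by simp
  qed (use s in auto)
  moreover have "(\<Sum>k. coef g k * coef \<eta> k * \<mu> k powr (1 - s)) = - ip f (laplacian \<eta>)"
    unfolding eq using parseval[OF f L] by (simp add: sums_iff suminf_minus)
  ultimately show "0 \<le> ip f (laplacian \<eta>)"
    by simp
qed

end

section \<open>Free boundaries\<close>

text \<open>\<open>strong_maximum_principle_cbox\<close> asks for a function on the whole space.
  Composing f with the projection onto the closed ball extends it continuously without creating new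
  values, and bumps of radius below R do not see the change.\<close>

lemma subharmonic_maximum:
  fixes f :: "'a::euclidean_space \<Rightarrow> real"
  assumes \<Omega>: "open \<Omega>" and f: "continuous_on \<Omega> f" and R: "R > 0" "cball c R \<subseteq> \<Omega>"
    and nonpos: "\<And>x. x \<in> cball c R \<Longrightarrow> f x \<le> 0" and zero: "f c = 0"
    and sub: "\<And>\<eta>. test_function (ball c R) \<eta> \<Longrightarrow> (\<And>x. 0 \<le> \<eta> x) \<Longrightarrow> 0 \<le> (LINT x|lebesgue_on \<Omega>. f x * laplacian \<eta> x)"
    and x: "x \<in> ball c R"
  shows "f x = 0"
proof -
  define g where "g y = f (closest_point (cball c R) y)" for y
  have in_cball: "closest_point (cball c R) y \<in> cball c R" for y
    using R by (intro closest_point_in_set) auto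
  have g: "g y = f y" if "y \<in> cball c R" for y
    using that by (simp add: g_def closest_point_self)
  have cont_g: "continuous_on UNIV g"
    unfolding g_def
    by (rule continuous_on_compose2[OF f continuous_on_closest_point]) (use R in_cball in auto)
  obtain a b where ab: "cball c R \<subseteq> cbox a b"
    using bounded_subset_cbox_symmetric[OF bounded_cball] by metis
  have "g x = 0"
  proof (rule strong_maximum_principle_cbox[OF R(1) cont_g _ _ ab _ x])
    show "g y \<le> 0" for y
      unfolding g_def by (rule nonpos[OF in_cball])
    show "g c = 0"
      using R zero by (simp add: g)
    fix r assume r: "0 < r" "r < R"
    let ?\<eta> = "bump 1 c r"
    have \<eta>: "test_function (ball c R) ?\<eta>"
      by (rule test_function_bump[OF r(1)]) (use r in auto)
    have out: "laplacian ?\<eta> y = 0" if "y \<notin> cball c R" for y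
      using bump_eq_0[OF r(1), of y c] that r by (simp add: laplacian_bump)
    have cont: "continuous_on UNIV (\<lambda>y. g y * laplacian ?\<eta> y)"
      by (rule continuous_on_mult[OF cont_g smooth_on_continuous[OF smooth_on_laplacian[OF smooth_on_bump]]])
    have "0 \<le> (LINT y|lebesgue_on \<Omega>. f y * laplacian ?\<eta> y)"
      by (rule sub[OF \<eta>]) (rule bump_nonneg, simp)
    also have "\<dots> = (LINT y|lebesgue_on \<Omega>. g y * laplacian ?\<eta> y)"
    proof (rule Bochner_Integration.integral_cong[OF refl])
      show "f y * laplacian ?\<eta> y = g y * laplacian ?\<eta> y" for y
        using g[of y] out[of y] by (cases "y \<in> cball c R") auto
    qed
    also have "\<dots> = (LINT y|lborel. g y * laplacian ?\<eta> y)"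
    proof (rule integral_lebesgue_on_test_function[OF \<Omega> cont])
      fix y assume "y \<notin> \<Omega>"
      then have "y \<notin> cball c R" using R by blast
      from out[OF this] show "g y * laplacian ?\<eta> y = 0"
        by (simp only: mult_zero_right)
    qed
    also have "\<dots> = integral UNIV (\<lambda>y. g y * laplacian ?\<eta> y)"
    proof (rule integral_lborel[symmetric])
      show "integrable lborel (\<lambda>y. g y * laplacian ?\<eta> y)"
        by (rule integrable_lborel_compact_support[OF compact_cball[of c R] cont]) (drule out, simp only: mult_zero_right)
    qed
    also have "(\<lambda>y. g y * laplacian ?\<eta> y) = (\<lambda>y. if y \<in> cbox a b then g y * laplacian ?\<eta> y else 0)"
    proof
      show "g y * laplacian ?\<eta> y = (if y \<in> cbox a b then g y * laplacian ?\<eta> y else 0)" for y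
        using out[of y] ab by (cases "y \<in> cball c R") auto
    qed
    also have "integral UNIV \<dots> = integral (cbox a b) (\<lambda>y. g y * laplacian ?\<eta> y)"
      by (rule Henstock_Kurzweil_Integration.integral_restrict_UNIV)
    finally show "0 \<le> integral (cbox a b) (\<lambda>y. g y * laplacian ?\<eta> y)" .
  qed
  then show ?thesis
    using x by (simp add: g)
qed

text \<open>At a boundary point c of the relatively open set {f < 0} one has f c >= 0, and f c > 0
  would make f positive nearby. If c is no boundary point of {f > 0}, then f <= 0 on a ball around
  c, every nonnegative test function supported in that ball is admissible in \<open>sub\<close>, and
  f vanishes on the ball although c is a limit of points with f < 0.\<close>

lemma subharmonic_free_boundary:
  fixes f :: "'a::euclidean_space \<Rightarrow> real"
  assumes \<Omega>: "open \<Omega>" and f: "continuous_on \<Omega> f"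
    and sub: "\<And>\<eta>. test_function \<Omega> \<eta> \<Longrightarrow> (\<And>x. 0 \<le> \<eta> x) \<Longrightarrow> (\<And>x. \<eta> x \<noteq> 0 \<Longrightarrow> f x \<le> 0) \<Longrightarrow>
      0 \<le> (LINT x|lebesgue_on \<Omega>. f x * laplacian \<eta> x)"
  shows "top_of_set \<Omega> frontier_of {x\<in>\<Omega>. f x < 0} \<subseteq> top_of_set \<Omega> frontier_of {x\<in>\<Omega>. f x > 0}"
proof
  fix c assume c: "c \<in> top_of_set \<Omega> frontier_of {x\<in>\<Omega>. f x < 0}"
  have op: "openin (top_of_set \<Omega>) {x\<in>\<Omega>. f x < 0}" "openin (top_of_set \<Omega>) {x\<in>\<Omega>. f x > 0}"
    using continuous_openin_preimage_gen[OF f open_lessThan[of 0]] continuous_openin_preimage_gen[OF f open_greaterThan[of 0]]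
    by (simp_all add: vimage_def Int_def)
  have c\<Omega>: "c \<in> \<Omega>" and c_ge: "f c \<ge> 0"
    and c_cl: "\<And>T. c \<in> T \<Longrightarrow> openin (top_of_set \<Omega>) T \<Longrightarrow> \<exists>y\<in>T. y \<in> \<Omega> \<and> f y < 0"
    using c interior_of_openin[OF op(1)] unfolding frontier_of_def in_closure_of by (auto simp: in_closure_of)
  show "c \<in> top_of_set \<Omega> frontier_of {x\<in>\<Omega>. f x > 0}"
  proof (rule ccontr)
    assume nc: "c \<notin> top_of_set \<Omega> frontier_of {x\<in>\<Omega>. f x > 0}"
    have "f c \<le> 0"
    proof (rule ccontr)
      assume "\<not> f c \<le> 0"
      then show False
        using c_cl[OF _ op(2)] c\<Omega> by auto
    qed
    with c_ge have c0: "f c = 0" by simp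
    then have "c \<notin> top_of_set \<Omega> closure_of {x\<in>\<Omega>. f x > 0}"
      using nc interior_of_openin[OF op(2)] by (auto simp: frontier_of_def)
    then obtain T where T: "c \<in> T" "openin (top_of_set \<Omega>) T" "\<And>y. y \<in> T \<Longrightarrow> \<not> (y \<in> \<Omega> \<and> f y > 0)"
      using c\<Omega> by (auto simp: in_closure_of)
    then have "open T" "T \<subseteq> \<Omega>"
      using \<Omega> by (auto simp: openin_open_eq)
    then obtain R where R: "R > 0" "cball c R \<subseteq> T"
      using T(1) open_contains_cball by blast
    have nonpos: "f y \<le> 0" if "y \<in> cball c R" for y
      using T(3)[of y] that R \<open>T \<subseteq> \<Omega>\<close> by force
    have "f y = 0" if "y \<in> ball c R" for y
    proof (rule subharmonic_maximum[OF \<Omega> f R(1) _ nonpos c0 _ that])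
      show "cball c R \<subseteq> \<Omega>" using R \<open>T \<subseteq> \<Omega>\<close> by blast
      fix \<eta> assume \<eta>: "test_function (ball c R) \<eta>" "\<And>x. 0 \<le> \<eta> x"
      have "ball c R \<subseteq> \<Omega>" using R \<open>T \<subseteq> \<Omega>\<close> ball_subset_cball by blast
      obtain K where "K \<subseteq> ball c R" "\<And>x. x \<notin> K \<Longrightarrow> \<eta> x = 0"
        using test_functionE[OF \<eta>(1)] by metis
      then have "f x \<le> 0" if "\<eta> x \<noteq> 0" for x
        using that nonpos[of x] by (meson ball_subset_cball subsetD)
      then show "0 \<le> (LINT x|lebesgue_on \<Omega>. f x * laplacian \<eta> x)"
        using sub[OF test_function_mono[OF \<eta>(1) \<open>ball c R \<subseteq> \<Omega>\<close>] \<eta>(2)] by blast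
    qed
    moreover have "openin (top_of_set \<Omega>) (ball c R)"
      using R \<open>T \<subseteq> \<Omega>\<close> ball_subset_cball by (intro open_subset open_ball) blast
    ultimately show False
      using c_cl[of "ball c R"] R(1) by force
  qed
qed

text \<open>Subtracting the constant \<gamma> from w therefore leaves the pairing with a Laplacian
  unchanged. The reason is integration by parts against the constant 1.\<close>

lemma integral_laplacian_test_function:
  assumes \<Omega>: "open \<Omega>" and \<eta>: "test_function \<Omega> \<eta>"
  shows "(LINT x|lebesgue_on \<Omega>. laplacian \<eta> x) = 0"
proof -
  obtain K where K: "compact K" "K \<subseteq> \<Omega>" "\<And>x. x \<notin> K \<Longrightarrow> laplacian \<eta> x = 0"
    using test_functionE[OF test_function_laplacian[OF \<eta>]] by blast
  have "(LINT x|lebesgue_on \<Omega>. laplacian \<eta> x) = (LINT x|lborel. laplacian \<eta> x)"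
  proof (rule integral_lebesgue_on_test_function[OF \<Omega>])
    show "continuous_on UNIV (laplacian \<eta>)"
      by (intro smooth_on_continuous smooth_on_laplacian test_function_smooth[OF \<eta>])
    show "laplacian \<eta> x = 0" if "x \<notin> \<Omega>" for x
      using K that by blast
  qed
  also have "\<dots> = (\<Sum>b\<in>Basis. LINT x|lborel. dir_deriv b (dir_deriv b \<eta>) x)"
    unfolding laplacian_def
  proof (rule Bochner_Integration.integral_sum)
    fix b
    obtain L where L: "compact L" "L \<subseteq> \<Omega>" "\<And>x. x \<notin> L \<Longrightarrow> dir_deriv b (dir_deriv b \<eta>) x = 0"
      using test_functionE[OF test_function_dir_deriv[OF test_function_dir_deriv[OF \<eta>]]] by blast
    show "integrable lborel (dir_deriv b (dir_deriv b \<eta>))"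
      by (rule integrable_lborel_compact_support[OF L(1) _ L(3)])
        (intro smooth_on_continuous smooth_on_dir_deriv test_function_smooth[OF \<eta>])
  qed
  also have "\<dots> = 0"
    using integral_by_parts_dir_deriv[OF smooth_on_const[of 1] test_function_dir_deriv[OF \<eta>]] by simp
  finally show ?thesis .
qed

theorem proposition5p1:
  fixes \<Omega> :: "(real ^ 'n) set" and s lam :: real
  assumes "smooth_bounded_domain \<Omega>" and "0 < s" and "s < 1" and "lam > 0"
  shows
    "(\<forall>u Du u0.
        thin_eigen_solution \<Omega> (1 - 2 * s) lam u Du u0 \<and>
        (AE z in lebesgue_on (\<Omega> \<times> {0<..}). snd (Du z) \<le> 0) \<longrightarrow>
        top_of_set \<Omega> frontier_of {x\<in>\<Omega>. u0 x < 0} \<subseteq>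
        top_of_set \<Omega> frontier_of {x\<in>\<Omega>. u0 x > 0}) \<and>
     (\<forall>\<mu> \<phi> w \<gamma>.
        dirichlet_eigensystem \<Omega> \<mu> \<phi> \<and> \<gamma> > 0 \<and> continuous_on \<Omega> w \<and>
        spectral_frac_laplacian \<Omega> \<mu> \<phi> s w (\<lambda>x. lam * max (w x - \<gamma>) 0) \<longrightarrow>
        top_of_set \<Omega> frontier_of {x\<in>\<Omega>. w x < \<gamma>} \<subseteq>
        top_of_set \<Omega> frontier_of {x\<in>\<Omega>. w x > \<gamma>})"
proof (intro conjI allI impI; elim conjE)
  have \<Omega>: "open \<Omega>" "bounded \<Omega>"
    using assms(1) by (auto simp: smooth_bounded_domain_def)
  {
    fix u Du u0
    assume sol: "thin_eigen_solution \<Omega> (1 - 2 * s) lam u Du u0"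
      and mono: "AE z in lebesgue_on (\<Omega> \<times> {0<..}). snd (Du z) \<le> 0"
    show "top_of_set \<Omega> frontier_of {x\<in>\<Omega>. u0 x < 0} \<subseteq> top_of_set \<Omega> frontier_of {x\<in>\<Omega>. u0 x > 0}"
    proof (rule subharmonic_free_boundary[OF \<Omega>(1)])
      show "continuous_on \<Omega> u0"
        using sol by (simp add: thin_eigen_solution_def)
      show "0 \<le> (LINT x|lebesgue_on \<Omega>. u0 x * laplacian \<eta> x)"
        if "test_function \<Omega> \<eta>" "\<And>x. 0 \<le> \<eta> x" "\<And>x. \<eta> x \<noteq> 0 \<Longrightarrow> u0 x \<le> 0" for \<eta>
        by (rule thin_eigen_trace_subharmonic[OF \<Omega> _ _ sol mono that]) (use assms in auto)
    qed
  next
    fix \<mu> \<phi> w \<gamma>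
    assume eig: "dirichlet_eigensystem \<Omega> \<mu> \<phi>" and w: "continuous_on \<Omega> w"
      and sol: "spectral_frac_laplacian \<Omega> \<mu> \<phi> s w (\<lambda>x. lam * max (w x - \<gamma>) 0)"
    interpret eigensystem \<Omega> \<mu> \<phi>
      using \<Omega> eig by unfold_locales
    have "top_of_set \<Omega> frontier_of {x\<in>\<Omega>. w x - \<gamma> < 0} \<subseteq> top_of_set \<Omega> frontier_of {x\<in>\<Omega>. w x - \<gamma> > 0}"
    proof (rule subharmonic_free_boundary[OF \<Omega>(1)])
      show "continuous_on \<Omega> (\<lambda>x. w x - \<gamma>)"
        by (intro continuous_intros w)
      fix \<eta> assume \<eta>: "test_function \<Omega> \<eta>" "\<And>x. 0 \<le> \<eta> x" "\<And>x. \<eta> x \<noteq> 0 \<Longrightarrow> w x - \<gamma> \<le> 0"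
      \<comment> \<open>Where \<eta> is nonzero the right-hand side of the equation is zero: this is
        the disjointness of supports behind the sign of the fractional form.\<close>
      have "lam * max (w x - \<gamma>) 0 * \<eta> x = 0" for x
        using \<eta>(3)[of x] by (cases "\<eta> x = 0") auto
      note sub = spectral_solution_subharmonic[OF sol assms(2,3) _ \<eta>(1) \<eta>(2) this]
      have wL: "w \<in> L2 \<Omega>" and nonneg: "0 \<le> ip w (laplacian \<eta>)"
        using sub assms(4) by auto
      have one: "(\<lambda>x. 1::real) \<in> L2 \<Omega>"
        by (rule L2_bounded[where C=1]) (use \<Omega> in \<open>auto intro: lmeasurable_open\<close>)
      note L = test_L2[OF test_function_laplacian[OF \<eta>(1)]]
      have "(LINT x|lebesgue_on \<Omega>. (w x - \<gamma>) * laplacian \<eta> x) =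
          ip w (laplacian \<eta>) - \<gamma> * (LINT x|lebesgue_on \<Omega>. laplacian \<eta> x)"
        using L2_inner_integrable[OF wL L] L2_inner_integrable[OF one L]
        by (simp add: L2_inner_def left_diff_distrib)
      then show "0 \<le> (LINT x|lebesgue_on \<Omega>. (w x - \<gamma>) * laplacian \<eta> x)"
        using nonneg integral_laplacian_test_function[OF \<Omega>(1) \<eta>(1)] by simp
    qed
    then show "top_of_set \<Omega> frontier_of {x\<in>\<Omega>. w x < \<gamma>} \<subseteq> top_of_set \<Omega> frontier_of {x\<in>\<Omega>. w x > \<gamma>}"
      by simp
  }
qed

end
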